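(* Let $f$ and $g$ be two admissible free holomorphic functions and let ${\bf W}^{(f)}=(W_1^{(f)},\ldots,W_n^{(f)})$ and ${\bf W}^{(g)}=(W_1^{(g)},\ldots,W_n^{(g)})$ be the associated universal models. Assume that $\mathcal D_{g^{-1}}$ is a regular domain and $\mathcal D^{pure}_{f^{-1}}\subset\mathcal D^{pure}_{g^{-1}}$. Let $\mathcal E,\mathcal E_*$ be Hilbert spaces, let $\mathcal G_1\subset F^2(H_n)\otimes\mathcal E$ be a co-invariant subspace under each operator $W_i^{(g)}\otimes I_{\mathcal E}$ and let $\mathcal G_2\subset F^2(H_n)\otimes\mathcal E_*$ be a co-invariant subspace under each operator $W_i^{(f)}\otimes I_{\mathcal E_*}$. If $X\in B(\mathcal G_1,\mathcal G_2)$ is a contraction such that $$X[P_{\mathcal G_1}(W_i^{(g)}\otimes I_{\mathcal E})|_{\mathcal G_1}]=[P_{\mathcal G_2}(W_i^{(f)}\otimes I_{\mathcal E_*})|_{\mathcal G_2}]X,\qquad i\in\{1,\ldots,n\},$$ then there is a contractive operator $\Gamma:F^2(H_n)\otimes\mathcal E\to F^2(H_n)\otimes\mathcal E_*$ such that $$\Gamma(W_i^{(g)}\otimes I_{\mathcal E})=(W_i^{(f)}\otimes I_{\mathcal E_*})\Gamma,\qquad i\in\{1,\ldots,n\},$$ $X^*=\Gamma^*|_{\mathcal G_2}$, and $\|\Gamma\|=\|X\|$. Moreover, there is a Hilbert space $\mathcal F$, a contractive multi-analytic operator $\Phi\in R^\infty(g)\bar\otimes_{min}B(\mathcal E,\mathcal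 F)$ and a co-isometric multi-analytic operator $F:F^2(H_n)\otimes\mathcal F\to F^2(H_n)\otimes\mathcal E_*$ such that $$F(W_i^{(g)}\otimes I_{\mathcal F})=(W_i^{(f)}\otimes I_{\mathcal E_*})F,\qquad i\in\{1,\ldots,n\},$$ and $\Gamma=F\Phi$.
   Context: Fix an integer $n\ge 1$ and an $n$-dimensional complex Hilbert space $H_n$ with orthonormal basis $e_1,\ldots,e_n$. The full Fock space is $F^2(H_n)=\bigoplus_{k\ge0}H_n^{\otimes k}$, $H_n^{\otimes 0}=\mathbb C1$; left creation operators: $S_i\varphi=e_i\otimes\varphi$. $\mathbb F_n^+$ is the unital free semigroup on generators $g_1,\ldots,g_n$ with identity $g_0$; $|\alpha|$ is the length of $\alpha$. For $\alpha=g_{i_1}\cdots g_{i_k}$ put $e_\alpha=e_{i_1}\otimes\cdots\otimes e_{i_k}$, $e_{g_0}=1$, and for operators or indeterminates $X_\alpha=X_{i_1}\cdots X_{i_k}$, $X_{g_0}=I$. A formal power series $g=1+\sum_{|\alpha|\ge1}b_\alpha Z_\alpha$ in noncommuting indeterminates is an admissible free holomorphic function if: (a) $b_\alpha>0$, $b_{g_0}=1$, $\sup_{\alpha}\frac{b_\alpha}{b_{g_i\alpha}}<\infty$ for each $i$; (b) $\limsup_{k}(\sum_{|\alpha|=k}b_\alpha^2)^{1/2k}<\infty$; (c) $\sup_{k}\|\sum_{p=0}^k\sum_{|\alpha|=p}a_\alpha W_\alpha W_\alpha^*\|<\infty$, where $g^{-1}=1+\sum_{|\alpha|\ge1}a_\alpha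 Z_\alpha$ is the formal power series inverse and ${\bf W}^{(g)}=(W_1,\ldots,W_n)$, the universal model of $g$, is given by $W_i=S_iD_i$, $D_ie_\alpha=\sqrt{b_\alpha/b_{g_i\alpha}}\,e_\alpha$. For a Hilbert space $\mathcal H$, $\mathcal D_{g^{-1}}(\mathcal H)$ is the set of $X=(X_1,\ldots,X_n)\in B(\mathcal H)^n$ such that (i) $\Delta_{g^{-1}}(X,X^* ):=\sum_{p=0}^\infty\sum_{|\alpha|=p}a_\alpha X_\alpha X_\alpha^*$ converges in the weak operator topology (WOT) and is $\ge0$; (ii) $\sum_{\alpha}b_\alpha X_\alpha\Delta_{g^{-1}}(X,X^* )X_\alpha^*\le I$ (WOT convergence). $X$ is pure if equality holds in (ii); $\mathcal D^{pure}_{g^{-1}}(\mathcal H)$ is the set of pure elements. $\mathcal D^{pure}_{f^{-1}}\subset\mathcal D^{pure}_{g^{-1}}$ means the inclusion holds over every Hilbert space $\mathcal H$. $\mathcal D_{g^{-1}}$ is a regular domain if $a_\alpha\le0$ for all $|\alpha|\ge1$ and $a_{g_i}<0$ for all $i$. A closed subspace is co-invariant under an operator $A$ if it is invariant under $A^*$; $P_{\mathcal G}$ denotes the orthogonal projection onto $\mathcal G$. Multi-analytic operators are those intertwining the (ampliated) universal models as displayed; for $\Phi$ this means $\Phi(W_i^{(g)}\otimes I_{\mathcal E})=(W_i^{(g)}\otimes I_{\mathcal F})\Phi$ for all $i$. $R^\infty(g)$ is the noncommutative Hardy algebra equal to the commutant $\{W_1^{(g)},\ldots,W_n^{(g)}\}'$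 in $B(F^2(H_n))$, and $R^\infty(g)\bar\otimes_{min}B(\mathcal E,\mathcal F)$ is the WOT-closed linear span of $\{\psi\otimes Y:\psi\in R^\infty(g),\,Y\in B(\mathcal E,\mathcal F)\}$ in $B(F^2(H_n)\otimes\mathcal E,F^2(H_n)\otimes\mathcal F)$. *)

theory Defs
  imports "HOL-Analysis.Analysis"
begin

section \<open>Complex Hilbert spaces\<close>

text \<open>
  The distribution only has real inner product spaces.  The class below adds a complex
  scalar multiplication and a sesquilinear form (linear in the first argument) whose real part
  is the inherited real inner product, so that \<open>norm x = sqrt (Re (cinner x x))\<close>.
\<close>

class scaleC = scaleR +
  fixes scaleC :: "complex \<Rightarrow> 'a \<Rightarrow> 'a" (infixr \<open>*\<^sub>C\<close> 75)

class chilbert_space = real_inner + complete_space + scaleC +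
  fixes cinner :: "'a \<Rightarrow> 'a \<Rightarrow> complex"
  assumes scaleC_of_real: "complex_of_real r *\<^sub>C x = r *\<^sub>R x"
    and scaleC_add_right: "c *\<^sub>C (x + y) = c *\<^sub>C x + c *\<^sub>C y"
    and scaleC_add_left: "(c + d) *\<^sub>C x = c *\<^sub>C x + d *\<^sub>C x"
    and scaleC_scaleC: "c *\<^sub>C d *\<^sub>C x = (c * d) *\<^sub>C x"
    and cinner_commute: "cinner x y = cnj (cinner y x)"
    and cinner_add_left: "cinner (x + y) z = cinner x z + cinner y z"
    and cinner_scaleC_left: "cinner (c *\<^sub>C x) y = c * cinner x y"
    and Re_cinner: "Re (cinner x y) = inner x y"

instantiation complex :: chilbert_space
begin

definition scaleC_complex :: "complex \<Rightarrow> complex \<Rightarrow> complex"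
  where "scaleC_complex c x = c * x"

definition cinner_complex :: "complex \<Rightarrow> complex \<Rightarrow> complex"
  where "cinner_complex x y = x * cnj y"

instance
  by standard
    (auto simp: scaleC_complex_def cinner_complex_def inner_complex_def algebra_simps
      scaleR_conv_of_real)

end

instantiation prod :: (chilbert_space, chilbert_space) chilbert_space
begin

definition scaleC_prod :: "complex \<Rightarrow> 'a \<times> 'b \<Rightarrow> 'a \<times> 'b"
  where "scaleC_prod c x = (c *\<^sub>C fst x, c *\<^sub>C snd x)"

definition cinner_prod :: "'a \<times> 'b \<Rightarrow> 'a \<times> 'b \<Rightarrow> complex"
  where "cinner_prod x y = cinner (fst x) (fst y) + cinner (snd x) (snd y)"

instance
proof
  fix x y :: "'a \<times> 'b"
  show "cinner x y = cnj (cinner y x)"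
    unfolding cinner_prod_def complex_cnj_add
    by (metis cinner_commute)
qed (auto simp: scaleC_prod_def cinner_prod_def inner_prod_def algebra_simps scaleC_of_real
      scaleC_add_right scaleC_add_left scaleC_scaleC cinner_add_left cinner_scaleC_left Re_cinner
      scaleR_prod_def)

end

lemma scaleC_zero_right [simp]: "c *\<^sub>C (0::'a::chilbert_space) = 0"
  using scaleC_add_right[of c 0 "0::'a"] by simp

lemma norm_scaleC: "norm (c *\<^sub>C (x::'a::chilbert_space)) = cmod c * norm x"
proof -
  have r: "cinner x (c *\<^sub>C y) = cnj c * cinner x y" for x y :: 'a
    using cinner_commute[of x "c *\<^sub>C y"] cinner_commute[of x y] by (simp add: cinner_scaleC_left)
  have "cinner (c *\<^sub>C x) (c *\<^sub>C x) = complex_of_real ((cmod c)\<^sup>2) * cinner x x"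
    by (simp only: r cinner_scaleC_left complex_norm_square) (simp add: algebra_simps)
  then have "inner (c *\<^sub>C x) (c *\<^sub>C x) = (cmod c)\<^sup>2 * inner x x"
    using Re_cinner[of "c *\<^sub>C x" "c *\<^sub>C x"] Re_cinner[of x x] by simp
  then show ?thesis by (simp add: norm_eq_sqrt_inner real_sqrt_mult)
qed

lemma cmod_cinner_le:
  fixes x y :: "'a::chilbert_space"
  shows "cmod (cinner x y) \<le> (norm x)\<^sup>2 + (norm y)\<^sup>2"
proof -
  have i: "Im (cinner x y) = inner ((- \<i>) *\<^sub>C x) y"
    by (simp add: Re_cinner[symmetric] cinner_scaleC_left)
  have 1: "\<bar>Re (cinner x y)\<bar> \<le> norm x * norm y"
    by (simp add: Re_cinner Cauchy_Schwarz_ineq2)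
  have 2: "\<bar>Im (cinner x y)\<bar> \<le> norm x * norm y"
    unfolding i using Cauchy_Schwarz_ineq2[of "(- \<i>) *\<^sub>C x" y] by (simp add: norm_scaleC)
  have "cmod (cinner x y) \<le> \<bar>Re (cinner x y)\<bar> + \<bar>Im (cinner x y)\<bar>"
    by (rule cmod_le)
  also have "\<dots> \<le> norm x * norm y + norm x * norm y"
    by (rule add_mono[OF 1 2])
  also have "\<dots> \<le> (norm x)\<^sup>2 + (norm y)\<^sup>2"
    using sum_squares_bound[of "norm x" "norm y"] by simp
  finally show ?thesis .
qed


section \<open>Hilbert direct sums\<close>

text \<open>The Hilbert space of square-summable families in \<open>'e\<close> indexed by \<open>'i\<close>.\<close>

typedef (overloaded) ('i, 'e) ell2 =
  "{f :: 'i \<Rightarrow> 'e::chilbert_space. (\<lambda>i. (norm (f i))\<^sup>2) summable_on UNIV}"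
  morphisms ell2_nth Abs_ell2
  by (rule exI[of _ "\<lambda>_. 0"]) simp

setup_lifting type_definition_ell2

lemma sq_summable_add:
  fixes f g :: "'i \<Rightarrow> 'e::real_normed_vector"
  assumes "(\<lambda>i. (norm (f i))\<^sup>2) summable_on UNIV" "(\<lambda>i. (norm (g i))\<^sup>2) summable_on UNIV"
  shows "(\<lambda>i. (norm (f i + g i))\<^sup>2) summable_on UNIV"
proof (rule summable_on_comparison_test)
  show "(\<lambda>i. 2 * (norm (f i))\<^sup>2 + 2 * (norm (g i))\<^sup>2) summable_on UNIV"
    using assms by (intro summable_on_add summable_on_cmult_right)
  fix i
  have "(norm (f i + g i))\<^sup>2 \<le> (norm (f i) + norm (g i))\<^sup>2"
    by (intro power_mono norm_triangle_ineq norm_ge_zero)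
  also have "\<dots> \<le> 2 * (norm (f i))\<^sup>2 + 2 * (norm (g i))\<^sup>2"
    using sum_squares_bound[of "norm (f i)" "norm (g i)"] by (simp add: power2_sum)
  finally show "(norm (f i + g i))\<^sup>2 \<le> 2 * (norm (f i))\<^sup>2 + 2 * (norm (g i))\<^sup>2" .
qed simp

lemma sq_summable_scaleC:
  fixes f :: "'i \<Rightarrow> 'e::chilbert_space"
  assumes "(\<lambda>i. (norm (f i))\<^sup>2) summable_on UNIV"
  shows "(\<lambda>i. (norm (c *\<^sub>C f i))\<^sup>2) summable_on UNIV"
  using summable_on_cmult_right[OF assms, of "(cmod c)\<^sup>2"]
  by (simp add: norm_scaleC power_mult_distrib)

lemma cinner_summable:
  fixes f g :: "'i \<Rightarrow> 'e::chilbert_space"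
  assumes "(\<lambda>i. (norm (f i))\<^sup>2) summable_on UNIV" "(\<lambda>i. (norm (g i))\<^sup>2) summable_on UNIV"
  shows "(\<lambda>i. cinner (f i) (g i)) summable_on UNIV"
proof -
  have "(\<lambda>i. (norm (f i))\<^sup>2 + (norm (g i))\<^sup>2) summable_on UNIV"
    using assms by (intro summable_on_add)
  then have "(\<lambda>i. norm (cinner (f i) (g i))) summable_on UNIV"
    by (rule summable_on_comparison_test) (auto simp: cmod_cinner_le)
  then show ?thesis by (rule abs_summable_summable)
qed

instantiation ell2 :: (type, chilbert_space) real_inner
begin

lift_definition zero_ell2 :: "('a, 'b) ell2" is "\<lambda>_. 0" by simp

lift_definition plus_ell2 :: "('a, 'b) ell2 \<Rightarrow> ('a, 'b) ell2 \<Rightarrow> ('a, 'b) ell2"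
  is "\<lambda>f g i. f i + g i" by (rule sq_summable_add)

lift_definition uminus_ell2 :: "('a, 'b) ell2 \<Rightarrow> ('a, 'b) ell2"
  is "\<lambda>f i. - f i" by simp

lift_definition minus_ell2 :: "('a, 'b) ell2 \<Rightarrow> ('a, 'b) ell2 \<Rightarrow> ('a, 'b) ell2"
  is "\<lambda>f g i. f i - g i"
proof -
  fix f g :: "'a \<Rightarrow> 'b"
  assume "(\<lambda>i. (norm (f i))\<^sup>2) summable_on UNIV" "(\<lambda>i. (norm (g i))\<^sup>2) summable_on UNIV"
  then show "(\<lambda>i. (norm (f i - g i))\<^sup>2) summable_on UNIV"
    using sq_summable_add[of f "\<lambda>i. - g i"] by simp
qed

lift_definition scaleR_ell2 :: "real \<Rightarrow> ('a, 'b) ell2 \<Rightarrow> ('a, 'b) ell2"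
  is "\<lambda>r f i. r *\<^sub>R f i"
  unfolding scaleC_of_real[symmetric] by (rule sq_summable_scaleC)

definition inner_ell2 :: "('a, 'b) ell2 \<Rightarrow> ('a, 'b) ell2 \<Rightarrow> real"
  where "inner_ell2 f g = (\<Sum>\<^sub>\<infinity>i. inner (ell2_nth f i) (ell2_nth g i))"

definition norm_ell2 :: "('a, 'b) ell2 \<Rightarrow> real"
  where "norm_ell2 f = sqrt (inner f f)"

definition dist_ell2 :: "('a, 'b) ell2 \<Rightarrow> ('a, 'b) ell2 \<Rightarrow> real"
  where "dist_ell2 f g = norm (f - g)"

definition sgn_ell2 :: "('a, 'b) ell2 \<Rightarrow> ('a, 'b) ell2"
  where "sgn_ell2 f = inverse (norm f) *\<^sub>R f"

definition uniformity_ell2 :: "(('a, 'b) ell2 \<times> ('a, 'b) ell2) filter"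
  where "uniformity_ell2 = (INF e\<in>{0<..}. principal {(x, y). dist x y < e})"

definition open_ell2 :: "('a, 'b) ell2 set \<Rightarrow> bool"
  where "open_ell2 U \<longleftrightarrow> (\<forall>x\<in>U. \<forall>\<^sub>F (x', y) in uniformity. x' = x \<longrightarrow> y \<in> U)"

lemma ell2_sq_summable: "(\<lambda>i. (norm (ell2_nth f i))\<^sup>2) summable_on UNIV"
  for f :: "('a, 'b) ell2"
  using ell2_nth[of f] by simp

lemma ell2_cinner_summable: "(\<lambda>i. cinner (ell2_nth f i) (ell2_nth g i)) summable_on UNIV"
  for f g :: "('a, 'b) ell2"
  by (intro cinner_summable ell2_sq_summable)

lemma ell2_inner_summable: "(\<lambda>i. inner (ell2_nth f i) (ell2_nth g i)) summable_on UNIV"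
  for f g :: "('a, 'b) ell2"
  using summable_on_Re[OF ell2_cinner_summable[of f g]] by (simp add: Re_cinner)

lemma inner_ell2_self: "inner f f = (\<Sum>\<^sub>\<infinity>i. (norm (ell2_nth f i))\<^sup>2)"
  for f :: "('a, 'b) ell2"
  unfolding inner_ell2_def by (simp add: power2_norm_eq_inner)

instance
proof
  fix f g h :: "('a, 'b) ell2" and r s :: real
  show "f + g + h = f + (g + h)" by transfer (simp add: add.assoc)
  show "f + g = g + f" by transfer (simp add: add.commute)
  show "0 + f = f" by transfer simp
  show "- f + f = 0" by transfer simp
  show "f - g = f + - g" by transfer simp
  show "r *\<^sub>R (f + g) = r *\<^sub>R f + r *\<^sub>R g" by transfer (simp add: scaleR_add_right)
  show "(r + s) *\<^sub>R f = r *\<^sub>R f + s *\<^sub>R f" by transfer (simp add: scaleR_add_left)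
  show "r *\<^sub>R s *\<^sub>R f = (r * s) *\<^sub>R f" by transfer simp
  show "1 *\<^sub>R f = f" by transfer simp
  show "inner f g = inner g f" by (simp add: inner_ell2_def inner_commute)
  show "inner (f + g) h = inner f h + inner g h"
    unfolding inner_ell2_def plus_ell2.rep_eq inner_add_left
    by (intro infsum_add ell2_inner_summable)
  show "inner (r *\<^sub>R f) g = r * inner f g"
    unfolding inner_ell2_def scaleR_ell2.rep_eq inner_scaleR_left
    by (intro infsum_cmult_right ell2_inner_summable)
  show "0 \<le> inner f f"
    unfolding inner_ell2_self by (rule infsum_nonneg) simp
  show "inner f f = 0 \<longleftrightarrow> f = 0"
  proof
    assume *: "inner f f = 0"
    have "(norm (ell2_nth f i))\<^sup>2 = 0" for i
      by (rule nonneg_infsum_le_0D[where A = UNIV and f = "\<lambda>i. (norm (ell2_nth f i))\<^sup>2"])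
        (use * in \<open>auto simp: ell2_sq_summable inner_ell2_self[symmetric]\<close>)
    then show "f = 0"
      by (intro ell2_nth_inject[THEN iffD1]) (auto simp: zero_ell2.rep_eq)
  qed (simp add: inner_ell2_self zero_ell2.rep_eq)
  show "norm f = sqrt (inner f f)" by (rule norm_ell2_def)
  show "dist f g = norm (f - g)" by (rule dist_ell2_def)
  show "sgn f = inverse (norm f) *\<^sub>R f" by (rule sgn_ell2_def)
  show "uniformity = (INF e\<in>{0<..}. principal {(x, y::('a, 'b) ell2). dist x y < e})"
    by (rule uniformity_ell2_def)
  show "open U \<longleftrightarrow> (\<forall>x\<in>U. \<forall>\<^sub>F (x', y) in uniformity. x' = x \<longrightarrow> y \<in> U)"
    for U :: "('a, 'b) ell2 set" by (rule open_ell2_def)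
qed

end

lemma ell2_norm_sq: "(norm f)\<^sup>2 = (\<Sum>\<^sub>\<infinity>i. (norm (ell2_nth f i))\<^sup>2)"
  by (simp add: power2_norm_eq_inner inner_ell2_self[unfolded power2_norm_eq_inner])

lemma ell2_norm_bound:
  assumes "finite A"
  shows "(\<Sum>i\<in>A. (norm (ell2_nth f i))\<^sup>2) \<le> (norm f)\<^sup>2"
  unfolding ell2_norm_sq
  by (rule finite_sum_le_infsum) (use ell2_sq_summable assms in auto)

lemma ell2_nth_norm_le: "norm (ell2_nth f i) \<le> norm f"
  using ell2_norm_bound[of "{i}" f] by (simp add: power2_le_iff_abs_le)

instance ell2 :: (type, chilbert_space) complete_space
proof
  fix X :: "nat \<Rightarrow> ('a, 'b) ell2"
  assume X: "Cauchy X"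
  have "Cauchy (\<lambda>m. ell2_nth (X m) i)" for i
  proof (rule metric_CauchyI)
    fix e :: real assume "e > 0"
    then obtain M where M: "\<And>m n. m \<ge> M \<Longrightarrow> n \<ge> M \<Longrightarrow> dist (X m) (X n) < e"
      using metric_CauchyD[OF X] by blast
    have "dist (ell2_nth (X m) i) (ell2_nth (X n) i) \<le> dist (X m) (X n)" for m n
      using ell2_nth_norm_le[of "X m - X n" i] by (simp add: dist_norm minus_ell2.rep_eq)
    then show "\<exists>M. \<forall>m\<ge>M. \<forall>n\<ge>M. dist (ell2_nth (X m) i) (ell2_nth (X n) i) < e"
      using M by (meson le_less_trans)
  qed
  then have "\<exists>l. (\<lambda>m. ell2_nth (X m) i) \<longlonglongrightarrow> l" for i
    by (simp add: Cauchy_convergent_iff convergent_def)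
  then obtain l where l: "\<And>i. (\<lambda>m. ell2_nth (X m) i) \<longlonglongrightarrow> l i"
    by metis
  have bd: "\<exists>M. \<forall>m\<ge>M. \<forall>A. finite A \<longrightarrow> (\<Sum>i\<in>A. (norm (ell2_nth (X m) i - l i))\<^sup>2) \<le> e\<^sup>2"
    if e: "e > 0" for e :: real
  proof -
    obtain M where M: "\<And>m n. m \<ge> M \<Longrightarrow> n \<ge> M \<Longrightarrow> dist (X m) (X n) < e"
      using metric_CauchyD[OF X e] by blast
    have "(\<Sum>i\<in>A. (norm (ell2_nth (X m) i - l i))\<^sup>2) \<le> e\<^sup>2" if m: "m \<ge> M" and A: "finite A" for m A
    proof (rule LIMSEQ_le_const2)
      show "(\<lambda>n. \<Sum>i\<in>A. (norm (ell2_nth (X m) i - ell2_nth (X n) i))\<^sup>2)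
          \<longlonglongrightarrow> (\<Sum>i\<in>A. (norm (ell2_nth (X m) i - l i))\<^sup>2)"
        by (intro tendsto_intros l)
      have "(\<Sum>i\<in>A. (norm (ell2_nth (X m) i - ell2_nth (X n) i))\<^sup>2) \<le> e\<^sup>2" if "n \<ge> M" for n
      proof -
        have "(\<Sum>i\<in>A. (norm (ell2_nth (X m) i - ell2_nth (X n) i))\<^sup>2) \<le> (norm (X m - X n))\<^sup>2"
          using ell2_norm_bound[OF A, of "X m - X n"] by (simp add: minus_ell2.rep_eq)
        also have "\<dots> \<le> e\<^sup>2"
          using M[OF m that] by (intro power_mono) (auto simp: dist_norm)
        finally show ?thesis .
      qed
      then show "\<exists>N. \<forall>n\<ge>N. (\<Sum>i\<in>A. (norm (ell2_nth (X m) i - ell2_nth (X n) i))\<^sup>2) \<le> e\<^sup>2"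
        by blast
    qed
    then show ?thesis by blast
  qed
  have diff: "(\<lambda>i. (norm (ell2_nth (X m) i - l i))\<^sup>2) summable_on UNIV"
    if "\<forall>A. finite A \<longrightarrow> (\<Sum>i\<in>A. (norm (ell2_nth (X m) i - l i))\<^sup>2) \<le> e\<^sup>2" for m e
    by (rule nonneg_bdd_above_summable_on) (use that in \<open>auto intro!: bdd_aboveI2\<close>)
  obtain M where "\<forall>A. finite A \<longrightarrow> (\<Sum>i\<in>A. (norm (ell2_nth (X M) i - l i))\<^sup>2) \<le> 1\<^sup>2"
    using bd[of 1] by auto
  then have "(\<lambda>i. (norm (l i - ell2_nth (X M) i))\<^sup>2) summable_on UNIV"
    using diff[of M 1] by (simp add: norm_minus_commute)
  then have "(\<lambda>i. (norm (l i))\<^sup>2) summable_on UNIV"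
    using sq_summable_add[of "\<lambda>i. l i - ell2_nth (X M) i" "ell2_nth (X M)", OF _ ell2_sq_summable]
    by simp
  then obtain L where L: "ell2_nth L = l"
    using Abs_ell2_inverse[of l] by auto
  have "X \<longlonglongrightarrow> L"
  proof (rule metric_LIMSEQ_I)
    fix r :: real assume r: "r > 0"
    then obtain M where M: "\<And>m A. m \<ge> M \<Longrightarrow> finite A \<Longrightarrow>
        (\<Sum>i\<in>A. (norm (ell2_nth (X m) i - l i))\<^sup>2) \<le> (r / 2)\<^sup>2"
      using bd[of "r / 2"] by auto
    have "dist (X m) L < r" if m: "m \<ge> M" for m
    proof -
      have "(norm (X m - L))\<^sup>2 \<le> (r / 2)\<^sup>2"
        unfolding ell2_norm_sq
        by (rule infsum_le_finite_sums) (use M m ell2_sq_summable[of "X m - L"] in \<open>auto simp: minus_ell2.rep_eq L\<close>)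
      then have "norm (X m - L) \<le> r / 2"
        using r by (simp add: power2_le_iff_abs_le)
      then show ?thesis using r by (simp add: dist_norm)
    qed
    then show "\<exists>no. \<forall>n\<ge>no. dist (X n) L < r" by blast
  qed
  then show "convergent X" by (rule convergentI)
qed

instantiation ell2 :: (type, chilbert_space) chilbert_space
begin

lift_definition scaleC_ell2 :: "complex \<Rightarrow> ('a, 'b) ell2 \<Rightarrow> ('a, 'b) ell2"
  is "\<lambda>c f i. c *\<^sub>C f i" by (rule sq_summable_scaleC)

definition cinner_ell2 :: "('a, 'b) ell2 \<Rightarrow> ('a, 'b) ell2 \<Rightarrow> complex"
  where "cinner_ell2 f g = (\<Sum>\<^sub>\<infinity>i. cinner (ell2_nth f i) (ell2_nth g i))"

instance
proof
  fix f g h :: "('a, 'b) ell2" and r :: real and c d :: complex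
  show "complex_of_real r *\<^sub>C f = r *\<^sub>R f" by transfer (simp add: scaleC_of_real)
  show "c *\<^sub>C (f + g) = c *\<^sub>C f + c *\<^sub>C g" by transfer (simp add: scaleC_add_right)
  show "(c + d) *\<^sub>C f = c *\<^sub>C f + d *\<^sub>C f" by transfer (simp add: scaleC_add_left)
  show "c *\<^sub>C d *\<^sub>C f = (c * d) *\<^sub>C f" by transfer (simp add: scaleC_scaleC)
  show "cinner f g = cnj (cinner g f)"
  proof -
    have "cinner (ell2_nth f i) (ell2_nth g i) = cnj (cinner (ell2_nth g i) (ell2_nth f i))" for i
      by (rule cinner_commute)
    then show ?thesis
      unfolding cinner_ell2_def infsum_cnj[symmetric] by (rule infsum_cong)
  qed
  show "cinner (f + g) h = cinner f h + cinner g h"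
    unfolding cinner_ell2_def plus_ell2.rep_eq cinner_add_left
    by (intro infsum_add ell2_cinner_summable)
  show "cinner (c *\<^sub>C f) g = c * cinner f g"
    unfolding cinner_ell2_def scaleC_ell2.rep_eq cinner_scaleC_left
    by (intro infsum_cmult_right ell2_cinner_summable)
  show "Re (cinner f g) = inner f g"
    unfolding cinner_ell2_def inner_ell2_def
    by (simp add: infsum_Re[symmetric] ell2_cinner_summable Re_cinner)
qed

end


section \<open>Operators between closed subspaces\<close>

text \<open>
  A Hilbert space that has to be quantified over inside a formula is a closed subspace \<open>M\<close> of
  some ambient type, with the inherited inner product; \<open>UNIV\<close> is the ambient space itself.
  Operators \<open>M \<rightarrow> N\<close> are functions on the ambient types of which only the restriction to \<open>M\<close>
  is meaningful.
\<close>

definition closed_csubspace :: "'a::chilbert_space set \<Rightarrow> bool"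
  where "closed_csubspace M \<longleftrightarrow>
    closed M \<and> 0 \<in> M \<and> (\<forall>x\<in>M. \<forall>y\<in>M. x + y \<in> M) \<and> (\<forall>c. \<forall>x\<in>M. c *\<^sub>C x \<in> M)"

definition bop :: "'a::chilbert_space set \<Rightarrow> 'b::chilbert_space set \<Rightarrow> ('a \<Rightarrow> 'b) set"
  where "bop M N = {T. (\<forall>x\<in>M. T x \<in> N)
    \<and> (\<forall>x\<in>M. \<forall>y\<in>M. T (x + y) = T x + T y)
    \<and> (\<forall>c. \<forall>x\<in>M. T (c *\<^sub>C x) = c *\<^sub>C T x)
    \<and> (\<exists>K. \<forall>x\<in>M. norm (T x) \<le> K * norm x)}"

definition op_norm :: "'a::chilbert_space set \<Rightarrow> ('a \<Rightarrow> 'b::chilbert_space) \<Rightarrow> real"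
  where "op_norm M T = (SUP x\<in>M. norm (T x) / norm x)"

definition contraction :: "'a::chilbert_space set \<Rightarrow> 'b::chilbert_space set \<Rightarrow> ('a \<Rightarrow> 'b) \<Rightarrow> bool"
  where "contraction M N T \<longleftrightarrow> T \<in> bop M N \<and> op_norm M T \<le> 1"

definition adj ::
    "'a::chilbert_space set \<Rightarrow> 'b::chilbert_space set \<Rightarrow> ('a \<Rightarrow> 'b) \<Rightarrow> 'b \<Rightarrow> 'a"
  where "adj M N T y = (THE z. z \<in> M \<and> (\<forall>x\<in>M. cinner (T x) y = cinner x z))"

definition coisometry :: "'a::chilbert_space set \<Rightarrow> 'b::chilbert_space set \<Rightarrow> ('a \<Rightarrow> 'b) \<Rightarrow> bool"
  where "coisometry M N T \<longleftrightarrow> T \<in> bop M N \<and> (\<forall>y\<in>N. T (adj M N T y) = y)"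

definition proj :: "'a::chilbert_space set \<Rightarrow> 'a \<Rightarrow> 'a"
  where "proj M x = (THE z. z \<in> M \<and> (\<forall>y\<in>M. cinner (x - z) y = 0))"

definition coinvariant :: "('a::chilbert_space \<Rightarrow> 'a) \<Rightarrow> 'a set \<Rightarrow> bool"
  where "coinvariant T M \<longleftrightarrow> (\<forall>x\<in>M. adj UNIV UNIV T x \<in> M)"

text \<open>In the order of \<open>complex\<close>, \<open>0 \<le> z\<close> means that \<open>z\<close> is real and nonnegative.\<close>

definition positive_op :: "'a::chilbert_space set \<Rightarrow> ('a \<Rightarrow> 'a) \<Rightarrow> bool"
  where "positive_op M T \<longleftrightarrow> (\<forall>x\<in>M. 0 \<le> cinner (T x) x)"

text \<open>The weak operator topology: the initial topology of all \<open>T \<mapsto> cinner (T x) y\<close>.\<close>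

definition wot :: "'a::chilbert_space set \<Rightarrow> 'b::chilbert_space set \<Rightarrow> ('a \<Rightarrow> 'b) topology"
  where "wot M N = pullback_topology (bop M N)
    (\<lambda>T. \<lambda>(x, y)\<in>M \<times> N. cinner (T x) y) (product_topology (\<lambda>_. euclidean) (M \<times> N))"

definition op_cspan :: "('a \<Rightarrow> 'b::chilbert_space) set \<Rightarrow> ('a \<Rightarrow> 'b) set"
  where "op_cspan A = {\<lambda>x. \<Sum>T\<in>F. c T *\<^sub>C T x | F c. finite F \<and> F \<subseteq> A}"


section \<open>Full Fock space\<close>

text \<open>
  The finite type \<open>'n\<close> indexes the orthonormal basis of \<open>H\<^sub>n\<close>, so the free semigroup on \<open>n\<close>
  generators is \<open>'n list\<close>, with \<open>i # \<alpha>\<close> for \<open>g\<^sub>i \<alpha>\<close>.  As the vectors \<open>e\<^sub>\<alpha>\<close> form an orthonormal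
  basis of the full Fock space, \<open>('n, complex) fock\<close> is the Fock space, with \<open>e\<^sub>\<alpha>\<close> the family that
  is 1 at \<open>\<alpha>\<close> and 0 elsewhere, and \<open>('n, 'e) fock\<close> is its Hilbert space tensor product with \<open>'e\<close>,
  the family \<open>h\<close> standing for the sum of all \<open>e\<^sub>\<alpha> \<otimes> h \<alpha>\<close>.
\<close>

type_synonym ('n, 'e) fock = "('n list, 'e) ell2"

definition tensor_vec :: "('n, complex) fock \<Rightarrow> 'e::chilbert_space \<Rightarrow> ('n, 'e) fock"
  where "tensor_vec \<phi> x = Abs_ell2 (\<lambda>\<alpha>. ell2_nth \<phi> \<alpha> *\<^sub>C x)"

text \<open>For bounded \<open>\<psi>\<close> and \<open>Y\<close>, the unique bounded operator with
  \<open>(\<psi> \<otimes> Y) (\<phi> \<otimes> x) = \<psi> \<phi> \<otimes> Y x\<close>.\<close>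

definition tensor_op ::
    "(('n, complex) fock \<Rightarrow> ('n, complex) fock) \<Rightarrow> ('e::chilbert_space \<Rightarrow> 'k::chilbert_space)
      \<Rightarrow> ('n, 'e) fock \<Rightarrow> ('n, 'k) fock"
  where "tensor_op \<psi> Y = (THE T. T \<in> bop UNIV UNIV \<and>
    (\<forall>\<phi> x. T (tensor_vec \<phi> x) = tensor_vec (\<psi> \<phi>) (Y x)))"

text \<open>The subspace \<open>F\<^sup>2(H\<^sub>n) \<otimes> M\<close> of \<open>('n, 'e) fock\<close>, for a closed subspace \<open>M\<close> of \<open>'e\<close>.  The
  operator \<open>\<psi> \<otimes> I\<^sub>M\<close> is the restriction of \<open>tensor_op \<psi> id\<close> to it.\<close>

definition fock_sub :: "'e::chilbert_space set \<Rightarrow> ('n, 'e) fock set"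
  where "fock_sub M = {h. \<forall>\<alpha>. ell2_nth h \<alpha> \<in> M}"

definition creation :: "'n \<Rightarrow> ('n, complex) fock \<Rightarrow> ('n, complex) fock"
  where "creation i \<phi> = Abs_ell2 (\<lambda>\<beta>. case \<beta> of [] \<Rightarrow> 0
    | j # \<alpha> \<Rightarrow> if j = i then ell2_nth \<phi> \<alpha> else 0)"


section \<open>Admissible free holomorphic functions and noncommutative domains\<close>

text \<open>
  A formal power series in noncommuting indeterminates is its coefficient function.  Real
  coefficients suffice, since admissible series have positive coefficients and the inverse of a
  series with real coefficients has real coefficients.
\<close>

type_synonym 'n nc_series = "'n list \<Rightarrow> real"

definition nc_one :: "'n nc_series"
  where "nc_one \<alpha> = (if \<alpha> = [] then 1 else 0)"

definition nc_mult :: "'n nc_series \<Rightarrow> 'n nc_series \<Rightarrow> 'n nc_series"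
  where "nc_mult a b \<alpha> = (\<Sum>k\<le>length \<alpha>. a (take k \<alpha>) * b (drop k \<alpha>))"

definition nc_inverse :: "'n nc_series \<Rightarrow> 'n nc_series"
  where "nc_inverse b = (THE a. nc_mult a b = nc_one \<and> nc_mult b a = nc_one)"

text \<open>The diagonal operator with \<open>D\<^sub>i e\<^sub>\<alpha> = sqrt (b \<alpha> / b (i # \<alpha>)) e\<^sub>\<alpha>\<close>; it is defined on the whole
  Fock space only if these weights are bounded in \<open>\<alpha>\<close>, which admissibility ensures.\<close>

definition weight_op :: "'n nc_series \<Rightarrow> 'n \<Rightarrow> ('n, complex) fock \<Rightarrow> ('n, complex) fock"
  where "weight_op b i \<phi> = Abs_ell2 (\<lambda>\<alpha>. sqrt (b \<alpha> / b (i # \<alpha>)) *\<^sub>R ell2_nth \<phi> \<alpha>)"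

definition universal_model :: "'n nc_series \<Rightarrow> 'n \<Rightarrow> ('n, complex) fock \<Rightarrow> ('n, complex) fock"
  where "universal_model b i = creation i \<circ> weight_op b i"

primrec word_op :: "('n \<Rightarrow> 'a \<Rightarrow> 'a) \<Rightarrow> 'n list \<Rightarrow> 'a \<Rightarrow> 'a" where
  "word_op X [] = id"
| "word_op X (i # \<alpha>) = X i \<circ> word_op X \<alpha>"

definition defect_partial ::
    "'a::chilbert_space set \<Rightarrow> 'n nc_series \<Rightarrow> ('n \<Rightarrow> 'a \<Rightarrow> 'a) \<Rightarrow> nat \<Rightarrow> 'a \<Rightarrow> 'a"
  where "defect_partial H a X k x =
    (\<Sum>p\<le>k. \<Sum>\<alpha> | length \<alpha> = p. a \<alpha> *\<^sub>R word_op X \<alpha> (adj H H (word_op X \<alpha>) x))"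

definition admissible :: "'n::finite nc_series \<Rightarrow> bool"
  where "admissible b \<longleftrightarrow>
    (\<forall>\<alpha>. b \<alpha> > 0) \<and> b [] = 1 \<and> (\<forall>i. bdd_above (range (\<lambda>\<alpha>. b \<alpha> / b (i # \<alpha>))))
    \<and> limsup (\<lambda>k. ereal ((\<Sum>\<alpha> | length \<alpha> = k. (b \<alpha>)\<^sup>2) powr (1 / (2 * real k)))) < \<infinity>
    \<and> bdd_above (range (\<lambda>k. op_norm UNIV
        (defect_partial UNIV (nc_inverse b) (universal_model b) k)))"

definition regular :: "'n nc_series \<Rightarrow> bool"
  where "regular b \<longleftrightarrow>
    (\<forall>\<alpha>. length \<alpha> \<ge> 1 \<longrightarrow> nc_inverse b \<alpha> \<le> 0) \<and> (\<forall>i. nc_inverse b [i] < 0)"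

definition is_defect ::
    "'a::chilbert_space set \<Rightarrow> 'n::finite nc_series \<Rightarrow> ('n \<Rightarrow> 'a \<Rightarrow> 'a) \<Rightarrow> ('a \<Rightarrow> 'a) \<Rightarrow> bool"
  where "is_defect H b X \<Delta> \<longleftrightarrow>
    limitin (wot H H) (defect_partial H (nc_inverse b) X) \<Delta> sequentially"

text \<open>\<open>Q\<close> is the sum over all words \<open>\<alpha>\<close> of \<open>b\<^sub>\<alpha> X\<^sub>\<alpha> \<Delta> X\<^sub>\<alpha>\<^sup>*\<close>.  For \<open>\<Delta> \<ge> 0\<close> the terms are positive, so
  unordered summation and summation by word length agree.\<close>

definition is_defect_sum ::
    "'a::chilbert_space set \<Rightarrow> 'n::finite nc_series \<Rightarrow> ('n \<Rightarrow> 'a \<Rightarrow> 'a) \<Rightarrow> ('a \<Rightarrow> 'a) \<Rightarrow> ('a \<Rightarrow> 'a) \<Rightarrow> bool"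
  where "is_defect_sum H b X \<Delta> Q \<longleftrightarrow>
    limitin (wot H H)
      (\<lambda>A x. \<Sum>\<alpha>\<in>A. b \<alpha> *\<^sub>R word_op X \<alpha> (\<Delta> (adj H H (word_op X \<alpha>) x)))
      Q (finite_subsets_at_top UNIV)"

definition nc_domain :: "'n::finite nc_series \<Rightarrow> 'a::chilbert_space set \<Rightarrow> ('n \<Rightarrow> 'a \<Rightarrow> 'a) set"
  where "nc_domain b H = {X. (\<forall>i. X i \<in> bop H H) \<and>
    (\<exists>\<Delta> Q. is_defect H b X \<Delta> \<and> positive_op H \<Delta> \<and>
      is_defect_sum H b X \<Delta> Q \<and> positive_op H (\<lambda>x. x - Q x))}"

definition pure_domain :: "'n::finite nc_series \<Rightarrow> 'a::chilbert_space set \<Rightarrow> ('n \<Rightarrow> 'a \<Rightarrow> 'a) set"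
  where "pure_domain b H = {X \<in> nc_domain b H.
    \<exists>\<Delta> Q. is_defect H b X \<Delta> \<and> is_defect_sum H b X \<Delta> Q \<and> (\<forall>x\<in>H. Q x = x)}"

text \<open>The operator \<open>W\<^sub>i \<otimes> I\<close> for the universal model \<open>W\<close> of \<open>b\<close>.\<close>

definition ampliation :: "'n nc_series \<Rightarrow> 'n \<Rightarrow> ('n, 'e::chilbert_space) fock \<Rightarrow> ('n, 'e) fock"
  where "ampliation b i = tensor_op (universal_model b i) id"

definition R_infty :: "'n nc_series \<Rightarrow> (('n, complex) fock \<Rightarrow> ('n, complex) fock) set"
  where "R_infty b =
    {\<psi> \<in> bop UNIV UNIV. \<forall>i. \<psi> \<circ> universal_model b i = universal_model b i \<circ> \<psi>}"

definition R_infty_tensor ::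
    "'n nc_series \<Rightarrow> 'k::chilbert_space set \<Rightarrow> (('n, 'e::chilbert_space) fock \<Rightarrow> ('n, 'k) fock) set"
  where "R_infty_tensor b N = wot UNIV (fock_sub N) closure_of
    op_cspan {tensor_op \<psi> Y | \<psi> Y. \<psi> \<in> R_infty b \<and> Y \<in> bop UNIV N}"

text \<open>
  Stand-in for ``every Hilbert space'', over which HOL cannot quantify: the closed subspaces of
  this type, i.e. of \<open>F\<^sup>2(H\<^sub>n) \<otimes> (\<complex> \<oplus> 'e)\<close>, are, up to unitary equivalence, all Hilbert spaces of
  dimension at most that of \<open>F\<^sup>2(H\<^sub>n) \<otimes> (\<complex> \<oplus> 'e)\<close>, in particular all separable ones.  A tuple of
  operators is a direct sum of tuples on separable spaces, so an inclusion of pure domains that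
  holds over all these subspaces holds over every Hilbert space.
\<close>

type_synonym ('n, 'e) universe = "('n, complex \<times> 'e) fock"

end

(*
The hypothesis on the pure domains, tested on the diagonal operators that W^(f) (x) I produces,
says that c = g^(-1) f has nonnegative coefficients.  Hence f = g c, and e_gamma (x) x |-> the sum
over gamma = alpha beta of sqrt (g_alpha c_beta / f_gamma) e_alpha (x) e_beta (x) x is an isometry
whose adjoint F intertwines W^(g) (x) I with W^(f) (x) I.  Replacing X by F^* X reduces the theorem
to commutant lifting for the model of g alone.  As g is regular, g = 1 + c' g with c' >= 0, so that
h |-> (h at the empty word, (sqrt c'_alpha W_alpha^* h)_alpha) is an isometry, and a lurking
isometry argument, on adjoints, produces the lifting.  Membership in the tensor product with
R^infinity (g) follows from the boundedness of Fejer means.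
*)

theory Submission
  imports Defs
begin

section \<open>Complex inner products and bounded operators\<close>

text \<open>The difficulty is to lift without increasing the norm. A map commuting with backward
  shifts is determined by its values at the empty word, so only one operator \<open>a\<close> into
  the coefficient space has to be found, and contractivity turns into an inequality propagated along
  the recursion g = 1 + c' g. The operator \<open>a\<close> comes with an auxiliary
  \<open>D'\<close> that continues the defect operator off the co-invariant subspace;
  \<open>D'\<close> solves a fixed-point equation built from a contraction \<open>V\<close>. That
  \<open>V\<close> may have norm 1 does no harm: c' vanishes at the empty word, so each use of the
  equation strips at least one letter and the iteration stabilizes on finitely supported vectors. In
  the kernel the weights are such that the squares over all splittings of \<gamma> add up to (g
  c)_\<gamma> / f_\<gamma> = 1. The factor g stands on the left because backward shifts strip
  letters from the front. Fejer means are needed since the partial sums of the formal series of a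
  bounded multi-analytic operator need not be bounded. The means are averages of compressions to
  blocks of word lengths, so they keep the norm bound.\<close>

lemma cinner_add_right: "cinner x (y + z) = cinner x y + cinner x (z::'a::chilbert_space)"
  by (metis cinner_add_left cinner_commute complex_cnj_add)

lemma cinner_scaleC_right: "cinner x (c *\<^sub>C y) = cnj c * cinner x (y::'a::chilbert_space)"
  by (metis cinner_commute cinner_scaleC_left complex_cnj_mult)

lemma scaleC_sgn_unit:
  assumes "z \<noteq> 0"
  shows "cnj (sgn z) * z = complex_of_real (cmod z)"
proof -
  have "z * cnj z = complex_of_real ((cmod z)\<^sup>2)"
    by (metis complex_norm_square)
  then show ?thesis using assms
    by (simp add: sgn_eq power2_eq_square field_simps)
qed

text \<open>A unimodular factor on the first argument makes the inner product real and nonnegative,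
  so the real Cauchy-Schwarz inequality applies without loss of a constant.\<close>

lemma cmod_cinner_le_norm: "cmod (cinner x y) \<le> norm x * norm (y::'a::chilbert_space)"
proof (cases "cinner x y = 0")
  case False
  let ?u = "cnj (sgn (cinner x y))"
  have "cmod (cinner x y) = Re (cinner (?u *\<^sub>C x) y)"
    using scaleC_sgn_unit[OF False] by (simp add: cinner_scaleC_left)
  also have "\<dots> \<le> norm (?u *\<^sub>C x) * norm y"
    by (simp add: Re_cinner norm_cauchy_schwarz)
  also have "\<dots> = norm x * norm y"
    using False by (simp add: norm_scaleC norm_sgn)
  finally show ?thesis .
qed simp

lemma cinner_scaleR_left: "cinner (r *\<^sub>R x) y = r *\<^sub>R cinner x (y::'a::chilbert_space)"
  using cinner_scaleC_left[of "complex_of_real r" x y] by (simp add: scaleC_of_real scaleR_conv_of_real)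

lemma cinner_scaleR_right: "cinner x (r *\<^sub>R y) = r *\<^sub>R cinner x (y::'a::chilbert_space)"
  using cinner_scaleC_right[of x "complex_of_real r" y] by (simp add: scaleC_of_real scaleR_conv_of_real)

interpretation cinner: bounded_bilinear "cinner :: 'a::chilbert_space \<Rightarrow> 'a \<Rightarrow> complex"
proof
  show "\<exists>K. \<forall>a b::'a. norm (cinner a b) \<le> norm a * norm b * K"
    by (intro exI[of _ 1]) (simp add: cmod_cinner_le_norm)
qed (simp_all add: cinner_add_left cinner_add_right cinner_scaleR_left cinner_scaleR_right)

lemma cinner_self: "cinner x x = complex_of_real ((norm (x::'a::chilbert_space))\<^sup>2)"
proof -
  have "cinner x x = cnj (cinner x x)" by (rule cinner_commute)
  then have "Im (cinner x x) = 0" by (simp add: complex_eq_iff)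
  moreover have "Re (cinner x x) = (norm x)\<^sup>2" by (simp add: Re_cinner power2_norm_eq_inner)
  ultimately show ?thesis by (simp add: complex_eq_iff)
qed

lemma cinner_ext:
  assumes "\<And>y. cinner y a = cinner y (b::'a::chilbert_space)"
  shows "a = b"
proof -
  have "cinner (a - b) (a - b) = 0" using assms by (simp add: cinner.diff_right)
  then show ?thesis unfolding cinner_self by simp
qed

lemma scaleC_minus_one: "(-1) *\<^sub>C x = - (x::'a::chilbert_space)"
  using scaleC_of_real[of "-1" x] by simp

lemma scaleC_diff_right: "c *\<^sub>C (x - y) = c *\<^sub>C x - c *\<^sub>C (y::'a::chilbert_space)"
  using scaleC_add_right[of c "x - y" y] by (simp add: algebra_simps)

lemma scaleR_scaleC: "r *\<^sub>R c *\<^sub>C x = c *\<^sub>C r *\<^sub>R (x::'a::chilbert_space)"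
  unfolding scaleC_of_real[symmetric] scaleC_scaleC by (simp add: mult.commute)

lemma bounded_linear_scaleC: "bounded_linear (\<lambda>x::'a::chilbert_space. c *\<^sub>C x)"
  by (intro bounded_linear_intro[of _ "cmod c"])
    (simp_all add: scaleC_add_right scaleR_scaleC norm_scaleC mult.commute)

text \<open>Closedness is omitted on purpose: the range of a bounded operator, on which the Riesz
  and Douglas arguments work, need not be closed.\<close>

definition csubspace :: "'a::chilbert_space set \<Rightarrow> bool"
  where "csubspace M \<longleftrightarrow> 0 \<in> M \<and> (\<forall>x\<in>M. \<forall>y\<in>M. x + y \<in> M) \<and> (\<forall>c. \<forall>x\<in>M. c *\<^sub>C x \<in> M)"

lemma csubspaceD:
  assumes "csubspace M"
  shows "0 \<in> M" "x \<in> M \<Longrightarrow> y \<in> M \<Longrightarrow> x + y \<in> M" "x \<in> M \<Longrightarrow> c *\<^sub>C x \<in> M"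
    "x \<in> M \<Longrightarrow> r *\<^sub>R x \<in> M" "x \<in> M \<Longrightarrow> y \<in> M \<Longrightarrow> x - y \<in> M"
proof -
  show 1: "0 \<in> M" "\<And>x y. x \<in> M \<Longrightarrow> y \<in> M \<Longrightarrow> x + y \<in> M" "\<And>c x. x \<in> M \<Longrightarrow> c *\<^sub>C x \<in> M"
    using assms by (auto simp: csubspace_def)
  show "x \<in> M \<Longrightarrow> r *\<^sub>R x \<in> M" using 1(3)[of x "complex_of_real r"] by (simp add: scaleC_of_real)
  show "x \<in> M \<Longrightarrow> y \<in> M \<Longrightarrow> x - y \<in> M"
    using 1(2)[of x "- y"] 1(3)[of y "-1"] by (simp add: scaleC_minus_one)
qed

lemma closed_csubspaceD: "closed_csubspace M \<Longrightarrow> csubspace M" "closed_csubspace M \<Longrightarrow> closed M"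
  by (auto simp: closed_csubspace_def csubspace_def)

lemma csubspace_UNIV [simp]: "csubspace UNIV"
  by (simp add: csubspace_def)

lemma closed_csubspace_UNIV [simp]: "closed_csubspace UNIV"
  by (simp add: closed_csubspace_def)

section \<open>Everywhere defined bounded operators\<close>

abbreviation bops :: "('a::chilbert_space \<Rightarrow> 'b::chilbert_space) set"
  where "bops \<equiv> bop UNIV UNIV"

lemma bop_bounded_linear:
  assumes "T \<in> bops"
  shows "bounded_linear T"
proof -
  obtain K where "\<forall>x. norm (T x) \<le> K * norm x" using assms by (auto simp: bop_def)
  then show ?thesis using assms
    by (intro bounded_linear_intro[of _ K])
      (auto simp: bop_def scaleC_of_real[symmetric] mult.commute)
qed

lemma bop_scaleC: "T \<in> bops \<Longrightarrow> T (c *\<^sub>C x) = c *\<^sub>C T x"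
  by (simp add: bop_def)

lemma bop_linear:
  assumes "T \<in> bops"
  shows "T (x + y) = T x + T y" "T (x - y) = T x - T y" "T 0 = 0" "T (r *\<^sub>R x) = r *\<^sub>R T x"
    "T (sum f A) = (\<Sum>a\<in>A. T (f a))"
  using bop_bounded_linear[OF assms]
  by (simp_all add: bounded_linear.linear linear_add linear_diff linear_0 linear_scale linear_sum)

lemma bop_tendsto: "T \<in> bops \<Longrightarrow> (f \<longlongrightarrow> l) F \<Longrightarrow> ((\<lambda>x. T (f x)) \<longlongrightarrow> T l) F"
  by (rule bounded_linear.tendsto[OF bop_bounded_linear])

lemma bopI:
  assumes "\<And>x y. T (x + y) = T x + T y" "\<And>c x. T (c *\<^sub>C x) = c *\<^sub>C T x"
    "\<And>x. norm (T x) \<le> K * norm x"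
  shows "T \<in> bops"
  using assms by (auto simp: bop_def)

lemma bop_bound:
  assumes "T \<in> bops"
  shows "\<exists>K\<ge>0. \<forall>x. norm (T x) \<le> K * norm x"
  using bounded_linear.nonneg_bounded[OF bop_bounded_linear[OF assms]] by (auto simp: mult.commute)

lemma bop_id [simp]: "id \<in> bops" "(\<lambda>x. x) \<in> bops"
  by (auto intro!: bopI[of _ 1])

lemma bop_zero [simp]: "(\<lambda>_. 0) \<in> bops"
  by (auto intro!: bopI[of _ 1])

lemma bop_comp:
  assumes "S \<in> bops" "T \<in> bops"
  shows "(\<lambda>x. S (T x)) \<in> bops"
proof -
  obtain K where K: "\<And>x. norm (S (T x)) \<le> norm x * K"
    using bounded_linear.bounded[OF bounded_linear_compose[OF bop_bounded_linear[OF assms(1)]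
          bop_bounded_linear[OF assms(2)]]] by blast
  show ?thesis
    by (rule bopI[of _ K]) (use assms K in \<open>auto simp: bop_scaleC bop_linear mult.commute\<close>)
qed

lemma bop_o: "S \<in> bops \<Longrightarrow> T \<in> bops \<Longrightarrow> S \<circ> T \<in> bops"
  using bop_comp[of S T] by (simp add: comp_def)

lemma bop_add:
  assumes "S \<in> bops" "T \<in> bops"
  shows "(\<lambda>x. S x + T x) \<in> bops"
proof -
  obtain K where K: "\<And>x. norm (S x + T x) \<le> norm x * K"
    using bounded_linear.bounded[OF bounded_linear_add[OF bop_bounded_linear[OF assms(1)]
          bop_bounded_linear[OF assms(2)]]] by blast
  show ?thesis
    by (rule bopI[of _ K])
      (use assms K in \<open>auto simp: bop_scaleC bop_linear mult.commute scaleC_add_right\<close>)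
qed

lemma bop_scaleC_left:
  assumes "T \<in> bops"
  shows "(\<lambda>x. c *\<^sub>C T x) \<in> bops"
proof -
  have "(\<lambda>x. c *\<^sub>C x) \<in> bops"
    by (rule bopI[of _ "cmod c"]) (auto simp: scaleC_add_right norm_scaleC scaleC_scaleC mult.commute)
  from bop_comp[OF this assms] show ?thesis .
qed

lemma bop_scaleR: "T \<in> bops \<Longrightarrow> (\<lambda>x. r *\<^sub>R T x) \<in> bops"
  using bop_scaleC_left[of T "complex_of_real r"] by (simp add: scaleC_of_real)

lemma bop_diff:
  assumes "S \<in> bops" "T \<in> bops"
  shows "(\<lambda>x. S x - T x) \<in> bops"
  using bop_add[OF assms(1) bop_scaleR[OF assms(2), of "-1"]] by simp

lemma bop_sum:
  assumes "\<And>a. a \<in> A \<Longrightarrow> T a \<in> bops"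
  shows "(\<lambda>x. \<Sum>a\<in>A. T a x) \<in> bops"
  using assms by (induction A rule: infinite_finite_induct) (auto intro: bop_add)

lemma bop_pointwise_limit:
  assumes T: "\<And>n. T n \<in> bops" and lim: "\<And>x. (\<lambda>n. T n x) \<longlonglongrightarrow> S x"
    and K: "\<And>n x. norm (T n x) \<le> K * norm x"
  shows "S \<in> bops" "norm (S x) \<le> K * norm x"
proof -
  show K': "norm (S x) \<le> K * norm x" for x
    using K by (intro LIMSEQ_le_const2[OF tendsto_norm[OF lim]]) blast
  show "S \<in> bops"
  proof (rule bopI[OF _ _ K'])
    show "S (x + y) = S x + S y" for x y
      using tendsto_add[OF lim[of x] lim[of y]] lim[of "x + y"]
      by (simp add: bop_linear[OF T] LIMSEQ_unique)
    show "S (c *\<^sub>C x) = c *\<^sub>C S x" for c x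
      using bounded_linear.tendsto[OF bounded_linear_scaleC lim[of x]] lim[of "c *\<^sub>C x"]
      by (simp add: bop_scaleC[OF T] LIMSEQ_unique)
  qed
qed

section \<open>Operator norms on subspaces\<close>

lemma op_norm_bdd:
  assumes "\<And>x. x \<in> M \<Longrightarrow> norm (T x) \<le> K * norm x" "K \<ge> 0"
  shows "bdd_above ((\<lambda>x. norm (T x) / norm x) ` M)"
  using assms by (intro bdd_aboveI2[of _ _ K]) (auto simp: divide_simps)

text \<open>The quotient at \<open>x = 0\<close> is \<open>0 / 0 = 0\<close>, so a bound
  \<open>K\<close> has to be nonnegative as soon as \<open>M\<close> contains 0.\<close>

lemma op_norm_le:
  assumes "\<And>x. x \<in> M \<Longrightarrow> norm (T x) \<le> K * norm x" "K \<ge> 0" "M \<noteq> {}"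
  shows "op_norm M T \<le> K"
  unfolding op_norm_def using assms by (intro cSUP_least) (auto simp: divide_simps)

lemma bop_bounded_on:
  assumes "T \<in> bop M N"
  shows "\<exists>K\<ge>0. \<forall>x\<in>M. norm (T x) \<le> K * norm x"
proof -
  obtain K where K: "\<forall>x\<in>M. norm (T x) \<le> K * norm x" using assms by (auto simp: bop_def)
  have "norm (T x) \<le> \<bar>K\<bar> * norm x" if "x \<in> M" for x
    using bspec[OF K that] mult_right_mono[OF abs_ge_self[of K] norm_ge_zero[of x]] by linarith
  then show ?thesis using abs_ge_zero by blast
qed

lemma norm_le_op_norm:
  assumes "T \<in> bop M N" "x \<in> M"
  shows "norm (T x) \<le> op_norm M T * norm x"
proof -
  obtain K where K: "K \<ge> 0" "\<And>x. x \<in> M \<Longrightarrow> norm (T x) \<le> K * norm x"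
    using bop_bounded_on[OF assms(1)] by auto
  have "norm (T x) / norm x \<le> op_norm M T"
    unfolding op_norm_def by (rule cSUP_upper[OF assms(2) op_norm_bdd[OF K(2,1)]]) simp
  then show ?thesis
    using K(2)[OF assms(2)] by (cases "x = 0") (auto simp: divide_simps split: if_splits)
qed

lemma op_norm_nonneg:
  assumes "T \<in> bop M N" "0 \<in> M"
  shows "0 \<le> op_norm M T"
proof -
  obtain K where K: "K \<ge> 0" "\<And>x. x \<in> M \<Longrightarrow> norm (T x) \<le> K * norm x"
    using bop_bounded_on[OF assms(1)] by auto
  have "norm (T 0) / norm (0::'a) \<le> op_norm M T"
    unfolding op_norm_def by (rule cSUP_upper[OF assms(2) op_norm_bdd[OF K(2,1)]]) simp
  then show ?thesis by simp
qed


section \<open>Riesz representation, adjoints and projections\<close>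

text \<open>The representing vector minimizes \<open>J\<close>. Since \<open>L\<close> need not be
  closed, the infimum is approached by a Cauchy sequence whose limit is only known to lie in the
  closure.\<close>

lemma riesz_real:
  fixes \<phi> :: "'a::{real_inner, complete_space} \<Rightarrow> real"
  assumes L0: "0 \<in> L" and Ladd: "\<And>x y. x \<in> L \<Longrightarrow> y \<in> L \<Longrightarrow> x + y \<in> L"
    and Lsc: "\<And>r x. x \<in> L \<Longrightarrow> r *\<^sub>R x \<in> L"
    and add: "\<And>x y. x \<in> L \<Longrightarrow> y \<in> L \<Longrightarrow> \<phi> (x + y) = \<phi> x + \<phi> y"
    and sc: "\<And>r x. x \<in> L \<Longrightarrow> \<phi> (r *\<^sub>R x) = r * \<phi> x"
    and bd: "\<And>x. x \<in> L \<Longrightarrow> \<bar>\<phi> x\<bar> \<le> C * norm x"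
  shows "\<exists>z\<in>closure L. \<forall>x\<in>L. \<phi> x = inner x z"
proof -
  define J where "J x = (norm x)\<^sup>2 - 2 * \<phi> x" for x
  \<comment> \<open>Completing the square: \<open>J x\<close> is at least
    \<open>(norm x - C)^2 - C^2\<close>.\<close>
  have J_lower: "- C\<^sup>2 \<le> J x" if "x \<in> L" for x
    using bd[OF that] zero_le_power2[of "norm x - C"]
    by (simp add: J_def power2_eq_square algebra_simps)
  define m where "m = (INF x\<in>L. J x)"
  have bddJ: "bdd_below (J ` L)"
    using J_lower by (intro bdd_belowI2)
  have m_le: "m \<le> J x" if "x \<in> L" for x
    unfolding m_def by (rule cINF_lower[OF bddJ that])
  have "\<exists>x\<in>L. J x < m + 1 / Suc n" for n
  proof (rule ccontr)
    assume "\<not> (\<exists>x\<in>L. J x < m + 1 / Suc n)"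
    then have *: "m + 1 / Suc n \<le> J x" if "x \<in> L" for x using that not_less by blast
    have "m + 1 / Suc n \<le> (INF x\<in>L. J x)" using L0 by (intro cINF_greatest *) blast
    then have "m + 1 / Suc n \<le> m" by (simp only: m_def)
    then show False by (simp add: field_simps)
  qed
  then obtain X where X: "\<And>n. X n \<in> L" "\<And>n. J (X n) < m + 1 / Suc n"
    by metis
  \<comment> \<open>Parallelogram law: the midpoint cannot undercut \<open>m\<close>, so two
    near-minimizers are close to each other.\<close>
  have par: "(norm (x - y))\<^sup>2 \<le> 2 * (J x - m) + 2 * (J y - m)" if "x \<in> L" "y \<in> L" for x y
  proof -
    have "m \<le> J ((1/2) *\<^sub>R (x + y))" by (intro m_le Lsc Ladd that)
    also have "\<dots> = (norm (x + y))\<^sup>2 / 4 - (\<phi> x + \<phi> y)"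
      unfolding J_def sc[OF Ladd[OF that]] add[OF that] by (simp add: power_divide add_divide_distrib)
    finally have "4 * m \<le> (norm (x + y))\<^sup>2 - 4 * (\<phi> x + \<phi> y)" by simp
    moreover have "(norm (x - y))\<^sup>2 + (norm (x + y))\<^sup>2 = 2 * (norm x)\<^sup>2 + 2 * (norm y)\<^sup>2"
      by (simp add: power2_norm_eq_inner algebra_simps inner_commute)
    ultimately show ?thesis by (simp add: J_def)
  qed
  have "Cauchy X"
  proof (rule metric_CauchyI)
    fix e :: real assume e: "e > 0"
    obtain N where N: "1 / real (Suc N) < e\<^sup>2 / 4"
      using nat_approx_posE[of "e\<^sup>2 / 4"] e by auto
    have "dist (X i) (X j) < e" if ij: "i \<ge> N" "j \<ge> N" for i j
    proof -
      have "1 / real (Suc i) \<le> 1 / real (Suc N)" "1 / real (Suc j) \<le> 1 / real (Suc N)"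
        using ij by (simp_all add: field_simps)
      then have "(norm (X i - X j))\<^sup>2 < e\<^sup>2"
        using par[OF X(1)[of i] X(1)[of j]] X(2)[of i] X(2)[of j] N by simp
      then show ?thesis using e by (simp add: dist_norm power2_less_imp_less)
    qed
    then show "\<exists>M. \<forall>i\<ge>M. \<forall>j\<ge>M. dist (X i) (X j) < e" by blast
  qed
  then obtain z where z: "X \<longlonglongrightarrow> z"
    using Cauchy_convergent_iff convergent_def by blast
  have JX: "(\<lambda>n. J (X n)) \<longlonglongrightarrow> m"
  proof (rule real_tendsto_sandwich)
    show "\<forall>\<^sub>F n in sequentially. J (X n) \<le> m + 1 / real (Suc n)"
      by (intro always_eventually allI less_imp_le X(2))
    show "\<forall>\<^sub>F n in sequentially. m \<le> J (X n)"
      by (intro always_eventually allI m_le X(1))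
    show "(\<lambda>n. m + 1 / real (Suc n)) \<longlonglongrightarrow> m"
      using tendsto_add[OF tendsto_const[of m] LIMSEQ_inverse_real_of_nat] by (simp add: divide_inverse)
  qed (rule tendsto_const)
  have "\<phi> x = inner x z" if x: "x \<in> L" for x
  proof -
    \<comment> \<open>First variation at \<open>z\<close>. As \<open>\<phi>\<close> is controlled on
      \<open>L\<close> only, which may not contain \<open>z\<close>, the variation is taken at
      \<open>X n\<close> and passed to the limit.\<close>
    have *: "0 \<le> 2 * t * (inner x z - \<phi> x) + t\<^sup>2 * (norm x)\<^sup>2" for t
    proof -
      have "m \<le> J (X n) + 2 * t * (inner x (X n) - \<phi> x) + t\<^sup>2 * (norm x)\<^sup>2" for n
      proof -
        have "m \<le> J (X n + t *\<^sub>R x)" by (intro m_le Ladd Lsc X x)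
        also have "\<dots> = J (X n) + 2 * t * (inner x (X n) - \<phi> x) + t\<^sup>2 * (norm x)\<^sup>2"
        proof -
          have "(norm (X n + t *\<^sub>R x))\<^sup>2 = (norm (X n))\<^sup>2 + 2 * t * inner x (X n) + t\<^sup>2 * (norm x)\<^sup>2"
            unfolding power2_norm_eq_inner by (simp add: algebra_simps inner_commute power2_eq_square)
          then show ?thesis
            unfolding J_def by (simp add: add[OF X(1) Lsc[OF x]] sc[OF x] algebra_simps)
        qed
        finally show ?thesis .
      qed
      then have "m \<le> m + 2 * t * (inner x z - \<phi> x) + t\<^sup>2 * (norm x)\<^sup>2"
        by (intro LIMSEQ_le_const[where X = "\<lambda>n. J (X n) + 2 * t * (inner x (X n) - \<phi> x) + t\<^sup>2 * (norm x)\<^sup>2"])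
          (auto intro!: tendsto_intros JX z)
      then show ?thesis by simp
    qed
    show ?thesis
    proof (cases "x = 0")
      case True
      then show ?thesis using sc[OF L0, of 0] by simp
    next
      case False
      define d where "d = inner x z - \<phi> x"
      define n where "n = (norm x)\<^sup>2"
      have n: "n > 0" using False by (simp add: n_def)
      \<comment> \<open>The choice \<open>t = - d / n\<close> minimizes
        \<open>2 t d + t^2 n\<close>; the minimum \<open>- d^2 / n\<close> is nonnegative only for
        \<open>d = 0\<close>.\<close>
      have "0 \<le> 2 * (- d / n) * d + (- d / n)\<^sup>2 * n" using *[of "- d / n"] by (simp only: d_def n_def)
      also have "\<dots> = - (d\<^sup>2 / n)" using n by (simp add: power2_eq_square)
      finally have "d = 0" using n by (simp add: divide_le_0_iff)
      then show ?thesis by (simp add: d_def)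
    qed
  qed
  moreover have "z \<in> closure L" using z X(1) closure_sequential by blast
  ultimately show ?thesis by blast
qed

lemma riesz:
  fixes \<phi> :: "'a::chilbert_space \<Rightarrow> complex"
  assumes L: "csubspace L"
    and add: "\<And>x y. x \<in> L \<Longrightarrow> y \<in> L \<Longrightarrow> \<phi> (x + y) = \<phi> x + \<phi> y"
    and sc: "\<And>c x. x \<in> L \<Longrightarrow> \<phi> (c *\<^sub>C x) = c * \<phi> x"
    and bd: "\<And>x. x \<in> L \<Longrightarrow> cmod (\<phi> x) \<le> C * norm x"
  shows "\<exists>z\<in>closure L. \<forall>x\<in>L. \<phi> x = cinner x z"
proof -
  have "\<exists>z\<in>closure L. \<forall>x\<in>L. Re (\<phi> x) = inner x z"
  proof (rule riesz_real)
    show "Re (\<phi> (r *\<^sub>R x)) = r * Re (\<phi> x)" if "x \<in> L" for r x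
      using sc[OF that, of "complex_of_real r"] by (simp add: scaleC_of_real)
    show "\<bar>Re (\<phi> x)\<bar> \<le> C * norm x" if "x \<in> L" for x
      using bd[OF that] abs_Re_le_cmod[of "\<phi> x"] by linarith
  qed (use L add in \<open>auto simp: csubspaceD\<close>)
  then obtain z where z: "z \<in> closure L" "\<And>x. x \<in> L \<Longrightarrow> Re (\<phi> x) = Re (cinner x z)"
    by (auto simp: Re_cinner)
  \<comment> \<open>Only real parts agree so far; replacing \<open>x\<close> by \<open>\<i>\<close>
    times \<open>x\<close> turns imaginary parts into real ones.\<close>
  have "\<phi> x = cinner x z" if x: "x \<in> L" for x
  proof -
    have "Re (\<phi> (\<i> *\<^sub>C x)) = Re (cinner (\<i> *\<^sub>C x) z)"
      by (intro z(2) csubspaceD L x)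
    then have "Im (\<phi> x) = Im (cinner x z)" by (simp add: sc x cinner_scaleC_left)
    with z(2)[OF x] show ?thesis by (simp add: complex_eq_iff)
  qed
  with z(1) show ?thesis by blast
qed

lemma csubspace_cinner_unique:
  assumes M: "csubspace M" and "z \<in> M" "z' \<in> M" "\<And>x. x \<in> M \<Longrightarrow> cinner x z = cinner x z'"
  shows "z = z'"
proof -
  have "z - z' \<in> M" by (intro csubspaceD assms)
  then have "cinner (z - z') (z - z') = 0" using assms(4) by (simp add: cinner.diff_right)
  then show ?thesis unfolding cinner_self by simp
qed

lemma adj_eqI:
  assumes "csubspace M" "z \<in> M" "\<And>x. x \<in> M \<Longrightarrow> cinner (T x) y = cinner x z"
  shows "adj M N T y = z"
  unfolding adj_def
  using assms(2,3) by (intro the_equality) (auto intro: csubspace_cinner_unique[OF assms(1)])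

text \<open>The Riesz vector exists for every \<open>y\<close> of the ambient type, not only in
  \<open>N\<close>. This allows comparing the adjoint of a restriction with an everywhere defined
  operator as functions.\<close>

lemma adj_spec:
  assumes M: "closed_csubspace M" and T: "T \<in> bop M N"
  shows "adj M N T y \<in> M" "x \<in> M \<Longrightarrow> cinner (T x) y = cinner x (adj M N T y)"
proof -
  obtain K where K: "K \<ge> 0" "\<And>x. x \<in> M \<Longrightarrow> norm (T x) \<le> K * norm x"
    using bop_bounded_on[OF T] by auto
  have "\<exists>z\<in>closure M. \<forall>x\<in>M. cinner (T x) y = cinner x z"
  proof (rule riesz[where C = "K * norm y"])
    show "cmod (cinner (T x) y) \<le> K * norm y * norm x" if "x \<in> M" for x
    proof -
      have "cmod (cinner (T x) y) \<le> norm (T x) * norm y" by (rule cmod_cinner_le_norm)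
      also have "\<dots> \<le> (K * norm x) * norm y" by (intro mult_right_mono K that) simp
      finally show ?thesis by (simp add: mult_ac)
    qed
  qed (use T closed_csubspaceD[OF M] in \<open>auto simp: bop_def cinner_add_left cinner_scaleC_left\<close>)
  then obtain z where z: "z \<in> M" "\<And>x. x \<in> M \<Longrightarrow> cinner (T x) y = cinner x z"
    using closed_csubspaceD(2)[OF M] by auto
  have eq: "adj M N T y = z" by (rule adj_eqI[OF closed_csubspaceD(1)[OF M] z])
  show "adj M N T y \<in> M" "x \<in> M \<Longrightarrow> cinner (T x) y = cinner x (adj M N T y)"
    using z by (simp_all add: eq)
qed

abbreviation ad :: "('a::chilbert_space \<Rightarrow> 'b::chilbert_space) \<Rightarrow> 'b \<Rightarrow> 'a"
  where "ad T \<equiv> adj UNIV UNIV T"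

lemma cinner_ad: "T \<in> bops \<Longrightarrow> cinner (T x) y = cinner x (ad T y)"
  by (simp add: adj_spec)

lemma cinner_ad': "T \<in> bops \<Longrightarrow> cinner (ad T y) x = cinner y (T x)"
  by (metis cinner_ad cinner_commute)

lemma norm_ad_le:
  assumes T: "T \<in> bops" and K: "\<And>x. norm (T x) \<le> K * norm x" "K \<ge> 0"
  shows "norm (ad T y) \<le> K * norm y"
proof (cases "ad T y = 0")
  case False
  have "(norm (ad T y))\<^sup>2 = cmod (cinner (ad T y) (ad T y))" by (simp add: cinner_self norm_power)
  also have "\<dots> = cmod (cinner (T (ad T y)) y)" by (simp add: cinner_ad[OF T])
  also have "\<dots> \<le> norm (T (ad T y)) * norm y" by (rule cmod_cinner_le_norm)
  also have "\<dots> \<le> K * norm (ad T y) * norm y" by (intro mult_right_mono K) simp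
  finally show ?thesis using False by (simp add: power2_eq_square mult_ac)
qed (use K in simp)

lemma ad_bop:
  assumes T: "T \<in> bops"
  shows "ad T \<in> bops"
proof -
  obtain K where K: "K \<ge> 0" "\<And>x. norm (T x) \<le> K * norm x" using bop_bound[OF T] by auto
  show ?thesis
  proof (rule bopI[of _ K])
    show "ad T (x + y) = ad T x + ad T y" for x y
      by (rule cinner_ext) (simp add: cinner_ad[OF T, symmetric] cinner_add_right)
    show "ad T (c *\<^sub>C x) = c *\<^sub>C ad T x" for c x
      by (rule cinner_ext) (simp add: cinner_ad[OF T, symmetric] cinner_scaleC_right)
  qed (rule norm_ad_le[OF T K(2,1)])
qed

lemma ad_unique:
  assumes "\<And>x y. cinner (T x) y = cinner x (S y)"
  shows "ad T = S"
  by (rule ext) (simp add: adj_eqI assms)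

lemma ad_ad: "T \<in> bops \<Longrightarrow> ad (ad T) = T"
  by (intro ad_unique cinner_ad')

lemma ad_comp: "S \<in> bops \<Longrightarrow> T \<in> bops \<Longrightarrow> ad (\<lambda>x. S (T x)) = (\<lambda>y. ad T (ad S y))"
  by (intro ad_unique) (simp add: cinner_ad)

section \<open>Orthogonal projections\<close>

lemma proj_eqI:
  assumes M: "csubspace M" and "z \<in> M" "\<And>y. y \<in> M \<Longrightarrow> cinner (x - z) y = 0"
  shows "proj M x = z"
  unfolding proj_def
proof (intro the_equality)
  fix z' assume z': "z' \<in> M \<and> (\<forall>y\<in>M. cinner (x - z') y = 0)"
  have "cinner y z' = cinner y z" if "y \<in> M" for y
    using z' assms(3)[OF that] that
    by (metis cinner.diff_left cinner_commute eq_iff_diff_eq_0)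
  then show "z' = z" using csubspace_cinner_unique[OF M] z' assms(2) by blast
qed (use assms in auto)

lemma proj_spec:
  assumes M: "closed_csubspace M"
  shows "proj M x \<in> M" "y \<in> M \<Longrightarrow> cinner (proj M x) y = cinner x y"
    "y \<in> M \<Longrightarrow> cinner y (proj M x) = cinner y x"
proof -
  have "\<exists>z\<in>closure M. \<forall>y\<in>M. cinner y x = cinner y z"
    by (rule riesz[where C = "norm x"])
      (use closed_csubspaceD[OF M] cmod_cinner_le_norm[of _ x] in
        \<open>auto simp: cinner_add_left cinner_scaleC_left mult.commute\<close>)
  then obtain z where z: "z \<in> M" "\<And>y. y \<in> M \<Longrightarrow> cinner y x = cinner y z"
    using closed_csubspaceD(2)[OF M] by auto
  have z': "cinner x y = cinner z y" if "y \<in> M" for y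
    using z(2)[OF that] by (metis cinner_commute)
  have eq: "proj M x = z"
    by (rule proj_eqI[OF closed_csubspaceD(1)[OF M] z(1)]) (simp add: cinner.diff_left z')
  show "proj M x \<in> M" "y \<in> M \<Longrightarrow> cinner (proj M x) y = cinner x y"
    "y \<in> M \<Longrightarrow> cinner y (proj M x) = cinner y x"
    using z z' by (simp_all add: eq)
qed

lemma norm_proj_le:
  assumes M: "closed_csubspace M"
  shows "norm (proj M x) \<le> norm x"
proof -
  have "(norm (proj M x))\<^sup>2 = cmod (cinner (proj M x) (proj M x))" by (simp add: cinner_self norm_power)
  also have "\<dots> = cmod (cinner x (proj M x))" by (simp only: proj_spec(2)[OF M proj_spec(1)[OF M]])
  also have "\<dots> \<le> norm x * norm (proj M x)" by (rule cmod_cinner_le_norm)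
  finally show ?thesis by (cases "proj M x = 0") (auto simp: power2_eq_square)
qed

lemma proj_bop:
  assumes M: "closed_csubspace M"
  shows "proj M \<in> bops"
proof (rule bopI[of _ 1])
  note S = closed_csubspaceD(1)[OF M]
  show "proj M (x + y) = proj M x + proj M y" for x y
    by (rule proj_eqI[OF S])
      (auto intro: csubspaceD[OF S] simp: proj_spec[OF M] cinner.diff_left cinner_add_left)
  show "proj M (c *\<^sub>C x) = c *\<^sub>C proj M x" for c x
    by (rule proj_eqI[OF S])
      (auto intro: csubspaceD[OF S] simp: proj_spec[OF M] cinner.diff_left cinner_scaleC_left)
  show "norm (proj M x) \<le> 1 * norm x" for x using norm_proj_le[OF M] by simp
qed

lemma csubspace_image:
  assumes T: "T \<in> bops" and M: "csubspace M"
  shows "csubspace (T ` M)"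
  unfolding csubspace_def
proof (intro conjI ballI allI)
  show "0 \<in> T ` M" by (rule image_eqI[of _ _ 0]) (simp_all add: csubspaceD(1)[OF M] bop_linear(3)[OF T])
  fix x y a assume "x \<in> T ` M"
  then obtain m where m: "m \<in> M" "x = T m" by blast
  show "a *\<^sub>C x \<in> T ` M"
    by (rule image_eqI[of _ _ "a *\<^sub>C m"]) (simp_all add: m csubspaceD(3)[OF M] bop_scaleC[OF T])
  assume "y \<in> T ` M"
  then obtain n where n: "n \<in> M" "y = T n" by blast
  show "x + y \<in> T ` M"
    by (rule image_eqI[of _ _ "m + n"]) (simp_all add: m n csubspaceD(2)[OF M] bop_linear(1)[OF T])
qed

text \<open>The adjoint of \<open>V\<close> comes from the Riesz representation on the range of \<open>p\<close>, which need not be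
  closed; so no completion argument is required.\<close>

lemma douglas:
  fixes p :: "'m::chilbert_space \<Rightarrow> 'a::chilbert_space" and q :: "'m \<Rightarrow> 'b::chilbert_space"
  assumes M: "csubspace M" and p: "p \<in> bops" and q: "q \<in> bops"
    and le: "\<And>m. m \<in> M \<Longrightarrow> norm (q m) \<le> norm (p m)"
  shows "\<exists>V\<in>bops. (\<forall>x. norm (V x) \<le> norm x) \<and> (\<forall>m\<in>M. V (p m) = q m)"
proof -
  define L where "L = p ` M"
  have L: "csubspace L" unfolding L_def by (rule csubspace_image[OF p M])
  \<comment> \<open>The choice is harmless: by \<open>le\<close>, two preimages with the same
    \<open>p\<close> value have the same \<open>q\<close> value.\<close>
  define r where "r x = q (SOME m. m \<in> M \<and> p m = x)" for x
  have rp: "r (p m) = q m" if m: "m \<in> M" for m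
  proof -
    let ?n = "SOME n. n \<in> M \<and> p n = p m"
    have n: "?n \<in> M \<and> p ?n = p m" by (rule someI[of _ m]) (simp add: m)
    have "norm (q (?n - m)) \<le> norm (p (?n - m))" by (intro le csubspaceD M) (use n m in auto)
    then show ?thesis using n by (simp add: r_def bop_linear[OF p] bop_linear[OF q])
  qed
  have r_add: "r (x + y) = r x + r y" if xy: "x \<in> L" "y \<in> L" for x y
  proof -
    obtain m n where mn: "m \<in> M" "n \<in> M" "x = p m" "y = p n" using xy by (auto simp: L_def)
    have "x + y = p (m + n)" by (simp add: mn bop_linear[OF p])
    then show ?thesis by (simp add: mn rp csubspaceD[OF M] bop_linear[OF q])
  qed
  have r_sc: "r (c *\<^sub>C x) = c *\<^sub>C r x" if x: "x \<in> L" for x c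
  proof -
    obtain m where m: "m \<in> M" "x = p m" using x by (auto simp: L_def)
    have "c *\<^sub>C x = p (c *\<^sub>C m)" by (simp add: m bop_scaleC[OF p])
    then show ?thesis by (simp add: m rp csubspaceD[OF M] bop_scaleC[OF q])
  qed
  have r_le: "norm (r x) \<le> norm x" if "x \<in> L" for x
    using that le by (auto simp: L_def rp)
  have "\<exists>z\<in>closure L. \<forall>x\<in>L. cinner (r x) y = cinner x z" for y
  proof (rule riesz[OF L, where C = "norm y"])
    show "cmod (cinner (r x) y) \<le> norm y * norm x" if "x \<in> L" for x
      using order_trans[OF cmod_cinner_le_norm mult_right_mono[OF r_le[OF that] norm_ge_zero[of y]]]
      by (simp add: mult.commute)
  qed (simp_all add: r_add r_sc cinner_add_left cinner_scaleC_left)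
  then obtain R where R: "\<And>y. R y \<in> closure L" "\<And>y x. x \<in> L \<Longrightarrow> cinner (r x) y = cinner x (R y)"
    by metis
  have approx: "cinner a z = cinner b z" if ab: "\<And>x. x \<in> L \<Longrightarrow> cinner a x = cinner b x" and z: "z \<in> closure L"
    for a b z
  proof -
    from z obtain X where X': "\<forall>n. X n \<in> L" "X \<longlonglongrightarrow> z"
      unfolding closure_sequential by (elim exE conjE) (rule that)
    have X: "\<And>n. X n \<in> L" "X \<longlonglongrightarrow> z" using X' by auto
    have "(\<lambda>n. cinner a (X n)) \<longlonglongrightarrow> cinner a z" by (intro cinner.tendsto tendsto_const X)
    moreover have "(\<lambda>n. cinner a (X n)) \<longlonglongrightarrow> cinner b z"
      unfolding ab[OF X(1)] by (intro cinner.tendsto tendsto_const X)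
    ultimately show ?thesis by (rule LIMSEQ_unique)
  qed
  \<comment> \<open>\<open>R\<close> is known only through inner products with \<open>L\<close>.
    They determine a vector inside the closure of \<open>L\<close>, which is what linearity of
    \<open>R\<close> rests on.\<close>
  have eq_closure: "a = b"
    if ab: "a - b \<in> closure L" "\<And>x. x \<in> L \<Longrightarrow> cinner x a = cinner x b" for a b
  proof -
    have "cinner a x = cinner b x" if "x \<in> L" for x
      unfolding cinner_commute[of a x] cinner_commute[of b x] by (simp only: ab(2)[OF that])
    then have "cinner a (a - b) = cinner b (a - b)" by (rule approx[OF _ ab(1)])
    then have "cinner (a - b) (a - b) = 0" by (simp add: cinner.diff_left)
    then show ?thesis by (simp add: cinner_self)
  qed
  have clL: "csubspace (closure L)"
    unfolding csubspace_def
  proof (intro conjI ballI allI)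
    show "0 \<in> closure L" using csubspaceD(1)[OF L] closure_subset by blast
    fix x y c assume "x \<in> closure L"
    then obtain X where X': "\<forall>n. X n \<in> L" "X \<longlonglongrightarrow> x"
      unfolding closure_sequential by (elim exE conjE) (rule that)
    have X: "\<And>n. X n \<in> L" "X \<longlonglongrightarrow> x" using X' by auto
    show "c *\<^sub>C x \<in> closure L"
      unfolding closure_sequential
      by (intro exI[of _ "\<lambda>n. c *\<^sub>C X n"] conjI allI csubspaceD(3)[OF L X(1)]
          bounded_linear.tendsto[OF bounded_linear_scaleC X(2)])
    assume "y \<in> closure L"
    then obtain Y where Y': "\<forall>n. Y n \<in> L" "Y \<longlonglongrightarrow> y"
      unfolding closure_sequential by (elim exE conjE) (rule that)
    have Y: "\<And>n. Y n \<in> L" "Y \<longlonglongrightarrow> y" using Y' by auto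
    show "x + y \<in> closure L"
      unfolding closure_sequential
      by (intro exI[of _ "\<lambda>n. X n + Y n"] conjI allI csubspaceD(2)[OF L X(1) Y(1)]
          tendsto_add[OF X(2) Y(2)])
  qed
  have R_le: "norm (R y) \<le> norm y" for y
  proof -
    from R(1)[of y] obtain X where X': "\<forall>n. X n \<in> L" "X \<longlonglongrightarrow> R y"
      unfolding closure_sequential by (elim exE conjE) (rule that)
    have X: "\<And>n. X n \<in> L" "X \<longlonglongrightarrow> R y" using X' by auto
    have "cmod (cinner (X n) (R y)) \<le> norm (X n) * norm y" for n
      using order_trans[OF cmod_cinner_le_norm mult_right_mono[OF r_le[OF X(1)[of n]] norm_ge_zero[of y]]]
      by (simp add: R(2)[OF X(1), symmetric])
    then have "cmod (cinner (R y) (R y)) \<le> norm (R y) * norm y"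
      by (intro tendsto_le[OF _ tendsto_mult[OF tendsto_norm[OF X(2)] tendsto_const]
            tendsto_norm[OF cinner.tendsto[OF X(2) tendsto_const]]] always_eventually) auto
    then show ?thesis
      by (cases "R y = 0") (auto simp: cinner_self norm_power power2_eq_square norm_mult)
  qed
  have Rb: "R \<in> bops"
  proof (rule bopI[of _ 1])
    show "R (x + y) = R x + R y" for x y
      by (rule eq_closure, intro csubspaceD clL R)
        (simp add: cinner_add_right R(2)[symmetric])
    show "R (c *\<^sub>C x) = c *\<^sub>C R x" for c x
      by (rule eq_closure, intro csubspaceD clL R)
        (simp add: cinner_scaleC_right R(2)[symmetric])
  qed (simp add: R_le)
  \<comment> \<open>\<open>V = ad R\<close> extends \<open>r\<close> by zero on the orthogonal
    complement of \<open>L\<close>.\<close>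
  have "ad R (p m) = q m" if "m \<in> M" for m
  proof (rule cinner_ext)
    fix y
    have "cinner (r (p m)) y = cinner (p m) (R y)" by (rule R(2)) (simp add: L_def that)
    then show "cinner y (ad R (p m)) = cinner y (q m)"
      by (metis cinner_ad[OF Rb] cinner_commute rp[OF that])
  qed
  moreover have "norm (ad R x) \<le> norm x" for x
    using norm_ad_le[OF Rb, of 1] R_le by simp
  ultimately show ?thesis using ad_bop[OF Rb] by blast
qed

section \<open>Square-summable families\<close>

lemma ell2_eqI: "(\<And>i. ell2_nth f i = ell2_nth g i) \<Longrightarrow> f = g"
  by (rule ell2_nth_inject[THEN iffD1]) (rule ext)

lemma ell2_nth_Abs: "(\<lambda>i. (norm (f i))\<^sup>2) summable_on UNIV \<Longrightarrow> ell2_nth (Abs_ell2 f) = f"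
  by (rule Abs_ell2_inverse) simp

lemma ell2_boundedI:
  assumes "\<And>A. finite A \<Longrightarrow> (\<Sum>i\<in>A. (norm (f i))\<^sup>2) \<le> B"
  shows "(\<lambda>i. (norm (f i))\<^sup>2) summable_on UNIV" "ell2_nth (Abs_ell2 f) = f"
    "(norm (Abs_ell2 f))\<^sup>2 \<le> B"
proof -
  show s: "(\<lambda>i. (norm (f i))\<^sup>2) summable_on UNIV"
    by (rule nonneg_bdd_above_summable_on) (auto intro!: bdd_aboveI2 assms)
  show e: "ell2_nth (Abs_ell2 f) = f" by (rule ell2_nth_Abs[OF s])
  show "(norm (Abs_ell2 f))\<^sup>2 \<le> B"
    unfolding ell2_norm_sq e by (rule infsum_le_finite_sums[OF s]) (simp add: assms)
qed

lemmas ell2_nth_simps = plus_ell2.rep_eq minus_ell2.rep_eq scaleR_ell2.rep_eq scaleC_ell2.rep_eq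
  zero_ell2.rep_eq uminus_ell2.rep_eq

lemma ell2_nth_bop: "(\<lambda>h. ell2_nth h i) \<in> bops"
  by (rule bopI[of _ 1]) (simp_all add: ell2_nth_simps ell2_nth_norm_le)

lemma ell2_nth_sum: "ell2_nth (sum f A) i = (\<Sum>a\<in>A. ell2_nth (f a) i)"
  by (rule bop_linear(5)[OF ell2_nth_bop])

lemma ell2_norm_has_sum: "((\<lambda>i. (norm (ell2_nth h i))\<^sup>2) has_sum (norm h)\<^sup>2) UNIV"
  unfolding ell2_norm_sq by (rule has_sum_infsum[OF ell2_sq_summable])

definition unit_vec :: "'i \<Rightarrow> 'e::chilbert_space \<Rightarrow> ('i, 'e) ell2"
  where "unit_vec i x = Abs_ell2 (\<lambda>j. if j = i then x else 0)"

lemma unit_vec_nth: "ell2_nth (unit_vec i x) j = (if j = i then x else 0)"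
proof -
  have "(\<lambda>j. (norm (if j = i then x else 0))\<^sup>2) summable_on UNIV
    \<longleftrightarrow> (\<lambda>j. (norm x)\<^sup>2) summable_on {i}"
    by (rule summable_on_cong_neutral) auto
  then show ?thesis unfolding unit_vec_def by (subst ell2_nth_Abs) auto
qed

lemma cinner_unit_vec_right: "cinner h (unit_vec i x) = cinner (ell2_nth h i) x"
proof -
  have "cinner h (unit_vec i x) = (\<Sum>\<^sub>\<infinity>j\<in>{i}. cinner (ell2_nth h j) x)"
    unfolding cinner_ell2_def
    by (rule infsum_cong_neutral) (auto simp: unit_vec_nth cinner.zero_right)
  then show ?thesis by simp
qed

lemma cinner_unit_vec_left: "cinner (unit_vec i x) h = cinner x (ell2_nth h i)"
  by (metis cinner_unit_vec_right cinner_commute)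

lemma norm_unit_vec: "norm (unit_vec i x) = norm x"
proof -
  have "complex_of_real ((norm (unit_vec i x))\<^sup>2) = complex_of_real ((norm x)\<^sup>2)"
    unfolding cinner_self[symmetric] by (simp add: cinner_unit_vec_right unit_vec_nth)
  then have "(norm (unit_vec i x))\<^sup>2 = (norm x)\<^sup>2" by (rule of_real_eq_iff[THEN iffD1])
  then show ?thesis by (simp add: power2_eq_iff_nonneg)
qed

lemma unit_vec_bop: "unit_vec i \<in> bops"
  by (rule bopI[of _ 1]) (auto intro!: ell2_eqI simp: unit_vec_nth ell2_nth_simps norm_unit_vec)

lemma ell2_cinner_eqI:
  assumes "\<And>i x. cinner (unit_vec i x) f = cinner (unit_vec i x) g"
  shows "f = g"
proof (rule ell2_eqI)
  fix i
  show "ell2_nth f i = ell2_nth g i"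
    by (rule cinner_ext) (simp only: cinner_unit_vec_left[symmetric] assms)
qed

text \<open>One scheme for coordinate restrictions, diagonal operators, weighted backward shifts,
  slices of the kernel and, through adjoints, forward shifts and right multiplications. The backward
  direction is the convenient one: each coordinate of the image is a single term.\<close>

definition pullback :: "('j \<Rightarrow> 'i) \<Rightarrow> ('j \<Rightarrow> real) \<Rightarrow> ('e::chilbert_space \<Rightarrow> 'k::chilbert_space)
    \<Rightarrow> ('i, 'e) ell2 \<Rightarrow> ('j, 'k) ell2"
  where "pullback \<sigma> w Z h = Abs_ell2 (\<lambda>j. w j *\<^sub>R Z (ell2_nth h (\<sigma> j)))"

text \<open>Injectivity of \<open>\<sigma>\<close> means that no coordinate of \<open>h\<close> is
  counted twice, so the norm grows by at most the bounds of the weights and of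
  \<open>Z\<close>.\<close>

lemma pullback:
  fixes h :: "('i, 'e::chilbert_space) ell2" and Z :: "'e \<Rightarrow> 'k::chilbert_space" and \<sigma> :: "'j \<Rightarrow> 'i"
  assumes \<sigma>: "inj \<sigma>" and w: "\<And>j. \<bar>w j\<bar> \<le> C" and Z: "Z \<in> bops"
    and K: "\<And>x. norm (Z x) \<le> K * norm x" "0 \<le> K"
  shows pullback_nth: "ell2_nth (pullback \<sigma> w Z h) j = w j *\<^sub>R Z (ell2_nth h (\<sigma> j))"
    and norm_pullback_le: "norm (pullback \<sigma> w Z h) \<le> C * K * norm h"
    and pullback_bop: "pullback \<sigma> w Z \<in> bops"
proof -
  have C: "0 \<le> C" using order_trans[OF abs_ge_zero w] by blast
  have fin: "(\<Sum>j\<in>A. (norm (w j *\<^sub>R Z (ell2_nth h (\<sigma> j))))\<^sup>2) \<le> (C * K * norm h)\<^sup>2"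
    if A: "finite A" for A and h :: "('i, 'e) ell2"
  proof -
    have "(\<Sum>j\<in>A. (norm (w j *\<^sub>R Z (ell2_nth h (\<sigma> j))))\<^sup>2)
        \<le> (\<Sum>j\<in>A. (C * K)\<^sup>2 * (norm (ell2_nth h (\<sigma> j)))\<^sup>2)"
    proof (rule sum_mono)
      fix j
      have "norm (w j *\<^sub>R Z (ell2_nth h (\<sigma> j))) \<le> C * (K * norm (ell2_nth h (\<sigma> j)))"
        unfolding norm_scaleR by (intro mult_mono w K C norm_ge_zero)
      from power_mono[OF this norm_ge_zero, of 2]
      show "(norm (w j *\<^sub>R Z (ell2_nth h (\<sigma> j))))\<^sup>2 \<le> (C * K)\<^sup>2 * (norm (ell2_nth h (\<sigma> j)))\<^sup>2"
        by (simp add: power_mult_distrib mult.assoc)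
    qed
    also have "\<dots> = (C * K)\<^sup>2 * (\<Sum>i\<in>\<sigma> ` A. (norm (ell2_nth h i))\<^sup>2)"
      using \<sigma> by (simp add: sum_distrib_left sum.reindex inj_on_subset)
    also have "\<dots> \<le> (C * K)\<^sup>2 * (norm h)\<^sup>2"
      using A by (intro mult_left_mono ell2_norm_bound) auto
    finally show ?thesis by (simp add: power_mult_distrib)
  qed
  show nth: "ell2_nth (pullback \<sigma> w Z h) j = w j *\<^sub>R Z (ell2_nth h (\<sigma> j))" for h j
    unfolding pullback_def by (simp add: ell2_boundedI(2)[OF fin])
  show le: "norm (pullback \<sigma> w Z h) \<le> C * K * norm h" for h
    using ell2_boundedI(3)[OF fin, of h] C K(2) unfolding pullback_def
    by (simp add: power2_le_iff_abs_le)
  show "pullback \<sigma> w Z \<in> bops"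
    by (rule bopI[OF _ _ le])
      (auto intro!: ell2_eqI simp: nth ell2_nth_simps bop_linear[OF Z] bop_scaleC[OF Z]
        scaleR_add_right scaleR_scaleC)
qed

definition restr :: "'i set \<Rightarrow> ('i, 'e::chilbert_space) ell2 \<Rightarrow> ('i, 'e) ell2"
  where "restr S = pullback id (indicator S) id"

lemma
  fixes h :: "('i, 'e::chilbert_space) ell2"
  shows restr_nth: "ell2_nth (restr S h) i = (if i \<in> S then ell2_nth h i else 0)"
  and norm_restr_le: "norm (restr S h) \<le> norm h"
  and restr_bop: "(restr S :: ('i, 'e) ell2 \<Rightarrow> _) \<in> bops"
proof -
  have w: "\<bar>indicator S i :: real\<bar> \<le> 1" for i :: 'i by (simp add: indicator_def)
  note P = pullback[OF inj_on_id w bop_id(1), where K = 1, simplified]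
  show "ell2_nth (restr S h) i = (if i \<in> S then ell2_nth h i else 0)"
    by (simp add: restr_def P(1))
  show "norm (restr S h) \<le> norm h"
    by (simp add: restr_def P(2))
  show "(restr S :: ('i, 'e) ell2 \<Rightarrow> _) \<in> bops"
    unfolding restr_def by (rule P(3))
qed

lemma restr_UNIV: "restr UNIV h = h"
  by (rule ell2_eqI) (simp add: restr_nth)

lemma restr_finite: "finite A \<Longrightarrow> restr A h = (\<Sum>i\<in>A. unit_vec i (ell2_nth h i))"
  by (rule ell2_eqI) (simp add: restr_nth ell2_nth_sum unit_vec_nth sum.delta)

lemma norm_restr_finite:
  assumes "finite A"
  shows "(norm (restr A h))\<^sup>2 = (\<Sum>i\<in>A. (norm (ell2_nth h i))\<^sup>2)"
proof -
  have "(norm (restr A h))\<^sup>2 = (\<Sum>\<^sub>\<infinity>i\<in>A. (norm (ell2_nth h i))\<^sup>2)"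
    unfolding ell2_norm_sq by (rule infsum_cong_neutral) (auto simp: restr_nth)
  then show ?thesis using assms by simp
qed

lemma norm_restr_Compl: "(norm (restr S h))\<^sup>2 + (norm (restr (- S) h))\<^sup>2 = (norm h)\<^sup>2"
proof -
  have "((\<lambda>i. (norm (ell2_nth (restr S h) i))\<^sup>2 + (norm (ell2_nth (restr (- S) h) i))\<^sup>2)
      has_sum (norm (restr S h))\<^sup>2 + (norm (restr (- S) h))\<^sup>2) UNIV"
    by (intro has_sum_add ell2_norm_has_sum)
  moreover have "(norm (ell2_nth (restr S h) i))\<^sup>2 + (norm (ell2_nth (restr (- S) h) i))\<^sup>2
      = (norm (ell2_nth h i))\<^sup>2" for i
    by (simp add: restr_nth)
  ultimately show ?thesis using has_sum_unique[OF ell2_norm_has_sum[of h]] by simp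
qed

lemma diff_restr: "h - restr S h = restr (- S) h"
  by (rule ell2_eqI) (simp add: ell2_nth_simps restr_nth)

text \<open>By Pythagoras the squared error is the full sum of squares minus a finite partial
  sum.\<close>

lemma tendsto_restr:
  fixes h :: "('i, 'e::chilbert_space) ell2"
  shows "((\<lambda>A. restr A h) \<longlongrightarrow> h) (finite_subsets_at_top UNIV)"
proof -
  have "((\<lambda>A. \<Sum>i\<in>A. (norm (ell2_nth h i))\<^sup>2) \<longlongrightarrow> (norm h)\<^sup>2) (finite_subsets_at_top UNIV)"
    using ell2_norm_has_sum[of h] by (simp add: has_sum_def)
  then have "((\<lambda>A. sqrt ((norm h)\<^sup>2 - (\<Sum>i\<in>A. (norm (ell2_nth h i))\<^sup>2))) \<longlongrightarrow> sqrt ((norm h)\<^sup>2 - (norm h)\<^sup>2))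
      (finite_subsets_at_top UNIV)"
    by (intro tendsto_intros)
  then have lim: "((\<lambda>A. sqrt ((norm h)\<^sup>2 - (\<Sum>i\<in>A. (norm (ell2_nth h i))\<^sup>2))) \<longlongrightarrow> 0)
      (finite_subsets_at_top UNIV)" by simp
  have "((\<lambda>A. norm (restr A h - h)) \<longlongrightarrow> 0) (finite_subsets_at_top UNIV)"
  proof (rule Lim_transform_eventually[OF lim])
    show "\<forall>\<^sub>F A in finite_subsets_at_top UNIV.
        sqrt ((norm h)\<^sup>2 - (\<Sum>i\<in>A. (norm (ell2_nth h i))\<^sup>2)) = norm (restr A h - h)"
    proof (rule eventually_finite_subsets_at_top_weakI)
      fix A :: "'i set" assume A: "finite A"
      have "(norm (restr A h - h))\<^sup>2 = (norm h)\<^sup>2 - (\<Sum>i\<in>A. (norm (ell2_nth h i))\<^sup>2)"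
        using norm_restr_Compl[of A h] unfolding norm_restr_finite[OF A]
        by (simp add: norm_minus_commute[of "restr A h"] diff_restr)
      then show "sqrt ((norm h)\<^sup>2 - (\<Sum>i\<in>A. (norm (ell2_nth h i))\<^sup>2)) = norm (restr A h - h)"
        by (metis norm_ge_zero real_sqrt_unique)
    qed
  qed
  then show ?thesis
    by (subst Lim_null) (simp add: tendsto_norm_zero_iff)
qed

lemma bop_eq_on_unit_vecs:
  assumes S: "S \<in> bops" and T: "T \<in> bops" and eq: "\<And>i x. S (unit_vec i x) = T (unit_vec i x)"
  shows "S = T"
proof
  fix h
  have "((\<lambda>A. S (restr A h)) \<longlongrightarrow> S h) (finite_subsets_at_top UNIV)"
    by (rule bop_tendsto[OF S tendsto_restr])
  moreover have "((\<lambda>A. S (restr A h)) \<longlongrightarrow> T h) (finite_subsets_at_top UNIV)"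
  proof (rule Lim_transform_eventually[OF bop_tendsto[OF T tendsto_restr]])
    show "\<forall>\<^sub>F A in finite_subsets_at_top UNIV. T (restr A h) = S (restr A h)"
      by (rule eventually_finite_subsets_at_top_weakI)
        (simp add: restr_finite bop_linear(5)[OF S] bop_linear(5)[OF T] eq)
  qed
  ultimately show "S h = T h"
    using tendsto_unique[OF finite_subsets_at_top_neq_bot] by blast
qed

lemma finite_words: "finite {\<gamma> :: 'n::finite list. length \<gamma> \<le> k}" "finite {\<gamma> :: 'n list. length \<gamma> < k}"
    "finite {\<gamma> :: 'n list. length \<gamma> = k}"
proof -
  show 1: "finite {\<gamma> :: 'n list. length \<gamma> \<le> k}"
    using finite_lists_length_le[of "UNIV :: 'n set" k] by simp
  show "finite {\<gamma> :: 'n list. length \<gamma> < k}" "finite {\<gamma> :: 'n list. length \<gamma> = k}"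
    by (auto intro: finite_subset[OF _ 1])
qed

text \<open>Over a finite alphabet the words of bounded length form finite sets that eventually
  contain any given finite set, so truncation by length follows from truncation to finite
  sets.\<close>

lemma tendsto_restr_length:
  fixes h :: "('n::finite, 'e::chilbert_space) fock"
  shows "(\<lambda>k. restr {\<gamma>. length \<gamma> < k} h) \<longlonglongrightarrow> h" "(\<lambda>k. restr {\<gamma>. length \<gamma> \<ge> k} h) \<longlonglongrightarrow> 0"
proof -
  have "filterlim (\<lambda>k. {\<gamma> :: 'n list. length \<gamma> < k}) (finite_subsets_at_top UNIV) sequentially"
    unfolding filterlim_finite_subsets_at_top
  proof (intro allI impI)
    fix A :: "'n list set" assume "finite A \<and> A \<subseteq> UNIV"
    then have "finite (length ` A)" by simp
    then obtain m where "\<forall>k\<in>length ` A. k \<le> m" using finite_nat_set_iff_bounded_le by blast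
    then show "\<forall>\<^sub>F k in sequentially. finite {\<gamma> :: 'n list. length \<gamma> < k}
        \<and> A \<subseteq> {\<gamma>. length \<gamma> < k} \<and> {\<gamma> :: 'n list. length \<gamma> < k} \<subseteq> UNIV"
      using finite_words by (intro eventually_sequentiallyI[of "Suc m"]) (auto simp: less_Suc_eq_le intro: le_less_trans)
  qed
  from filterlim_compose[OF tendsto_restr this]
  show 1: "(\<lambda>k. restr {\<gamma>. length \<gamma> < k} h) \<longlonglongrightarrow> h" .
  have "- {\<gamma> :: 'n list. length \<gamma> < k} = {\<gamma>. length \<gamma> \<ge> k}" for k by auto
  then show "(\<lambda>k. restr {\<gamma>. length \<gamma> \<ge> k} h) \<longlonglongrightarrow> 0"
    using tendsto_diff[OF tendsto_const[of h] 1] by (simp add: diff_restr)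
qed

section \<open>Elementary tensors\<close>

lemma
  fixes \<phi> :: "('b, complex) fock" and x :: "'e::chilbert_space"
  shows tensor_vec_nth: "ell2_nth (tensor_vec \<phi> x) \<alpha> = ell2_nth \<phi> \<alpha> *\<^sub>C x"
  and tensor_vec_bop: "(\<lambda>\<phi> :: ('b, complex) fock. tensor_vec \<phi> x) \<in> bops"
proof -
  have fin: "(\<Sum>\<alpha>\<in>A. (norm (ell2_nth \<phi> \<alpha> *\<^sub>C x))\<^sup>2) \<le> (norm x * norm \<phi>)\<^sup>2"
    if "finite A" for A and \<phi> :: "('b, complex) fock"
  proof -
    have "(\<Sum>\<alpha>\<in>A. (norm (ell2_nth \<phi> \<alpha> *\<^sub>C x))\<^sup>2) = (norm x)\<^sup>2 * (\<Sum>\<alpha>\<in>A. (norm (ell2_nth \<phi> \<alpha>))\<^sup>2)"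
      by (simp add: norm_scaleC power_mult_distrib sum_distrib_left mult.commute)
    also have "\<dots> \<le> (norm x)\<^sup>2 * (norm \<phi>)\<^sup>2" by (intro mult_left_mono ell2_norm_bound that) simp
    finally show ?thesis by (simp add: power_mult_distrib)
  qed
  show nth: "ell2_nth (tensor_vec \<phi> x) \<alpha> = ell2_nth \<phi> \<alpha> *\<^sub>C x" for \<phi> :: "('b, complex) fock" and \<alpha>
    unfolding tensor_vec_def by (simp add: ell2_boundedI(2)[OF fin])
  show "(\<lambda>\<phi> :: ('b, complex) fock. tensor_vec \<phi> x) \<in> bops"
  proof (rule bopI[of _ "norm x"])
    show "norm (tensor_vec \<phi> x) \<le> norm x * norm \<phi>" for \<phi> :: "('b, complex) fock"
      using ell2_boundedI(3)[OF fin, of \<phi>] unfolding tensor_vec_def by (simp add: power2_le_iff_abs_le)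
  qed (auto intro!: ell2_eqI simp: nth ell2_nth_simps scaleC_add_left scaleC_scaleC scaleC_complex_def)
qed

lemma tensor_vec_unit_vec: "tensor_vec (unit_vec \<alpha> c) x = unit_vec \<alpha> (c *\<^sub>C x)"
proof -
  have "0 *\<^sub>C x = 0" using scaleC_of_real[of 0 x] by simp
  then show ?thesis by (intro ell2_eqI) (simp add: tensor_vec_nth unit_vec_nth)
qed

text \<open>The definite description in \<open>tensor_op\<close> is resolved because every
  \<open>unit_vec i x\<close> is an elementary tensor, and finite sums of these are dense.\<close>

lemma tensor_op_eqI:
  assumes "T \<in> bops" "\<And>\<phi> x. T (tensor_vec \<phi> x) = tensor_vec (\<psi> \<phi>) (Y x)"
  shows "tensor_op \<psi> Y = T"
  unfolding tensor_op_def
proof (rule the_equality)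
  fix S assume S: "S \<in> bops \<and> (\<forall>\<phi> x. S (tensor_vec \<phi> x) = tensor_vec (\<psi> \<phi>) (Y x))"
  have "S (unit_vec i x) = T (unit_vec i x)" for i x
  proof -
    have "unit_vec i x = tensor_vec (unit_vec i 1) x"
      using scaleC_of_real[of 1 x] by (simp add: tensor_vec_unit_vec)
    then show ?thesis using S assms(2) by simp
  qed
  then show "S = T" using S assms(1) by (intro bop_eq_on_unit_vecs) auto
qed (use assms in auto)

section \<open>A defect operator of a contraction\<close>

text \<open>Instead of the square root of \<open>1 - T\<close> for \<open>T = C\<^sup>* C\<close>, the expansion
  \<open>1 - x = (\<Sum>k. x ^ k * (1 - x)\<^sup>2)\<close> on \<open>[0, 1)\<close> provides a row of operators; here \<open>u k x\<close> stands for
  \<open>T\<close> to the power \<open>k / 2\<close> applied to \<open>x\<close>.\<close>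

lemma defect_operator:
  fixes C :: "'a::chilbert_space \<Rightarrow> 'b::chilbert_space"
  assumes C: "C \<in> bops" and le: "\<And>x. norm (C x) \<le> norm x"
  shows "\<exists>D :: 'a \<Rightarrow> (nat, 'a \<times> 'b) ell2. D \<in> bops \<and> (\<forall>x. (norm (D x))\<^sup>2 = (norm x)\<^sup>2 - (norm (C x))\<^sup>2)"
proof -
  define T where "T = (\<lambda>x. ad C (C x))"
  have T: "T \<in> bops" unfolding T_def by (rule bop_comp[OF ad_bop[OF C] C])
  have T_le: "norm (T x) \<le> norm (C x)" for x
    using norm_ad_le[OF C, of 1] le by (simp add: T_def)
  have Tpow: "(T ^^ j) \<in> bops" for j
    by (induction j) (simp_all only: funpow.simps bop_id bop_o[OF T])
  \<comment> \<open>For odd \<open>k\<close> the missing square root of \<open>T\<close> is replaced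
    by \<open>C\<close>, which has the same norms; the two parities occupy different summands of the
    pair.\<close>
  define u :: "nat \<Rightarrow> 'a \<Rightarrow> 'a \<times> 'b" where
    "u k x = (if even k then ((T ^^ (k div 2)) x, 0) else (0, C ((T ^^ (k div 2)) x)))" for k x
  define s where "s k x = (norm (u k x))\<^sup>2" for k x
  have s_even: "s (2 * j) x = (norm ((T ^^ j) x))\<^sup>2" for j x by (simp add: s_def u_def norm_Pair)
  have s_odd: "s (Suc (2 * j)) x = (norm (C ((T ^^ j) x)))\<^sup>2" for j x by (simp add: s_def u_def norm_Pair)
  have Tj: "(T ^^ Suc j) x = T ((T ^^ j) x)" for j x by simp
  have s_dec: "s (Suc k) x \<le> s k x" for k x
  proof (cases "even k")
    case True
    then obtain j where k: "k = 2 * j" by (elim evenE)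
    show ?thesis unfolding k s_even s_odd by (intro power_mono le) simp
  next
    case False
    then obtain j where k: "k = Suc (2 * j)" by (elim oddE) simp
    have "Suc k = 2 * Suc j" by (simp add: k)
    then show ?thesis unfolding k s_odd by (simp only: s_even Tj) (intro power_mono T_le norm_ge_zero)
  qed
  have nsq: "(norm (a - b))\<^sup>2 = (norm a)\<^sup>2 - 2 * inner a b + (norm b)\<^sup>2" for a b :: "'c::real_inner"
    unfolding power2_norm_eq_inner by (simp add: algebra_simps inner_commute)
  have in1: "inner x (T y) = inner (C x) (C y)" for x y
    unfolding T_def Re_cinner[symmetric] by (simp add: cinner_ad[OF C])
  \<comment> \<open>\<open>s k x\<close> is the quadratic form of the \<open>k\<close>-th power of
    \<open>T\<close> at \<open>x\<close>. Replacing \<open>x\<close> by \<open>x - T x\<close>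
    inserts the square of \<open>1 - T\<close>, that is, a second difference in
    \<open>k\<close>.\<close>
  have s_diff: "s k (x - T x) = s k x - 2 * s (Suc k) x + s (Suc (Suc k)) x" for k x
  proof (cases "even k")
    case True
    then obtain j where k: "k = 2 * j" by (elim evenE)
    let ?y = "(T ^^ j) x"
    have SS: "Suc (Suc k) = 2 * Suc j" by (simp add: k)
    have "(T ^^ j) (x - T x) = ?y - T ?y"
      by (simp add: bop_linear[OF Tpow] funpow_swap1)
    then have "s k (x - T x) = (norm ?y)\<^sup>2 - 2 * inner ?y (T ?y) + (norm (T ?y))\<^sup>2"
      by (simp only: k s_even nsq)
    moreover have "inner ?y (T ?y) = s (Suc k) x"
      by (simp only: in1 k s_odd power2_norm_eq_inner)
    moreover have "(norm (T ?y))\<^sup>2 = s (Suc (Suc k)) x" by (simp only: SS s_even Tj)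
    ultimately show ?thesis by (simp add: k s_even)
  next
    case False
    then obtain j where k: "k = Suc (2 * j)" by (elim oddE) simp
    let ?y = "(T ^^ j) x"
    have S: "Suc k = 2 * Suc j" by (simp add: k)
    have SS: "Suc (Suc k) = Suc (2 * Suc j)" by (simp add: k)
    have "(T ^^ j) (x - T x) = ?y - T ?y"
      by (simp add: bop_linear[OF Tpow] funpow_swap1)
    then have "s k (x - T x) = (norm (C ?y))\<^sup>2 - 2 * inner (C ?y) (C (T ?y)) + (norm (C (T ?y)))\<^sup>2"
      by (simp only: k s_odd nsq bop_linear[OF C])
    moreover have "inner (C ?y) (C (T ?y)) = s (Suc k) x"
      using in1[of "T ?y" ?y]
      by (simp only: inner_commute[of "C ?y"] S s_even Tj power2_norm_eq_inner)
    moreover have "(norm (C (T ?y)))\<^sup>2 = s (Suc (Suc k)) x" by (simp only: SS s_odd Tj)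
    ultimately show ?thesis by (simp add: k s_odd)
  qed
  have partial: "(\<Sum>k<N. s k (x - T x)) = (s 0 x - s 1 x) - (s N x - s (Suc N) x)" for N x
    by (induction N) (simp_all add: s_diff)
  have s_nonneg: "s k x \<ge> 0" for k x by (simp add: s_def)
  \<comment> \<open>The limit \<open>L\<close> of \<open>s k x\<close> may be nonzero, for example
    on fixed vectors of \<open>T\<close>; only the difference of neighbouring terms enters, and it
    tends to 0.\<close>
  have sums: "(\<lambda>k. s k (x - T x)) sums ((norm x)\<^sup>2 - (norm (C x))\<^sup>2)" for x
  proof -
    have dec: "decseq (\<lambda>k. s k x)" by (rule decseq_SucI) (rule s_dec)
    have "\<exists>L. (\<lambda>k. s k x) \<longlonglongrightarrow> L"
      by (rule decseq_convergent[OF dec, of 0]) (auto simp: s_nonneg)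
    then obtain L where L: "(\<lambda>k. s k x) \<longlonglongrightarrow> L" ..
    have "(\<lambda>N. (s 0 x - s 1 x) - (s N x - s (Suc N) x)) \<longlonglongrightarrow> (s 0 x - s 1 x) - (L - L)"
      by (intro tendsto_diff tendsto_const L LIMSEQ_Suc)
    then show ?thesis
      unfolding sums_def partial using s_even[of 0 x] s_odd[of 0 x] by simp
  qed
  have hs: "((\<lambda>k. (norm (u k (x - T x)))\<^sup>2) has_sum ((norm x)\<^sup>2 - (norm (C x))\<^sup>2)) UNIV" for x
    using sums_nonneg_imp_has_sum[OF sums[of x]] by (simp add: s_def)
  define D where "D x = Abs_ell2 (\<lambda>k. u k (x - T x))" for x
  have nth: "ell2_nth (D x) k = u k (x - T x)" for x k
    unfolding D_def using has_sum_imp_summable[OF hs] by (simp add: ell2_nth_Abs)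
  have nD: "(norm (D x))\<^sup>2 = (norm x)\<^sup>2 - (norm (C x))\<^sup>2" for x
    using has_sum_unique[OF ell2_norm_has_sum[of "D x"]] hs[of x] by (simp add: nth)
  have u_add: "u k (x + y) = u k x + u k y" for k x y
    by (simp add: u_def bop_linear[OF Tpow] bop_linear[OF C])
  have u_sc: "u k (c *\<^sub>C x) = c *\<^sub>C u k x" for k x c
    by (simp add: u_def bop_scaleC[OF Tpow] bop_scaleC[OF C] scaleC_prod_def)
  have "D \<in> bops"
  proof (rule bopI[of _ 1])
    show "D (x + y) = D x + D y" for x y
    proof -
      have "x + y - T (x + y) = (x - T x) + (y - T y)" by (simp add: bop_linear[OF T])
      then show ?thesis by (intro ell2_eqI) (simp only: nth ell2_nth_simps u_add)
    qed
    show "D (c *\<^sub>C x) = c *\<^sub>C D x" for c x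
    proof -
      have "c *\<^sub>C x - T (c *\<^sub>C x) = c *\<^sub>C (x - T x)" by (simp add: bop_scaleC[OF T] scaleC_diff_right)
      then show ?thesis by (intro ell2_eqI) (simp only: nth ell2_nth_simps u_sc)
    qed
    show "norm (D x) \<le> 1 * norm x" for x
      using nD[of x] by (simp add: power2_le_imp_le)
  qed
  then show ?thesis using nD by blast
qed

section \<open>Weighted shifts on the Fock space\<close>

definition shift_weights :: "'n nc_series \<Rightarrow> bool"
  where "shift_weights b \<longleftrightarrow> (\<forall>\<alpha>. b \<alpha> > 0) \<and> b [] = 1
    \<and> (\<forall>i. bdd_above (range (\<lambda>\<alpha>. b \<alpha> / b (i # \<alpha>))))"

lemma admissible_shift_weights: "admissible b \<Longrightarrow> shift_weights b"
  by (simp add: admissible_def shift_weights_def)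

text \<open>This is the adjoint of \<open>W_\<alpha> (x) I\<close>: the weights met along
  \<open>\<alpha>\<close> telescope to one quotient. The forward operator \<open>fshift\<close> is
  defined as its adjoint, so that its boundedness and algebra come for free.\<close>

definition bshift :: "'n nc_series \<Rightarrow> 'n list \<Rightarrow> ('n, 'e::chilbert_space) fock \<Rightarrow> ('n, 'e) fock"
  where "bshift b \<alpha> = pullback (\<lambda>\<beta>. \<alpha> @ \<beta>) (\<lambda>\<beta>. sqrt (b \<beta> / b (\<alpha> @ \<beta>))) id"

definition fshift :: "'n nc_series \<Rightarrow> 'n list \<Rightarrow> ('n, 'e::chilbert_space) fock \<Rightarrow> ('n, 'e) fock"
  where "fshift b \<alpha> = ad (bshift b \<alpha>)"

context
  fixes b :: "'n nc_series"
  assumes b: "shift_weights b"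
begin

lemma weights_pos: "b \<alpha> > 0" and weights_Nil: "b [] = 1"
  using b by (auto simp: shift_weights_def)

lemma weights_ratio_bound: "\<exists>C\<ge>0. \<forall>\<beta>. b \<beta> / b (\<alpha> @ \<beta>) \<le> C"
proof (induction \<alpha>)
  case Nil
  show ?case using weights_pos by (intro exI[of _ 1]) (simp add: less_imp_neq[symmetric])
next
  case (Cons i \<alpha>)
  then obtain C where C: "C \<ge> 0" "\<And>\<beta>. b \<beta> / b (\<alpha> @ \<beta>) \<le> C" by blast
  have "bdd_above (range (\<lambda>\<alpha>. b \<alpha> / b (i # \<alpha>)))" using b by (simp add: shift_weights_def)
  then obtain D where D': "\<forall>\<beta>. b \<beta> / b (i # \<beta>) \<le> D" unfolding bdd_above_def by blast
  then have D: "b \<beta> / b (i # \<beta>) \<le> D" for \<beta> by blast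
  have "0 \<le> b [] / b [i]" using weights_pos by (intro divide_nonneg_nonneg less_imp_le)
  then have D0: "D \<ge> 0" using D order_trans by blast
  have "b \<beta> / b ((i # \<alpha>) @ \<beta>) \<le> C * D" for \<beta>
  proof -
    have "b \<beta> / b ((i # \<alpha>) @ \<beta>) = (b \<beta> / b (\<alpha> @ \<beta>)) * (b (\<alpha> @ \<beta>) / b (i # \<alpha> @ \<beta>))"
      using weights_pos[of "\<alpha> @ \<beta>"] by simp
    also have "\<dots> \<le> C * D"
      using weights_pos by (intro mult_mono C D) (simp add: less_imp_le)
    finally show ?thesis .
  qed
  then show ?case using C(1) D0 by (intro exI[of _ "C * D"]) simp
qed

lemma
  fixes h :: "('n, 'e::chilbert_space) fock"
  shows bshift_nth: "ell2_nth (bshift b \<alpha> h) \<beta> = sqrt (b \<beta> / b (\<alpha> @ \<beta>)) *\<^sub>R ell2_nth h (\<alpha> @ \<beta>)"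
    and bshift_bop: "(bshift b \<alpha> :: ('n, 'e) fock \<Rightarrow> _) \<in> bops"
proof -
  obtain C where C: "C \<ge> 0" "\<And>\<beta>. b \<beta> / b (\<alpha> @ \<beta>) \<le> C" using weights_ratio_bound by blast
  have w: "\<bar>sqrt (b \<beta> / b (\<alpha> @ \<beta>))\<bar> \<le> sqrt C" for \<beta>
    using C(2)[of \<beta>] weights_pos by (simp add: less_imp_le)
  have inj: "inj (\<lambda>\<beta>. \<alpha> @ \<beta>)" by (simp add: inj_def)
  note P = pullback[OF inj w bop_id(1), where K = 1, simplified]
  show "ell2_nth (bshift b \<alpha> h) \<beta> = sqrt (b \<beta> / b (\<alpha> @ \<beta>)) *\<^sub>R ell2_nth h (\<alpha> @ \<beta>)"
    unfolding bshift_def by (subst P(1)) simp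
  show "(bshift b \<alpha> :: ('n, 'e) fock \<Rightarrow> _) \<in> bops"
    unfolding bshift_def by (rule P(3))
qed

text \<open>The factors come in reversed order, as for adjoints of a product: the front part
  \<open>\<alpha>\<close> is stripped first.\<close>

lemma bshift_append: "bshift b (\<alpha> @ \<beta>) h = bshift b \<beta> (bshift b \<alpha> h)"
proof (rule ell2_eqI)
  fix \<gamma>
  have "sqrt (b \<gamma> / b (\<alpha> @ \<beta> @ \<gamma>))
      = sqrt (b \<gamma> / b (\<beta> @ \<gamma>)) * sqrt (b (\<beta> @ \<gamma>) / b (\<alpha> @ \<beta> @ \<gamma>))"
    using weights_pos[of "\<beta> @ \<gamma>"] by (simp flip: real_sqrt_mult)
  then show "ell2_nth (bshift b (\<alpha> @ \<beta>) h) \<gamma> = ell2_nth (bshift b \<beta> (bshift b \<alpha> h)) \<gamma>"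
    by (simp add: bshift_nth)
qed

lemma bshift_Nil: "bshift b [] h = h"
  using weights_pos by (intro ell2_eqI) (simp add: bshift_nth less_imp_neq[symmetric])

lemma bshift_zero: "bshift b \<alpha> 0 = 0"
  by (rule bop_linear(3)[OF bshift_bop])

lemma fshift_bop: "fshift b \<alpha> \<in> bops"
  unfolding fshift_def by (rule ad_bop[OF bshift_bop])

lemma cinner_fshift: "cinner (fshift b \<alpha> h) k = cinner h (bshift b \<alpha> k)"
  unfolding fshift_def by (rule cinner_ad'[OF bshift_bop])

lemma ad_fshift: "ad (fshift b \<alpha>) = bshift b \<alpha>"
  unfolding fshift_def by (rule ad_ad[OF bshift_bop])

lemma fshift_append: "fshift b (\<alpha> @ \<beta>) h = fshift b \<alpha> (fshift b \<beta> h)"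
proof (rule cinner_ext)
  fix k
  have "cinner (fshift b (\<alpha> @ \<beta>) h) k = cinner (fshift b \<alpha> (fshift b \<beta> h)) k"
    by (simp only: cinner_fshift bshift_append)
  then show "cinner k (fshift b (\<alpha> @ \<beta>) h) = cinner k (fshift b \<alpha> (fshift b \<beta> h))"
    by (metis cinner_commute)
qed

lemma fshift_Nil: "fshift b [] h = h"
  by (simp add: fshift_def ad_unique[of "bshift b []" "\<lambda>h. h"] bshift_Nil)

lemma fshift_unit_vec:
  "fshift b \<alpha> (unit_vec \<beta> x) = sqrt (b \<beta> / b (\<alpha> @ \<beta>)) *\<^sub>R unit_vec (\<alpha> @ \<beta>) x"
proof (rule cinner_ext)
  fix k
  have "cinner (fshift b \<alpha> (unit_vec \<beta> x)) k = cinner (sqrt (b \<beta> / b (\<alpha> @ \<beta>)) *\<^sub>R unit_vec (\<alpha> @ \<beta>) x) k"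
    by (simp only: cinner_fshift cinner_unit_vec_left bshift_nth cinner.scaleR_left cinner.scaleR_right)
  then show "cinner k (fshift b \<alpha> (unit_vec \<beta> x))
      = cinner k (sqrt (b \<beta> / b (\<alpha> @ \<beta>)) *\<^sub>R unit_vec (\<alpha> @ \<beta>) x)"
    by (metis cinner_commute)
qed

lemma fshift_nth:
  fixes h :: "('n, 'e::chilbert_space) fock"
  shows "ell2_nth (fshift b [i] h) \<gamma> = (case \<gamma> of [] \<Rightarrow> 0
    | j # \<alpha> \<Rightarrow> if j = i then sqrt (b \<alpha> / b (i # \<alpha>)) *\<^sub>R ell2_nth h \<alpha> else 0)"
  (is "_ = ?r")
proof (rule cinner_ext)
  fix x :: 'e
  have *: "bshift b [i] (unit_vec \<gamma> x) = (case \<gamma> of [] \<Rightarrow> 0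
      | j # \<alpha> \<Rightarrow> if j = i then sqrt (b \<alpha> / b (i # \<alpha>)) *\<^sub>R unit_vec \<alpha> x else 0)"
    by (rule ell2_eqI) (auto simp: bshift_nth unit_vec_nth ell2_nth_simps split: list.splits)
  have "cinner x (ell2_nth (fshift b [i] h) \<gamma>) = cinner (unit_vec \<gamma> x) (fshift b [i] h)"
    by (simp only: cinner_unit_vec_left)
  also have "\<dots> = cinner (bshift b [i] (unit_vec \<gamma> x)) h"
    by (simp only: fshift_def cinner_ad[OF bshift_bop])
  also have "\<dots> = cinner x ?r"
    unfolding * by (auto simp: cinner_unit_vec_left cinner.zero_left cinner.zero_right
        cinner.scaleR_left cinner.scaleR_right split: list.splits)
  finally show "cinner x (ell2_nth (fshift b [i] h) \<gamma>) = cinner x ?r" .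
qed

lemma universal_model_eq: "universal_model b i = fshift b [i]"
proof
  fix \<phi> :: "('n, complex) fock"
  obtain C where C: "C \<ge> 0" "\<And>\<beta>. b \<beta> / b (i # \<beta>) \<le> C" using weights_ratio_bound[of "[i]"] by auto
  have w: "\<bar>sqrt (b \<beta> / b (i # \<beta>))\<bar> \<le> sqrt C" for \<beta>
    using C(2)[of \<beta>] weights_pos by (simp add: less_imp_le)
  have "weight_op b i \<phi> = pullback id (\<lambda>\<beta>. sqrt (b \<beta> / b (i # \<beta>))) id \<phi>"
    by (simp add: weight_op_def pullback_def)
  then have D: "ell2_nth (weight_op b i \<phi>) \<beta> = sqrt (b \<beta> / b (i # \<beta>)) *\<^sub>R ell2_nth \<phi> \<beta>" for \<beta>
    using pullback_nth[OF inj_on_id w bop_id(1), where K = 1] by simp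
  let ?f = "\<lambda>\<beta>. case \<beta> of [] \<Rightarrow> 0 | j # \<alpha> \<Rightarrow> if j = i then ell2_nth (weight_op b i \<phi>) \<alpha> else 0"
  have f: "?f = ell2_nth (fshift b [i] \<phi>)"
    by (rule ext) (simp add: fshift_nth D split: list.splits)
  have "creation i (weight_op b i \<phi>) = fshift b [i] \<phi>"
    unfolding creation_def f by (rule ell2_nth_inverse)
  then show "universal_model b i \<phi> = fshift b [i] \<phi>" by (simp add: universal_model_def)
qed

text \<open>This replaces the definite description by an operator with a known adjoint; the later
  arguments run on \<open>bshift\<close> and return to the ampliation only at the end.\<close>

lemma ampliation_eq: "ampliation b i = fshift b [i]"
  unfolding ampliation_def
proof (rule tensor_op_eqI[OF fshift_bop])
  fix \<phi> :: "('n, complex) fock" and x :: 'a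
  have "(0::complex) *\<^sub>C x = 0" using scaleC_of_real[of 0 x] by simp
  then show "fshift b [i] (tensor_vec \<phi> x) = tensor_vec (universal_model b i \<phi>) (id x)"
    by (intro ell2_eqI)
      (simp add: universal_model_eq fshift_nth tensor_vec_nth scaleR_conv_of_real
        scaleC_of_real[symmetric] scaleC_scaleC split: list.splits)
qed

lemma word_op_fshift: "word_op (\<lambda>i. fshift b [i]) \<alpha> = fshift b \<alpha>"
  by (induction \<alpha>) (auto simp: fshift_Nil simp flip: fshift_append)

end

section \<open>Series in noncommuting indeterminates\<close>

lemma nc_mult_one: "nc_mult nc_one a = a" "nc_mult a nc_one = a"
proof -
  show "nc_mult nc_one a = a"
  proof
    fix \<alpha>
    have "nc_mult nc_one a \<alpha> = (\<Sum>k\<le>length \<alpha>. if k = 0 then a \<alpha> else 0)"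
      unfolding nc_mult_def by (rule sum.cong) (auto simp: nc_one_def)
    then show "nc_mult nc_one a \<alpha> = a \<alpha>" by simp
  qed
  show "nc_mult a nc_one = a"
  proof
    fix \<alpha>
    have "nc_mult a nc_one \<alpha> = (\<Sum>k\<le>length \<alpha>. if k = length \<alpha> then a \<alpha> else 0)"
      unfolding nc_mult_def by (rule sum.cong) (auto simp: nc_one_def)
    then show "nc_mult a nc_one \<alpha> = a \<alpha>" by simp
  qed
qed

lemma nc_mult_assoc:
  fixes a b c :: "'n nc_series"
  shows "nc_mult (nc_mult a b) c = nc_mult a (nc_mult b c)"
proof
  fix \<gamma> :: "'n list"
  let ?n = "length \<gamma>"
  let ?t = "\<lambda>j k. a (take j \<gamma>) * b (drop j (take k \<gamma>)) * c (drop k \<gamma>)"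
  have "nc_mult (nc_mult a b) c \<gamma> = (\<Sum>k\<le>?n. \<Sum>j\<le>k. ?t j k)"
    unfolding nc_mult_def sum_distrib_right
    by (intro sum.cong refl) (auto simp: min_absorb1 min_absorb2)
  also have "\<dots> = (\<Sum>(k, j)\<in>(SIGMA k:{..?n}. {..k}). ?t j k)" by (simp add: sum.Sigma)
  \<comment> \<open>A pair of cuts \<open>j \<le> k\<close> is encoded by the first cut and the
    distance to the second.\<close>
  also have "\<dots> = (\<Sum>(j, i)\<in>(SIGMA j:{..?n}. {..?n - j}). ?t j (i + j))"
    by (rule sum.reindex_bij_witness[of _ "\<lambda>(j, i). (i + j, j)" "\<lambda>(k, j). (j, k - j)"]) auto
  also have "\<dots> = (\<Sum>j\<le>?n. \<Sum>i\<le>?n - j. ?t j (i + j))" by (simp add: sum.Sigma)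
  also have "\<dots> = nc_mult a (nc_mult b c) \<gamma>"
    unfolding nc_mult_def sum_distrib_left
    by (intro sum.cong refl) (simp_all add: drop_take mult.assoc)
  finally show "nc_mult (nc_mult a b) c \<gamma> = nc_mult a (nc_mult b c) \<gamma>" .
qed

text \<open>The last term of the convolution at \<open>\<gamma>\<close> is
  \<open>a \<gamma> * b []\<close>, so the coefficients are found by recursion on the word
  length.\<close>

lemma nc_left_inverse_exists:
  assumes "b [] = 1"
  shows "\<exists>a. nc_mult a b = nc_one"
proof -
  have "\<exists>a. \<forall>\<gamma>. a \<gamma> = nc_one \<gamma> - (\<Sum>k<length \<gamma>. a (take k \<gamma>) * b (drop k \<gamma>))"
  proof -
    define F where "F a \<gamma> = nc_one \<gamma> - (\<Sum>k<length \<gamma>. a (take k \<gamma>) * b (drop k \<gamma>))" for a \<gamma>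
    define a where "a = wfrec (Wellfounded.measure length) F"
    have "a \<gamma> = F a \<gamma>" for \<gamma>
    proof -
      have "a \<gamma> = F (cut a (Wellfounded.measure length) \<gamma>) \<gamma>"
        unfolding a_def by (rule wfrec) simp
      also have "\<dots> = F a \<gamma>"
        unfolding F_def by (intro arg_cong2[where f = minus] sum.cong refl) (auto simp: cut_apply)
      finally show ?thesis .
    qed
    then show ?thesis unfolding F_def by blast
  qed
  then obtain a where a: "\<And>\<gamma>. a \<gamma> = nc_one \<gamma> - (\<Sum>k<length \<gamma>. a (take k \<gamma>) * b (drop k \<gamma>))" by auto
  have "nc_mult a b \<gamma> = nc_one \<gamma>" for \<gamma>
  proof -
    have "nc_mult a b \<gamma> = (\<Sum>k<length \<gamma>. a (take k \<gamma>) * b (drop k \<gamma>)) + a \<gamma>"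
      unfolding nc_mult_def by (simp add: lessThan_Suc_atMost[symmetric] assms)
    then show ?thesis using a[of \<gamma>] by linarith
  qed
  then show ?thesis by blast
qed

text \<open>Reversal of words is an anti-automorphism, so the existence of left inverses gives right
  inverses too.\<close>

lemma nc_rev: "nc_mult (\<lambda>\<gamma>. a (rev \<gamma>)) (\<lambda>\<gamma>. b (rev \<gamma>)) \<gamma> = nc_mult b a (rev \<gamma>)"
proof -
  have "nc_mult b a (rev \<gamma>) = (\<Sum>k\<le>length \<gamma>. b (rev (drop (length \<gamma> - k) \<gamma>)) * a (rev (take (length \<gamma> - k) \<gamma>)))"
    unfolding nc_mult_def by (intro sum.cong) (auto simp: take_rev drop_rev)
  also have "\<dots> = (\<Sum>k\<le>length \<gamma>. b (rev (drop k \<gamma>)) * a (rev (take k \<gamma>)))"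
    by (rule sum.reindex_bij_witness[of _ "\<lambda>k. length \<gamma> - k" "\<lambda>k. length \<gamma> - k"]) auto
  finally show ?thesis unfolding nc_mult_def by (simp add: mult.commute)
qed

lemma nc_inverse:
  assumes "b [] = 1"
  shows "nc_mult (nc_inverse b) b = nc_one" "nc_mult b (nc_inverse b) = nc_one"
proof -
  obtain a where a: "nc_mult a b = nc_one" using nc_left_inverse_exists[of b] assms by blast
  obtain r where r: "nc_mult r (\<lambda>\<gamma>. b (rev \<gamma>)) = nc_one"
    using nc_left_inverse_exists[of "\<lambda>\<gamma>. b (rev \<gamma>)"] assms by auto
  define a' where "a' \<gamma> = r (rev \<gamma>)" for \<gamma>
  have a': "nc_mult b a' = nc_one"
  proof
    fix \<gamma>
    show "nc_mult b a' \<gamma> = nc_one \<gamma>"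
      using nc_rev[of a' b "rev \<gamma>"] fun_cong[OF r, of "rev \<gamma>"] by (simp add: a'_def nc_one_def)
  qed
  \<comment> \<open>By associativity every left inverse equals every right inverse, which yields
    existence and uniqueness of the two-sided one.\<close>
  have eq: "x = y" if "nc_mult x b = nc_one" "nc_mult b y = nc_one" for x y
    using nc_mult_assoc[of x b y] that by (simp add: nc_mult_one)
  have "nc_mult a b = nc_one \<and> nc_mult b a = nc_one" using a a' eq by blast
  moreover have "x = a" if "nc_mult x b = nc_one \<and> nc_mult b x = nc_one" for x
    using eq[of x a'] eq[of a a'] that a a' by simp
  ultimately have "\<exists>!a. nc_mult a b = nc_one \<and> nc_mult b a = nc_one" by (rule ex1I)
  from theI'[OF this] have "nc_mult (nc_inverse b) b = nc_one \<and> nc_mult b (nc_inverse b) = nc_one"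
    unfolding nc_inverse_def .
  then show "nc_mult (nc_inverse b) b = nc_one" "nc_mult b (nc_inverse b) = nc_one" by auto
qed

text \<open>Pairs of words correspond to a word with a cut. Grouping a nonnegative double sum by the
  concatenated word makes the convolution \<open>nc_mult\<close> appear, which is how identities of
  series become identities of norms.\<close>

lemma has_sum_concat:
  fixes F :: "'n list \<Rightarrow> 'n list \<Rightarrow> real"
  assumes F: "\<And>\<alpha> \<beta>. 0 \<le> F \<alpha> \<beta>"
    and sum: "((\<lambda>\<gamma>. \<Sum>k\<le>length \<gamma>. F (take k \<gamma>) (drop k \<gamma>)) has_sum s) UNIV"
  shows "((\<lambda>(\<alpha>, \<beta>). F \<alpha> \<beta>) has_sum s) UNIV" and "(\<lambda>\<beta>. F \<alpha> \<beta>) summable_on UNIV"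
    and "((\<lambda>\<alpha>. \<Sum>\<^sub>\<infinity>\<beta>. F \<alpha> \<beta>) has_sum s) UNIV"
proof -
  let ?S = "SIGMA \<gamma>:(UNIV :: 'n list set). {..length \<gamma>}"
  let ?G = "\<lambda>\<gamma>. \<Sum>k\<le>length \<gamma>. F (take k \<gamma>) (drop k \<gamma>)"
  have fin: "((\<lambda>k. case (\<gamma>, k) of (\<gamma>, k) \<Rightarrow> F (take k \<gamma>) (drop k \<gamma>)) has_sum ?G \<gamma>) {..length \<gamma>}" for \<gamma>
    by (simp add: has_sum_finite)
  have "((\<lambda>(\<gamma>, k). F (take k \<gamma>) (drop k \<gamma>)) has_sum s) ?S"
    by (rule has_sum_SigmaI[OF fin sum]) (auto intro: summable_on_SigmaI[OF fin has_sum_imp_summable[OF sum]] F)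
  moreover have "((\<lambda>(\<gamma>, k). F (take k \<gamma>) (drop k \<gamma>)) has_sum s) ?S
      \<longleftrightarrow> ((\<lambda>(\<alpha>, \<beta>). F \<alpha> \<beta>) has_sum s) UNIV"
    by (rule has_sum_reindex_bij_witness[of _ "\<lambda>(\<alpha>, \<beta>). (\<alpha> @ \<beta>, length \<alpha>)"
          "\<lambda>(\<gamma>, k). (take k \<gamma>, drop k \<gamma>)"]) auto
  ultimately show 1: "((\<lambda>(\<alpha>, \<beta>). F \<alpha> \<beta>) has_sum s) UNIV" by simp
  then have 2: "((\<lambda>(\<alpha>, \<beta>). F \<alpha> \<beta>) has_sum s) (UNIV \<times> UNIV)" by simp
  then have s: "(\<lambda>(\<alpha>, \<beta>). F \<alpha> \<beta>) summable_on UNIV \<times> UNIV" by (rule has_sum_imp_summable)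
  show sm: "(\<lambda>\<beta>. F \<alpha> \<beta>) summable_on UNIV" for \<alpha>
    using summable_on_SigmaD1[OF s] by simp
  show "((\<lambda>\<alpha>. \<Sum>\<^sub>\<infinity>\<beta>. F \<alpha> \<beta>) has_sum s) UNIV"
    by (rule has_sum_SigmaD[OF 2]) (simp add: has_sum_infsum[OF sm])
qed

section \<open>Commutant lifting for regular weights\<close>

lemma bop_Pair: "S \<in> bops \<Longrightarrow> T \<in> bops \<Longrightarrow> (\<lambda>x. (S x, T x)) \<in> bops"
proof -
  assume S: "S \<in> bops" and T: "T \<in> bops"
  obtain K where K: "\<forall>x. norm (S x, T x) \<le> norm x * K"
    using bounded_linear.bounded[OF bounded_linear_Pair[OF bop_bounded_linear[OF S] bop_bounded_linear[OF T]]]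
    by blast
  show ?thesis
    using K by (intro bopI[of _ K])
      (simp_all add: bop_linear[OF S] bop_linear[OF T] bop_scaleC[OF S] bop_scaleC[OF T] scaleC_prod_def
        mult.commute[of K])
qed

lemma norm_Pair_sq: "(norm (a, b))\<^sup>2 = (norm a)\<^sup>2 + (norm b)\<^sup>2"
  by (simp add: norm_Pair)

lemma norm_snd: "norm (snd z) \<le> norm z"
  by (metis norm_snd_le prod.collapse)

lemma bop_fst: "fst \<in> bops" and bop_snd: "snd \<in> bops"
  by (auto intro!: bopI[of _ 1] simp: scaleC_prod_def norm_fst_le norm_snd_le)

lemma has_sum_diff_real:
  fixes f g :: "'a \<Rightarrow> real"
  assumes "(f has_sum s) A" "(g has_sum t) A"
  shows "((\<lambda>x. f x - g x) has_sum s - t) A"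
proof -
  from has_sum_add[OF assms(1) has_sum_uminusI[OF assms(2)]] show ?thesis by simp
qed

lemma norm_le_sqrtI: "(norm a)\<^sup>2 \<le> (norm b)\<^sup>2 \<Longrightarrow> norm a \<le> norm b"
  by (rule power2_le_imp_le) simp_all

context
  fixes b c :: "'n::finite nc_series"
  assumes b: "shift_weights b" and c_nonneg: "\<And>\<alpha>. c \<alpha> \<ge> 0" and c_Nil: "c [] = 0"
    and c_rec: "\<And>\<gamma>. \<gamma> \<noteq> [] \<Longrightarrow> nc_mult c b \<gamma> = b \<gamma>"
begin

text \<open>The hypotheses say (1 - c) b = 1. Grouping by the concatenated word,
  \<open>\<gamma>\<close> receives the total weight
  \<open>nc_mult c b \<gamma> / b \<gamma>\<close>, which is 1 except at the empty word, where it is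
  0.\<close>

lemma bshift_norm_has_sum:
  "((\<lambda>\<alpha>. c \<alpha> * (norm (bshift b \<alpha> h))\<^sup>2) has_sum (norm h)\<^sup>2 - (norm (ell2_nth h []))\<^sup>2) UNIV"
proof -
  define F where "F \<alpha> \<beta> = c \<alpha> * (b \<beta> / b (\<alpha> @ \<beta>) * (norm (ell2_nth h (\<alpha> @ \<beta>)))\<^sup>2)" for \<alpha> \<beta>
  have F_nonneg: "0 \<le> F \<alpha> \<beta>" for \<alpha> \<beta>
    using weights_pos[OF b] c_nonneg by (simp add: F_def less_imp_le)
  let ?r = "restr (- {[]}) h"
  have "(\<Sum>k\<le>length \<gamma>. F (take k \<gamma>) (drop k \<gamma>)) = (norm (ell2_nth ?r \<gamma>))\<^sup>2" for \<gamma>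
  proof -
    have "(\<Sum>k\<le>length \<gamma>. F (take k \<gamma>) (drop k \<gamma>)) = nc_mult c b \<gamma> / b \<gamma> * (norm (ell2_nth h \<gamma>))\<^sup>2"
      by (simp add: F_def nc_mult_def sum_divide_distrib sum_distrib_right mult.assoc)
    then show ?thesis
      using weights_pos[OF b, of \<gamma>] c_rec[of \<gamma>]
      by (cases "\<gamma> = []") (simp_all add: restr_nth nc_mult_def[of _ _ "[]"] c_Nil)
  qed
  then have sum: "((\<lambda>\<gamma>. \<Sum>k\<le>length \<gamma>. F (take k \<gamma>) (drop k \<gamma>)) has_sum (norm ?r)\<^sup>2) UNIV"
    using ell2_norm_has_sum[of ?r] by simp
  have "(norm ?r)\<^sup>2 = (norm h)\<^sup>2 - (norm (ell2_nth h []))\<^sup>2"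
    using norm_restr_Compl[of "{[]}" h] by (simp add: norm_restr_finite)
  moreover have "(\<Sum>\<^sub>\<infinity>\<beta>. F \<alpha> \<beta>) = c \<alpha> * (norm (bshift b \<alpha> h))\<^sup>2" for \<alpha>
  proof -
    have "(\<Sum>\<^sub>\<infinity>\<beta>. F \<alpha> \<beta>) = c \<alpha> * (\<Sum>\<^sub>\<infinity>\<beta>. b \<beta> / b (\<alpha> @ \<beta>) * (norm (ell2_nth h (\<alpha> @ \<beta>)))\<^sup>2)"
      unfolding F_def by (rule infsum_cmult_right')
    also have "(\<Sum>\<^sub>\<infinity>\<beta>. b \<beta> / b (\<alpha> @ \<beta>) * (norm (ell2_nth h (\<alpha> @ \<beta>)))\<^sup>2) = (norm (bshift b \<alpha> h))\<^sup>2"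
      unfolding ell2_norm_sq
      using weights_pos[OF b] by (intro infsum_cong) (simp add: bshift_nth[OF b] power_mult_distrib less_imp_le)
    finally show ?thesis .
  qed
  ultimately show ?thesis using has_sum_concat(3)[OF F_nonneg sum] by simp
qed

lemma bshift_norm_sum_le:
  assumes "finite A"
  shows "(\<Sum>\<alpha>\<in>A. c \<alpha> * (norm (bshift b \<alpha> h))\<^sup>2) \<le> (norm h)\<^sup>2"
proof -
  have "(\<Sum>\<alpha>\<in>A. c \<alpha> * (norm (bshift b \<alpha> h))\<^sup>2) \<le> (norm h)\<^sup>2 - (norm (ell2_nth h []))\<^sup>2"
    by (rule finite_sum_le_has_sum[OF bshift_norm_has_sum assms]) (auto simp: c_nonneg)
  then show ?thesis by (smt (verit) zero_le_power2)
qed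

text \<open>With the identity for \<open>G\<close>, this together with the coordinate at the empty
  word is the isometry belonging to the recursion b = 1 + c b; in general \<open>G\<close> acts
  afterwards in each coordinate.\<close>

definition row_op :: "(('n, 'u::chilbert_space) fock \<Rightarrow> 'd::chilbert_space) \<Rightarrow> ('n, 'u) fock \<Rightarrow> ('n list, 'd) ell2"
  where "row_op G h = Abs_ell2 (\<lambda>\<alpha>. sqrt (c \<alpha>) *\<^sub>R G (bshift b \<alpha> h))"

context
  fixes G :: "('n, 'u::chilbert_space) fock \<Rightarrow> 'd::chilbert_space"
  assumes G: "G \<in> bops" and G_le: "\<And>h. norm (G h) \<le> norm h"
begin

lemma row_finite_sum_le:
  assumes "finite A"
  shows "(\<Sum>\<alpha>\<in>A. (norm (sqrt (c \<alpha>) *\<^sub>R G (bshift b \<alpha> h)))\<^sup>2) \<le> (norm h)\<^sup>2"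
proof -
  have "(\<Sum>\<alpha>\<in>A. (norm (sqrt (c \<alpha>) *\<^sub>R G (bshift b \<alpha> h)))\<^sup>2) \<le> (\<Sum>\<alpha>\<in>A. c \<alpha> * (norm (bshift b \<alpha> h))\<^sup>2)"
    by (intro sum_mono) (simp add: power_mult_distrib c_nonneg mult_left_mono power_mono G_le)
  then show ?thesis using bshift_norm_sum_le[OF assms, of h] by linarith
qed

lemma row_op_nth: "ell2_nth (row_op G h) \<alpha> = sqrt (c \<alpha>) *\<^sub>R G (bshift b \<alpha> h)"
  unfolding row_op_def by (simp add: ell2_boundedI(2)[OF row_finite_sum_le])

lemma row_op_bop: "row_op G \<in> bops"
proof (rule bopI[of _ 1])
  show "norm (row_op G h) \<le> 1 * norm h" for h
    using ell2_boundedI(3)[OF row_finite_sum_le, of h] by (simp add: row_op_def norm_le_sqrtI)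
qed (auto intro!: ell2_eqI simp: row_op_nth ell2_nth_simps bop_linear[OF bshift_bop[OF b]] bop_linear[OF G]
    bop_scaleC[OF bshift_bop[OF b]] bop_scaleC[OF G] scaleR_add_right scaleR_scaleC)

lemma row_norm_has_sum: "((\<lambda>\<alpha>. c \<alpha> * (norm (G (bshift b \<alpha> h)))\<^sup>2) has_sum (norm (row_op G h))\<^sup>2) UNIV"
  using ell2_norm_has_sum[of "row_op G h"] by (simp add: row_op_nth power_mult_distrib c_nonneg)

lemma row_norm_le: "(norm (row_op G h))\<^sup>2 \<le> (norm h)\<^sup>2 - (norm (ell2_nth h []))\<^sup>2"
  by (rule has_sum_mono[OF row_norm_has_sum bshift_norm_has_sum])
    (simp add: c_nonneg mult_left_mono power_mono G_le)

end

text \<open>The source of convergence. Since \<open>c []\<close> is 0, only nonempty words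
  contribute, and a shift by such a word moves coordinates of length at least \<open>k\<close> from
  ones of length at least \<open>Suc k\<close>. The factor 2 passes through unchanged.\<close>

lemma row_diff_le:
  fixes G G' :: "('n, 'u::chilbert_space) fock \<Rightarrow> 'd::chilbert_space"
  assumes G: "G \<in> bops" "\<And>h. norm (G h) \<le> norm h" and G': "G' \<in> bops" "\<And>h. norm (G' h) \<le> norm h"
    and le: "\<And>\<alpha>. norm (G (bshift b \<alpha> h) - G' (bshift b \<alpha> h))
        \<le> 2 * norm (restr {\<gamma>. length \<gamma> \<ge> k} (bshift b \<alpha> h))"
  shows "norm (row_op G h - row_op G' h) \<le> 2 * norm (restr {\<gamma>. length \<gamma> \<ge> Suc k} h)"
proof -
  let ?r = "restr {\<gamma>. length \<gamma> \<ge> Suc k} h"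
  have "(norm (ell2_nth (row_op G h - row_op G' h) \<alpha>))\<^sup>2 \<le> c \<alpha> * (norm (bshift b \<alpha> ?r))\<^sup>2 * 4" for \<alpha>
  proof (cases "\<alpha> = []")
    case True
    then show ?thesis by (simp add: ell2_nth_simps row_op_nth[OF G] row_op_nth[OF G'] c_Nil)
  next
    case False
    then have "restr {\<gamma>. length \<gamma> \<ge> k} (bshift b \<alpha> h) = restr {\<gamma>. length \<gamma> \<ge> k} (bshift b \<alpha> ?r)"
      by (cases \<alpha>) (auto intro!: ell2_eqI simp: restr_nth bshift_nth[OF b])
    then have "norm (restr {\<gamma>. length \<gamma> \<ge> k} (bshift b \<alpha> h)) \<le> norm (bshift b \<alpha> ?r)"
      by (simp add: norm_restr_le)
    then have "norm (G (bshift b \<alpha> h) - G' (bshift b \<alpha> h)) \<le> 2 * norm (bshift b \<alpha> ?r)"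
      using le[of \<alpha>] by linarith
    from power_mono[OF this norm_ge_zero, of 2]
    have "(norm (G (bshift b \<alpha> h) - G' (bshift b \<alpha> h)))\<^sup>2 \<le> 4 * (norm (bshift b \<alpha> ?r))\<^sup>2"
      by (simp add: power_mult_distrib)
    from mult_left_mono[OF this c_nonneg[of \<alpha>]] show ?thesis
      by (simp add: ell2_nth_simps row_op_nth[OF G] row_op_nth[OF G'] scaleR_diff_right[symmetric]
          power_mult_distrib c_nonneg mult_ac)
  qed
  then have "(norm (row_op G h - row_op G' h))\<^sup>2 \<le> ((norm ?r)\<^sup>2 - (norm (ell2_nth ?r []))\<^sup>2) * 4"
    by (intro has_sum_mono[OF ell2_norm_has_sum has_sum_cmult_left[OF bshift_norm_has_sum]]) simp
  also have "\<dots> \<le> (2 * norm ?r)\<^sup>2" by (simp add: power_mult_distrib)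
  finally show ?thesis by (rule power2_le_imp_le) simp
qed

text \<open>The left side will be a partial sum of the squared norm of the lifting. Splitting off a
  nonempty first part of each word by b = 1 + c b reduces it to shorter words at the shifted
  vectors; \<open>le\<close> then trades the defect terms of the shifted vectors for that of
  \<open>h\<close>.\<close>

lemma row_contraction_sum_le:
  fixes a :: "('n, 'u::chilbert_space) fock \<Rightarrow> 'e::chilbert_space"
    and D :: "('n, 'u) fock \<Rightarrow> 'd::chilbert_space"
  assumes D: "D \<in> bops" "\<And>h. norm (D h) \<le> norm h"
    and le: "\<And>h. (norm (a h))\<^sup>2 + (norm (D h))\<^sup>2 \<le> (norm (ell2_nth h []))\<^sup>2 + (norm (row_op D h))\<^sup>2"
  shows "(\<Sum>\<gamma> | length \<gamma> < N. b \<gamma> * (norm (a (bshift b \<gamma> h)))\<^sup>2) \<le> (norm h)\<^sup>2 - (norm (D h))\<^sup>2"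
proof (induction N arbitrary: h)
  case 0
  show ?case using D(2)[of h] by (simp add: power_mono)
next
  case (Suc N)
  define \<omega> where "\<omega> h = (norm (a h))\<^sup>2" for h
  define f where "f \<alpha> \<beta> = c \<alpha> * (b \<beta> * \<omega> (bshift b \<beta> (bshift b \<alpha> h)))" for \<alpha> \<beta>
  define W where "W = {\<gamma> :: 'n list. length \<gamma> < Suc N}"
  have W: "finite W" "[] \<in> W" by (simp_all add: W_def finite_words)
  have f_nonneg: "0 \<le> f \<alpha> \<beta>" for \<alpha> \<beta>
    using weights_pos[OF b] c_nonneg by (simp add: f_def \<omega>_def less_imp_le)
  have inj: "inj_on (\<lambda>(\<gamma>, k). (take k \<gamma>, drop k \<gamma>)) (SIGMA \<gamma>:W - {[]}. {1..length \<gamma>})"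
    by (rule inj_on_inverseI[of _ "\<lambda>(\<alpha>, \<beta>). (\<alpha> @ \<beta>, length \<alpha>)"]) auto
  have "(\<Sum>\<gamma>\<in>W - {[]}. b \<gamma> * \<omega> (bshift b \<gamma> h)) = (\<Sum>\<gamma>\<in>W - {[]}. \<Sum>k\<in>{1..length \<gamma>}. f (take k \<gamma>) (drop k \<gamma>))"
  proof (rule sum.cong[OF refl])
    fix \<gamma> assume "\<gamma> \<in> W - {[]}"
    then have "b \<gamma> = nc_mult c b \<gamma>" by (simp add: c_rec)
    also have "\<dots> = (\<Sum>k\<in>{1..length \<gamma>}. c (take k \<gamma>) * b (drop k \<gamma>))"
      unfolding nc_mult_def
      by (rule sum.mono_neutral_right) (auto simp: c_Nil not_le Suc_le_eq)
    finally have "b \<gamma> * \<omega> (bshift b \<gamma> h) = (\<Sum>k\<in>{1..length \<gamma>}. c (take k \<gamma>) * b (drop k \<gamma>)) * \<omega> (bshift b \<gamma> h)"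
      by simp
    then show "b \<gamma> * \<omega> (bshift b \<gamma> h) = (\<Sum>k\<in>{1..length \<gamma>}. f (take k \<gamma>) (drop k \<gamma>))"
      unfolding sum_distrib_right f_def by (simp add: bshift_append[OF b, symmetric] mult.assoc)
  qed
  also have "\<dots> = (\<Sum>(\<gamma>, k)\<in>(SIGMA \<gamma>:W - {[]}. {1..length \<gamma>}). f (take k \<gamma>) (drop k \<gamma>))"
    using W by (simp add: sum.Sigma)
  also have "\<dots> = (\<Sum>(\<alpha>, \<beta>)\<in>(\<lambda>(\<gamma>, k). (take k \<gamma>, drop k \<gamma>)) ` (SIGMA \<gamma>:W - {[]}. {1..length \<gamma>}). f \<alpha> \<beta>)"
    by (subst sum.reindex[OF inj]) (simp add: case_prod_unfold)
  \<comment> \<open>The set of splittings is enlarged to a full product. Cuts have a nonempty first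
    part, so the second part is shorter than \<open>N\<close> and the induction hypothesis applies
    to it.\<close>
  also have "\<dots> \<le> (\<Sum>(\<alpha>, \<beta>)\<in>W \<times> {\<beta>. length \<beta> < N}. f \<alpha> \<beta>)"
  proof (rule sum_mono2)
    show "(\<lambda>(\<gamma>, k). (take k \<gamma>, drop k \<gamma>)) ` (SIGMA \<gamma>:W - {[]}. {1..length \<gamma>}) \<subseteq> W \<times> {\<beta>. length \<beta> < N}"
      by (auto simp: W_def)
  qed (auto simp: W finite_words f_nonneg)
  also have "\<dots> = (\<Sum>\<alpha>\<in>W. \<Sum>\<beta> | length \<beta> < N. f \<alpha> \<beta>)"
    by (simp add: sum.cartesian_product)
  also have "\<dots> \<le> (\<Sum>\<alpha>\<in>W. c \<alpha> * (norm (bshift b \<alpha> h))\<^sup>2 - c \<alpha> * (norm (D (bshift b \<alpha> h)))\<^sup>2)"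
  proof (rule sum_mono)
    fix \<alpha>
    show "(\<Sum>\<beta> | length \<beta> < N. f \<alpha> \<beta>) \<le> c \<alpha> * (norm (bshift b \<alpha> h))\<^sup>2 - c \<alpha> * (norm (D (bshift b \<alpha> h)))\<^sup>2"
      using mult_left_mono[OF Suc.IH[of "bshift b \<alpha> h"] c_nonneg[of \<alpha>]]
      by (simp only: f_def \<omega>_def sum_distrib_left[symmetric] right_diff_distrib)
  qed
  also have "\<dots> \<le> ((norm h)\<^sup>2 - (norm (ell2_nth h []))\<^sup>2) - (norm (row_op D h))\<^sup>2"
  proof (rule finite_sum_le_has_sum[OF has_sum_diff_real[OF bshift_norm_has_sum row_norm_has_sum[OF D]] W(1)])
    fix \<alpha>
    show "0 \<le> c \<alpha> * (norm (bshift b \<alpha> h))\<^sup>2 - c \<alpha> * (norm (D (bshift b \<alpha> h)))\<^sup>2"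
      using D(2)[of "bshift b \<alpha> h"] c_nonneg[of \<alpha>] by (simp add: mult_left_mono power_mono)
  qed auto
  finally have "(\<Sum>\<gamma>\<in>W - {[]}. b \<gamma> * \<omega> (bshift b \<gamma> h))
      \<le> ((norm h)\<^sup>2 - (norm (ell2_nth h []))\<^sup>2) - (norm (row_op D h))\<^sup>2" .
  moreover have "(\<Sum>\<gamma>\<in>W. b \<gamma> * \<omega> (bshift b \<gamma> h)) = \<omega> h + (\<Sum>\<gamma>\<in>W - {[]}. b \<gamma> * \<omega> (bshift b \<gamma> h))"
    using sum.remove[OF W, of "\<lambda>\<gamma>. b \<gamma> * \<omega> (bshift b \<gamma> h)"] by (simp add: weights_Nil[OF b] bshift_Nil[OF b])
  ultimately show ?case using le[of h] unfolding W_def \<omega>_def by linarith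
qed

text \<open>The identity \<open>(norm h)\<^sup>2 = (norm (ell2_nth h []))\<^sup>2 + (\<Sum>\<alpha>. c \<alpha> * (norm (bshift b \<alpha> h))\<^sup>2)\<close> makes
  \<open>(h [], row_op D h) \<mapsto> (C h [], D h)\<close> isometric on \<open>M\<close>, where \<open>D\<close> is a defect operator of \<open>C\<close>.  Any
  contractive extension \<open>V\<close> of this map yields a lifting: solve \<open>D' h = snd (V (h [], row_op D' h))\<close> for
  \<open>D'\<close> by iteration and let \<open>fst (V (h [], row_op D' h))\<close> be the value of the lifting at the empty word.\<close>

lemma commutant_lifting_contraction:
  fixes C :: "('n, 'u::chilbert_space) fock \<Rightarrow> ('n, 'e::chilbert_space) fock"
  assumes C: "C \<in> bops" and C_le: "\<And>h. norm (C h) \<le> norm h" and M: "csubspace M"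
    and inv1: "\<And>i h. h \<in> M \<Longrightarrow> bshift b [i] h \<in> M"
    and int1: "\<And>i h. h \<in> M \<Longrightarrow> C (bshift b [i] h) = bshift b [i] (C h)"
  shows "\<exists>A\<in>bops. (\<forall>h. norm (A h) \<le> norm h) \<and> (\<forall>i h. A (bshift b [i] h) = bshift b [i] (A h))
    \<and> (\<forall>h\<in>M. A h = C h)"
proof -
  have inv: "bshift b \<alpha> h \<in> M" if "h \<in> M" for \<alpha> h
    using that
  proof (induction \<alpha> arbitrary: h)
    case (Cons i \<alpha>)
    then show ?case using bshift_append[OF b, of "[i]" \<alpha> h] inv1 by simp
  qed (simp add: bshift_Nil[OF b])
  have int: "C (bshift b \<alpha> h) = bshift b \<alpha> (C h)" if "h \<in> M" for \<alpha> h
    using that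
  proof (induction \<alpha> arbitrary: h)
    case (Cons i \<alpha>)
    then show ?case
      using bshift_append[OF b, of "[i]" \<alpha> h] bshift_append[OF b, of "[i]" \<alpha> "C h"] inv1 int1 by simp
  qed (simp add: bshift_Nil[OF b])
  obtain D :: "('n, 'u) fock \<Rightarrow> (nat, ('n, 'u) fock \<times> ('n, 'e) fock) ell2"
    where D: "D \<in> bops" and D_norm': "\<forall>h. (norm (D h))\<^sup>2 = (norm h)\<^sup>2 - (norm (C h))\<^sup>2"
    using defect_operator[OF C C_le] by blast
  note D_norm = D_norm'[rule_format]
  have D_le: "norm (D h) \<le> norm h" for h
    by (rule norm_le_sqrtI) (simp add: D_norm)
  have nil: "(\<lambda>h. ell2_nth h []) \<in> bops" by (rule ell2_nth_bop)
  have p: "(\<lambda>h. (ell2_nth h [], row_op D h)) \<in> bops"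
    by (rule bop_Pair[OF nil row_op_bop[OF D D_le]])
  have q: "(\<lambda>h. (ell2_nth (C h) [], D h)) \<in> bops"
    by (rule bop_Pair[OF bop_comp[OF nil C] D])
  \<comment> \<open>Subtract the norm identities of \<open>h\<close> and \<open>C h\<close>. As
    \<open>C\<close> commutes with the shifts on \<open>M\<close>, the difference is termwise the
    defect of the shifted vectors; the two norms are in fact equal.\<close>
  have qp: "norm (ell2_nth (C h) [], D h) \<le> norm (ell2_nth h [], row_op D h)" if h: "h \<in> M" for h
  proof -
    have "((\<lambda>\<alpha>. c \<alpha> * (norm (bshift b \<alpha> h))\<^sup>2 - c \<alpha> * (norm (bshift b \<alpha> (C h)))\<^sup>2) has_sum
        ((norm h)\<^sup>2 - (norm (ell2_nth h []))\<^sup>2) - ((norm (C h))\<^sup>2 - (norm (ell2_nth (C h) []))\<^sup>2)) UNIV"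
      by (rule has_sum_diff_real[OF bshift_norm_has_sum bshift_norm_has_sum])
    moreover have "c \<alpha> * (norm (bshift b \<alpha> h))\<^sup>2 - c \<alpha> * (norm (bshift b \<alpha> (C h)))\<^sup>2
        = c \<alpha> * (norm (D (bshift b \<alpha> h)))\<^sup>2" for \<alpha>
      by (simp add: D_norm int[OF h] right_diff_distrib)
    ultimately have "(norm (row_op D h))\<^sup>2
        = ((norm h)\<^sup>2 - (norm (ell2_nth h []))\<^sup>2) - ((norm (C h))\<^sup>2 - (norm (ell2_nth (C h) []))\<^sup>2)"
      using has_sum_unique[OF row_norm_has_sum[OF D D_le, of h]] by simp
    then show ?thesis
      by (intro norm_le_sqrtI) (simp add: norm_Pair_sq D_norm)
  qed
  obtain V where V: "V \<in> bops" and V_le': "\<forall>x. norm (V x) \<le> norm x"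
    and V_eq': "\<forall>h\<in>M. V (ell2_nth h [], row_op D h) = (ell2_nth (C h) [], D h)"
    using douglas[OF M p q qp] by blast
  note V_le = V_le'[rule_format] and V_eq = V_eq'[rule_format]
  \<comment> \<open>On \<open>M\<close> the operator \<open>D\<close> is a fixed point of
    \<open>step\<close>, by the choice of \<open>V\<close>; a fixed point on the whole space is
    wanted.\<close>
  define step where "step G = (\<lambda>h. snd (V (ell2_nth h [], row_op G h)))"
    for G :: "('n, 'u) fock \<Rightarrow> (nat, ('n, 'u) fock \<times> ('n, 'e) fock) ell2"
  have V_sq: "(norm (fst (V x)))\<^sup>2 + (norm (snd (V x)))\<^sup>2 \<le> (norm x)\<^sup>2" for x
    using power_mono[OF V_le[of x] norm_ge_zero, of 2] norm_Pair_sq[of "fst (V x)" "snd (V x)"]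
    unfolding prod.collapse by linarith
  have VG: "(\<lambda>h. V (ell2_nth h [], row_op G h)) \<in> bops" if "G \<in> bops" "\<And>h. norm (G h) \<le> norm h" for G
    by (rule bop_comp[OF V bop_Pair[OF nil row_op_bop[OF that]]])
  have step: "step G \<in> bops" "norm (step G h) \<le> norm h" if G: "G \<in> bops" "\<And>h. norm (G h) \<le> norm h" for G h
  proof -
    show "step G \<in> bops" unfolding step_def by (rule bop_comp[OF bop_snd VG[OF G]])
    have "(norm (step G h))\<^sup>2 \<le> (norm (ell2_nth h [], row_op G h))\<^sup>2"
      unfolding step_def using V_sq[of "(ell2_nth h [], row_op G h)"] zero_le_power2[of "norm (fst (V (ell2_nth h [], row_op G h)))"]
      by linarith
    also have "\<dots> \<le> (norm h)\<^sup>2" using row_norm_le[OF G, of h] by (simp add: norm_Pair_sq)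
    finally show "norm (step G h) \<le> norm h" by (rule norm_le_sqrtI)
  qed
  \<comment> \<open>The first components of the two arguments of \<open>V\<close> cancel, so only
    the difference of the rows remains, and it gains one letter.\<close>
  have step_diff: "norm (step G h - step G' h) \<le> 2 * norm (restr {\<gamma>. length \<gamma> \<ge> Suc k} h)"
    if G: "G \<in> bops" "\<And>h. norm (G h) \<le> norm h" and G': "G' \<in> bops" "\<And>h. norm (G' h) \<le> norm h"
      and le: "\<And>\<alpha>. norm (G (bshift b \<alpha> h) - G' (bshift b \<alpha> h))
        \<le> 2 * norm (restr {\<gamma>. length \<gamma> \<ge> k} (bshift b \<alpha> h))" for G G' h k
  proof -
    have "step G h - step G' h = snd (V (0, row_op G h - row_op G' h))"
      using bop_linear(2)[OF V, of "(ell2_nth h [], row_op G h)" "(ell2_nth h [], row_op G' h)"]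
      by (simp add: step_def)
    also have "norm \<dots> \<le> norm (0 :: 'u, row_op G h - row_op G' h)"
      by (rule order_trans[OF norm_snd V_le])
    also have "\<dots> = norm (row_op G h - row_op G' h)" by (simp add: norm_Pair)
    also have "\<dots> \<le> 2 * norm (restr {\<gamma>. length \<gamma> \<ge> Suc k} h)" by (rule row_diff_le[OF G G' le])
    finally show ?thesis .
  qed
  define E where "E k = (step ^^ k) (\<lambda>_. 0)" for k
  have E0: "E 0 = (\<lambda>_. 0)" and ESuc: "E (Suc k) = step (E k)" for k by (simp_all add: E_def)
  have E: "E k \<in> bops \<and> (\<forall>h. norm (E k h) \<le> norm h)" for k
  proof (induction k)
    case 0
    then show ?case by (simp add: E0)
  next
    case (Suc k)
    then show ?case unfolding ESuc using step[of "E k"] by blast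
  qed
  have E_bop: "E k \<in> bops" and E_le: "norm (E k h) \<le> norm h" for k h using E by auto
  have twice: "norm x \<le> 2 * norm y" if "norm x \<le> norm y"
    for x :: "(nat, ('n, 'u) fock \<times> ('n, 'e) fock) ell2" and y :: "('n, 'u) fock"
    using that norm_ge_zero[of y] by linarith
  \<comment> \<open>After \<open>k\<close> iterations nothing changes on vectors supported on words
    shorter than \<open>k\<close>.\<close>
  have approx: "norm (E (k + j) h - E k h) \<le> 2 * norm (restr {\<gamma>. length \<gamma> \<ge> k} h)" for k j h
  proof (induction k arbitrary: h)
    case 0
    show ?case by (simp add: E0 restr_UNIV twice[OF E_le])
  next
    case (Suc k)
    then show ?case using step_diff[OF E_bop E_le E_bop E_le, of "k + j" h k k] by (simp add: ESuc)
  qed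
  have "Cauchy (\<lambda>k. E k h)" for h
  proof (rule CauchyI)
    fix e :: real assume "e > 0"
    then have "\<forall>\<^sub>F k in sequentially. norm (restr {\<gamma>. length \<gamma> \<ge> k} h) < e / 4"
      using order_tendstoD(2)[OF tendsto_norm[OF tendsto_restr_length(2)[of h]], of "e / 4"] by simp
    then obtain N where N: "norm (restr {\<gamma>. length \<gamma> \<ge> N} h) < e / 4"
      by (auto simp: eventually_sequentially)
    have "norm (E m h - E n h) < e" if "m \<ge> N" "n \<ge> N" for m n
    proof -
      have "norm (E m h - E N h) \<le> 2 * norm (restr {\<gamma>. length \<gamma> \<ge> N} h)"
        "norm (E n h - E N h) \<le> 2 * norm (restr {\<gamma>. length \<gamma> \<ge> N} h)"
        using approx[of N "m - N" h] approx[of N "n - N" h] that by auto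
      then show ?thesis using N norm_triangle_ineq4[of "E m h - E N h" "E n h - E N h"] by simp
    qed
    then show "\<exists>M. \<forall>m\<ge>M. \<forall>n\<ge>M. norm (E m h - E n h) < e" by blast
  qed
  then have "\<exists>l. (\<lambda>k. E k h) \<longlonglongrightarrow> l" for h by (simp add: Cauchy_convergent_iff convergent_def)
  then obtain D' where D'_lim': "\<forall>h. (\<lambda>k. E k h) \<longlonglongrightarrow> D' h" by metis
  note D'_lim = D'_lim'[rule_format]
  have D': "D' \<in> bops" and D'_le: "norm (D' h) \<le> norm h" for h
    using bop_pointwise_limit[OF E_bop D'_lim, of 1] E_le by simp_all
  have D'_approx: "norm (D' h - E k h) \<le> 2 * norm (restr {\<gamma>. length \<gamma> \<ge> k} h)" for h k
  proof (rule LIMSEQ_le_const2)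
    show "(\<lambda>j. norm (E (k + j) h - E k h)) \<longlonglongrightarrow> norm (D' h - E k h)"
      using LIMSEQ_ignore_initial_segment[OF D'_lim[of h], of k]
      by (intro tendsto_norm tendsto_diff tendsto_const) (simp add: add.commute)
    show "\<exists>N. \<forall>n\<ge>N. norm (E (k + n) h - E k h) \<le> 2 * norm (restr {\<gamma>. length \<gamma> \<ge> k} h)"
      using approx by blast
  qed
  \<comment> \<open>The tails tend to 0, so any vector that close to all iterates is the limit. This
    is used both for the fixed-point property of \<open>D'\<close> and for its agreement with
    \<open>D\<close> on \<open>M\<close>.\<close>
  have unique: "D' h = l" if "\<And>k. norm (l - E k h) \<le> 2 * norm (restr {\<gamma>. length \<gamma> \<ge> k} h)" for h l
  proof -
    have "(\<lambda>k. 2 * norm (restr {\<gamma>. length \<gamma> \<ge> k} h)) \<longlonglongrightarrow> 0"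
      using tendsto_mult_right_zero[OF tendsto_norm_zero[OF tendsto_restr_length(2)[of h]]] .
    then have "(\<lambda>k. l - E k h) \<longlonglongrightarrow> 0"
      by (rule Lim_null_comparison[rotated]) (simp add: that)
    then have "(\<lambda>k. E k h) \<longlonglongrightarrow> l"
      using tendsto_diff[OF tendsto_const[of l]] by fastforce
    then show ?thesis using D'_lim LIMSEQ_unique by blast
  qed
  have D'_step: "step D' h = D' h" for h
  proof (rule unique[symmetric])
    show "norm (step D' h - E k h) \<le> 2 * norm (restr {\<gamma>. length \<gamma> \<ge> k} h)" for k
    proof (cases k)
      case 0
      show ?thesis by (simp add: 0 E0 restr_UNIV twice[OF step(2)[OF D' D'_le]])
    next
      case (Suc m)
      show ?thesis unfolding Suc ESuc by (rule step_diff[OF D' D'_le E_bop E_le D'_approx])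
    qed
  qed
  have D'_M: "D' h = D h" if "h \<in> M" for h
  proof (rule unique)
    fix k
    show "norm (D h - E k h) \<le> 2 * norm (restr {\<gamma>. length \<gamma> \<ge> k} h)"
      using that
    proof (induction k arbitrary: h)
      case 0
      show ?case by (simp add: E0 restr_UNIV twice[OF D_le])
    next
      case (Suc k)
      have "D h = step D h" using V_eq[OF Suc.prems] by (simp add: step_def)
      moreover have "norm (step D h - step (E k) h) \<le> 2 * norm (restr {\<gamma>. length \<gamma> \<ge> Suc k} h)"
        by (rule step_diff[OF D D_le E_bop E_le]) (rule Suc.IH[OF inv[OF Suc.prems]])
      ultimately show ?case by (simp add: ESuc)
    qed
  qed
  define a where "a = (\<lambda>h. fst (V (ell2_nth h [], row_op D' h)))"
  have a: "a \<in> bops" unfolding a_def by (rule bop_comp[OF bop_fst VG[OF D' D'_le]])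
  \<comment> \<open>By the fixed-point property the second component of \<open>V\<close> at this
    argument is \<open>D' h\<close> itself, so contractivity of \<open>V\<close> is exactly the
    hypothesis of the norm estimate.\<close>
  have a_le: "(norm (a h))\<^sup>2 + (norm (D' h))\<^sup>2 \<le> (norm (ell2_nth h []))\<^sup>2 + (norm (row_op D' h))\<^sup>2" for h
    using V_sq[of "(ell2_nth h [], row_op D' h)"] D'_step[of h] by (simp add: a_def step_def norm_Pair_sq)
  have fin: "(\<Sum>\<gamma>\<in>A. (norm (sqrt (b \<gamma>) *\<^sub>R a (bshift b \<gamma> h)))\<^sup>2) \<le> (norm h)\<^sup>2" if A: "finite A" for A h
  proof -
    from A have "finite (length ` A)" by simp
    then obtain N where N: "\<forall>k\<in>length ` A. k < N" using finite_nat_set_iff_bounded by blast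
    have "(\<Sum>\<gamma>\<in>A. (norm (sqrt (b \<gamma>) *\<^sub>R a (bshift b \<gamma> h)))\<^sup>2) = (\<Sum>\<gamma>\<in>A. b \<gamma> * (norm (a (bshift b \<gamma> h)))\<^sup>2)"
      using weights_pos[OF b] by (simp add: power_mult_distrib less_imp_le)
    also have "\<dots> \<le> (\<Sum>\<gamma> | length \<gamma> < N. b \<gamma> * (norm (a (bshift b \<gamma> h)))\<^sup>2)"
      using N weights_pos[OF b] by (intro sum_mono2 finite_words) (auto simp: less_imp_le)
    also have "\<dots> \<le> (norm h)\<^sup>2 - (norm (D' h))\<^sup>2" by (rule row_contraction_sum_le[OF D' D'_le a_le])
    also have "\<dots> \<le> (norm h)\<^sup>2" by simp
    finally show ?thesis .
  qed
  \<comment> \<open>Commutation with the shifts forces this formula: the empty coordinate of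
    \<open>bshift b \<gamma> k\<close> is coordinate \<open>\<gamma>\<close> of \<open>k\<close>
    divided by \<open>sqrt (b \<gamma>)\<close>.\<close>
  define A where "A = (\<lambda>h. Abs_ell2 (\<lambda>\<gamma>. sqrt (b \<gamma>) *\<^sub>R a (bshift b \<gamma> h)))"
  have A_nth: "ell2_nth (A h) \<gamma> = sqrt (b \<gamma>) *\<^sub>R a (bshift b \<gamma> h)" for h \<gamma>
    unfolding A_def by (simp add: ell2_boundedI(2)[OF fin])
  have A_le: "norm (A h) \<le> norm h" for h
    using ell2_boundedI(3)[OF fin, of h] by (simp add: A_def norm_le_sqrtI)
  have "A \<in> bops"
  proof (rule bopI[of _ 1])
    show "norm (A h) \<le> 1 * norm h" for h using A_le by simp
  qed (auto intro!: ell2_eqI simp: A_nth ell2_nth_simps bop_linear[OF bshift_bop[OF b]] bop_linear[OF a]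
      bop_scaleC[OF bshift_bop[OF b]] bop_scaleC[OF a] scaleR_add_right scaleR_scaleC)
  moreover have "A (bshift b [i] h) = bshift b [i] (A h)" for i h
  proof (rule ell2_eqI)
    fix \<gamma>
    have "sqrt (b \<gamma>) = sqrt (b \<gamma> / b (i # \<gamma>)) * sqrt (b (i # \<gamma>))"
      using weights_pos[OF b, of "i # \<gamma>"] by (simp flip: real_sqrt_mult)
    then show "ell2_nth (A (bshift b [i] h)) \<gamma> = ell2_nth (bshift b [i] (A h)) \<gamma>"
      by (simp add: A_nth bshift_nth[OF b] bshift_append[OF b, symmetric])
  qed
  moreover have "A h = C h" if h: "h \<in> M" for h
  proof (rule ell2_eqI)
    fix \<gamma>
    have *: "a k = ell2_nth (C k) []" if k: "k \<in> M" for k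
    proof -
      have "row_op D' k = row_op D k"
        by (rule ell2_eqI) (simp add: row_op_nth[OF D' D'_le] row_op_nth[OF D D_le] D'_M[OF inv[OF k]])
      then show ?thesis using V_eq[OF k] by (simp add: a_def)
    qed
    show "ell2_nth (A h) \<gamma> = ell2_nth (C h) \<gamma>"
      using weights_pos[OF b, of \<gamma>]
      by (simp add: A_nth *[OF inv[OF h]] int[OF h] bshift_nth[OF b] weights_Nil[OF b] flip: real_sqrt_mult)
  qed
  ultimately show ?thesis using A_le by blast
qed

text \<open>Rescaling to a contraction preserves the exact bound \<open>r\<close>, which the
  equality of norms in the theorem requires; for \<open>r = 0\<close> the map \<open>C\<close>
  vanishes.\<close>

lemma commutant_lifting:
  fixes C :: "('n, 'u::chilbert_space) fock \<Rightarrow> ('n, 'e::chilbert_space) fock"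
  assumes C: "C \<in> bops" and C_le: "\<And>h. norm (C h) \<le> r * norm h" and r: "r \<ge> 0" and M: "csubspace M"
    and inv: "\<And>i h. h \<in> M \<Longrightarrow> bshift b [i] h \<in> M"
    and int: "\<And>i h. h \<in> M \<Longrightarrow> C (bshift b [i] h) = bshift b [i] (C h)"
  shows "\<exists>A\<in>bops. (\<forall>h. norm (A h) \<le> r * norm h) \<and> (\<forall>i h. A (bshift b [i] h) = bshift b [i] (A h))
    \<and> (\<forall>h\<in>M. A h = C h)"
proof (cases "r = 0")
  case True
  then have "C h = 0" for h using C_le[of h] by simp
  then show ?thesis using True by (intro bexI[of _ "\<lambda>_. 0"]) (auto simp: bshift_zero[OF b])
next
  case False
  with r have r: "r > 0" by simp
  let ?C = "\<lambda>h. (1 / r) *\<^sub>R C h"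
  have "\<exists>A\<in>bops. (\<forall>h. norm (A h) \<le> norm h) \<and> (\<forall>i h. A (bshift b [i] h) = bshift b [i] (A h))
    \<and> (\<forall>h\<in>M. A h = ?C h)"
  proof (rule commutant_lifting_contraction[OF bop_scaleR[OF C] _ M inv])
    show "norm (?C h) \<le> norm h" for h using C_le[of h] r by (simp add: divide_simps mult.commute)
    show "?C (bshift b [i] h) = bshift b [i] (?C h)" if "h \<in> M" for i h
      by (simp add: int[OF that] bop_linear[OF bshift_bop[OF b]])
  qed
  then obtain A where A: "A \<in> bops" "\<forall>h. norm (A h) \<le> norm h"
      "\<forall>i h. A (bshift b [i] h) = bshift b [i] (A h)" "\<forall>h\<in>M. A h = ?C h"
    by blast
  show ?thesis
    using A r
    by (intro bexI[of _ "\<lambda>h. r *\<^sub>R A h"] bop_scaleR[OF A(1)]) (auto simp: bop_linear[OF bshift_bop[OF b]])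
qed

end

section \<open>The weak operator topology\<close>

lemma limitin_wotI:
  assumes "T0 \<in> bop M N" and "\<And>n. T n \<in> bop M N"
    and "\<And>x y. x \<in> M \<Longrightarrow> y \<in> N \<Longrightarrow> ((\<lambda>n. cinner (T n x) y) \<longlongrightarrow> cinner (T0 x) y) F"
  shows "limitin (wot M N) T T0 F"
proof -
  let ?f = "\<lambda>T. \<lambda>(x, y)\<in>M \<times> N. cinner (T x) y"
  have "limitin (product_topology (\<lambda>_. euclidean) (M \<times> N)) (\<lambda>n. ?f (T n)) (?f T0) F"
    unfolding limitin_componentwise using assms(3) by auto
  then show ?thesis
    unfolding limitin_def wot_def topspace_pullback_topology openin_pullback_topology
    using assms(1,2) by auto
qed

lemma limitin_wotD:
  assumes lim: "limitin (wot M N) T T0 F" and xy: "x \<in> M" "y \<in> N"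
  shows "((\<lambda>n. cinner (T n x) y) \<longlongrightarrow> cinner (T0 x) y) F"
proof -
  let ?f = "\<lambda>T. \<lambda>(x, y)\<in>M \<times> N. cinner (T x) y"
  have "continuous_map (product_topology (\<lambda>_. euclidean) (M \<times> N)) euclidean (\<lambda>u. u (x, y))"
    by (rule continuous_map_product_projection) (use xy in auto)
  from continuous_map_limit[OF continuous_map_pullback[OF this, of "bop M N" ?f] lim[unfolded wot_def]]
  show ?thesis using xy by (simp add: o_def)
qed

lemma in_wot_closure:
  assumes "limitin (wot M N) T T0 sequentially" "\<And>n. T n \<in> S"
  shows "T0 \<in> wot M N closure_of S"
  unfolding in_closure_of
proof (intro conjI allI impI)
  show "T0 \<in> topspace (wot M N)" using assms(1) by (simp add: limitin_def)
  fix U assume "T0 \<in> U \<and> openin (wot M N) U"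
  then have "\<forall>\<^sub>F n in sequentially. T n \<in> U" using assms(1) by (simp add: limitin_def)
  then obtain n where "T n \<in> U" by (auto simp: eventually_sequentially)
  then show "\<exists>T. T \<in> S \<and> T \<in> U" using assms(2) by blast
qed

text \<open>The span is built from sets of operators, so coinciding summands have to be merged;
  their multiplicity becomes the coefficient.\<close>

lemma sum_in_op_cspan:
  fixes T :: "'i \<Rightarrow> 'a \<Rightarrow> 'b::chilbert_space"
  assumes I: "finite I" and T: "\<And>i. i \<in> I \<Longrightarrow> T i \<in> A"
  shows "(\<lambda>x. \<Sum>i\<in>I. T i x) \<in> op_cspan A"
proof -
  let ?c = "\<lambda>S. of_nat (card {i \<in> I. T i = S}) :: complex"
  have "(\<Sum>i\<in>I. T i x) = (\<Sum>S\<in>T ` I. ?c S *\<^sub>C S x)" for x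
  proof -
    have "(\<Sum>i\<in>I. T i x) = (\<Sum>S\<in>T ` I. \<Sum>i | i \<in> I \<and> T i = S. T i x)"
      by (rule sum.image_gen[OF I])
    also have "\<dots> = (\<Sum>S\<in>T ` I. ?c S *\<^sub>C S x)"
    proof (rule sum.cong[OF refl])
      fix S
      have "(\<Sum>i | i \<in> I \<and> T i = S. T i x) = (\<Sum>i | i \<in> I \<and> T i = S. S x)" by (rule sum.cong) auto
      also have "\<dots> = real (card {i \<in> I. T i = S}) *\<^sub>R S x" by (rule sum_constant_scaleR)
      also have "\<dots> = ?c S *\<^sub>C S x" by (simp flip: scaleC_of_real)
      finally show "(\<Sum>i | i \<in> I \<and> T i = S. T i x) = ?c S *\<^sub>C S x" .
    qed
    finally show ?thesis .
  qed
  moreover have "finite (T ` I)" "T ` I \<subseteq> A" using I T by auto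
  ultimately show ?thesis unfolding op_cspan_def by (auto intro!: exI[of _ "T ` I"] exI[of _ ?c])
qed


section \<open>Fejer means of multi-analytic operators\<close>

text \<open>The weighted right creation operator of the word \<open>\<beta>\<close> tensored with
  \<open>Y\<close>. The factor \<open>b \<beta>\<close> normalizes it so that
  \<open>e_[] (x) x\<close> goes to \<open>e_\<beta> (x) Y x\<close> with coefficient 1.\<close>

definition rmult :: "'n nc_series \<Rightarrow> 'n list \<Rightarrow> ('e::chilbert_space \<Rightarrow> 'k::chilbert_space)
    \<Rightarrow> ('n, 'e) fock \<Rightarrow> ('n, 'k) fock"
  where "rmult b \<beta> Y = ad (pullback (\<lambda>\<alpha>. \<alpha> @ \<beta>) (\<lambda>\<alpha>. sqrt (b \<alpha> * b \<beta> / b (\<alpha> @ \<beta>))) (ad Y))"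

context
  fixes b :: "'n::finite nc_series"
  assumes b: "shift_weights b" and right_bound: "\<And>\<beta>. \<exists>C. \<forall>\<alpha>. b \<alpha> / b (\<alpha> @ \<beta>) \<le> C"
begin

lemma
  fixes Y :: "'e::chilbert_space \<Rightarrow> 'k::chilbert_space"
  assumes Y: "Y \<in> bops"
  shows rmult_bop: "(rmult b \<beta> Y :: ('n, 'e) fock \<Rightarrow> ('n, 'k) fock) \<in> bops"
    and rmult_unit_vec: "rmult b \<beta> Y (unit_vec \<alpha> x)
      = sqrt (b \<alpha> * b \<beta> / b (\<alpha> @ \<beta>)) *\<^sub>R unit_vec (\<alpha> @ \<beta>) (Y x)"
proof -
  let ?P = "pullback (\<lambda>\<alpha>. \<alpha> @ \<beta>) (\<lambda>\<alpha>. sqrt (b \<alpha> * b \<beta> / b (\<alpha> @ \<beta>))) (ad Y)"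
  obtain C where C': "\<forall>\<alpha>. b \<alpha> / b (\<alpha> @ \<beta>) \<le> C" using right_bound[of \<beta>] by blast
  have w: "\<bar>sqrt (b \<alpha> * b \<beta> / b (\<alpha> @ \<beta>))\<bar> \<le> sqrt (C * b \<beta>)" for \<alpha>
  proof -
    have "b \<alpha> * b \<beta> / b (\<alpha> @ \<beta>) \<le> C * b \<beta>"
      using mult_right_mono[OF C'[rule_format, of \<alpha>], of "b \<beta>"] weights_pos[OF b, of \<beta>] by simp
    then show ?thesis using weights_pos[OF b] by (simp add: less_imp_le)
  qed
  have inj: "inj (\<lambda>\<alpha>. \<alpha> @ \<beta>)" by (simp add: inj_def)
  obtain K where K': "K \<ge> 0" "\<forall>x. norm (ad Y x) \<le> K * norm x" using bop_bound[OF ad_bop[OF Y]] by blast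
  note P = pullback[OF inj w ad_bop[OF Y] K'(2)[rule_format] K'(1)]
  show "(rmult b \<beta> Y :: ('n, 'e) fock \<Rightarrow> ('n, 'k) fock) \<in> bops" unfolding rmult_def by (rule ad_bop[OF P(3)])
  show "rmult b \<beta> Y (unit_vec \<alpha> x)
      = sqrt (b \<alpha> * b \<beta> / b (\<alpha> @ \<beta>)) *\<^sub>R unit_vec (\<alpha> @ \<beta>) (Y x)" (is "_ = ?r")
  proof (rule ell2_cinner_eqI)
    fix \<gamma> y
    have "cinner (rmult b \<beta> Y (unit_vec \<alpha> x)) (unit_vec \<gamma> y) = cinner ?r (unit_vec \<gamma> y)"
      unfolding rmult_def cinner_ad'[OF P(3)] cinner_unit_vec_left P(1) cinner.scaleR_left cinner.scaleR_right
        cinner_ad[OF Y] ..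
    then show "cinner (unit_vec \<gamma> y) (rmult b \<beta> Y (unit_vec \<alpha> x)) = cinner (unit_vec \<gamma> y) ?r"
      by (metis cinner_commute)
  qed
qed

lemma tensor_op_rmult:
  assumes Y: "Y \<in> bops"
  shows "tensor_op (rmult b \<beta> id) Y = rmult b \<beta> Y"
proof (rule tensor_op_eqI[OF rmult_bop[OF Y]])
  fix \<phi> :: "('n, complex) fock" and x
  let ?S = "\<lambda>\<phi>. rmult b \<beta> Y (tensor_vec \<phi> x)" and ?T = "\<lambda>\<phi>. tensor_vec (rmult b \<beta> id \<phi>) (Y x)"
  have "?S = ?T"
  proof (rule bop_eq_on_unit_vecs)
    show "?S \<in> bops" by (rule bop_comp[OF rmult_bop[OF Y] tensor_vec_bop])
    show "?T \<in> bops" by (rule bop_comp[OF tensor_vec_bop rmult_bop[OF bop_id(1)]])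
    show "?S (unit_vec \<alpha> c) = ?T (unit_vec \<alpha> c)" for \<alpha> c
      by (simp add: tensor_vec_unit_vec rmult_unit_vec[OF Y] rmult_unit_vec[OF bop_id(1)] bop_scaleC[OF Y]
          bop_linear(4)[OF tensor_vec_bop])
  qed
  then show "rmult b \<beta> Y (tensor_vec \<phi> x) = tensor_vec (rmult b \<beta> id \<phi>) (Y x)" by (rule fun_cong)
qed

text \<open>Letters added at the front and at the back do not interfere; the two products of weights
  agree after cancelling the intermediate coefficient.\<close>

lemma rmult_R_infty: "rmult b \<beta> id \<in> R_infty b"
proof -
  note R = rmult_bop[OF bop_id(1)]
  have "(rmult b \<beta> id \<circ> fshift b [i] :: ('n, complex) fock \<Rightarrow> _) = fshift b [i] \<circ> rmult b \<beta> id" for i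
  proof (rule bop_eq_on_unit_vecs)
    fix \<alpha> and x :: complex
    have "sqrt (b \<alpha> / b (i # \<alpha>)) * sqrt (b (i # \<alpha>) * b \<beta> / b (i # \<alpha> @ \<beta>))
        = sqrt (b \<alpha> * b \<beta> / b (\<alpha> @ \<beta>)) * sqrt (b (\<alpha> @ \<beta>) / b (i # \<alpha> @ \<beta>))"
      using weights_pos[OF b, of "i # \<alpha>"] weights_pos[OF b, of "\<alpha> @ \<beta>"] by (simp flip: real_sqrt_mult)
    then show "(rmult b \<beta> id \<circ> fshift b [i]) (unit_vec \<alpha> x) = (fshift b [i] \<circ> rmult b \<beta> id) (unit_vec \<alpha> x)"
      by (simp add: fshift_unit_vec[OF b] rmult_unit_vec[OF bop_id(1)] bop_linear(4)[OF R]
          bop_linear(4)[OF fshift_bop[OF b]])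
  qed (intro bop_o R fshift_bop[OF b])+
  then show ?thesis by (simp add: R_infty_def R universal_model_eq[OF b])
qed

context
  fixes \<Phi> :: "('n, 'e::chilbert_space) fock \<Rightarrow> ('n, 'k::chilbert_space) fock" and r :: real
  assumes \<Phi>: "\<Phi> \<in> bops" and \<Phi>_le: "\<And>h. norm (\<Phi> h) \<le> r * norm h" and r: "r \<ge> 0"
    and \<Phi>_int: "\<And>i h. \<Phi> (fshift b [i] h) = fshift b [i] (\<Phi> h)"
begin

text \<open>The Fourier coefficients of \<open>\<Phi>\<close>: an intertwiner is determined by its
  values on the vectors at the empty word.\<close>

definition symbol :: "'n list \<Rightarrow> 'e \<Rightarrow> 'k"
  where "symbol \<beta> = (\<lambda>x. ell2_nth (\<Phi> (unit_vec [] x)) \<beta>)"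

lemma symbol_bop: "symbol \<beta> \<in> bops"
  unfolding symbol_def by (rule bop_comp[OF ell2_nth_bop bop_comp[OF \<Phi> unit_vec_bop]])

lemma intertwiner_unit_vec:
  "\<Phi> (unit_vec \<alpha> x) = sqrt (b \<alpha>) *\<^sub>R fshift b \<alpha> (\<Phi> (unit_vec [] x))"
proof -
  have int: "\<Phi> (fshift b \<alpha> h) = fshift b \<alpha> (\<Phi> h)" for h
  proof (induction \<alpha> arbitrary: h)
    case (Cons i \<alpha>)
    then show ?case
      using fshift_append[OF b, of "[i]" \<alpha> h] fshift_append[OF b, of "[i]" \<alpha> "\<Phi> h"] \<Phi>_int by simp
  qed (simp add: fshift_Nil[OF b])
  have "unit_vec \<alpha> x = sqrt (b \<alpha>) *\<^sub>R fshift b \<alpha> (unit_vec [] x)"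
    using weights_pos[OF b, of \<alpha>] by (simp add: fshift_unit_vec[OF b] weights_Nil[OF b] flip: real_sqrt_mult)
  then show ?thesis by (simp only: bop_linear(4)[OF \<Phi>] int)
qed

text \<open>These are the matrix entries of \<open>rmult b \<beta> (symbol \<beta>)\<close>, so
  formally \<open>\<Phi>\<close> is the sum of these operators over all
  \<open>\<beta>\<close>.\<close>

lemma cinner_intertwiner_append:
  "cinner (\<Phi> (unit_vec \<alpha> x)) (unit_vec (\<alpha> @ \<beta>) y)
    = complex_of_real (sqrt (b \<alpha> * b \<beta> / b (\<alpha> @ \<beta>))) * cinner (symbol \<beta> x) y"
proof -
  have "bshift b \<alpha> (unit_vec (\<alpha> @ \<beta>) y) = sqrt (b \<beta> / b (\<alpha> @ \<beta>)) *\<^sub>R unit_vec \<beta> y"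
    by (rule ell2_eqI) (simp add: bshift_nth[OF b] unit_vec_nth ell2_nth_simps)
  then have "cinner (\<Phi> (unit_vec \<alpha> x)) (unit_vec (\<alpha> @ \<beta>) y)
      = complex_of_real (sqrt (b \<alpha>) * sqrt (b \<beta> / b (\<alpha> @ \<beta>))) * cinner (symbol \<beta> x) y"
    unfolding intertwiner_unit_vec[of \<alpha>] cinner.scaleR_left cinner_fshift[OF b]
    by (simp add: cinner.scaleR_right cinner_unit_vec_right symbol_def scaleR_conv_of_real mult.assoc)
  then show ?thesis by (simp add: real_sqrt_mult[symmetric])
qed

lemma cinner_intertwiner_other:
  assumes "\<And>\<beta>. \<gamma> \<noteq> \<alpha> @ \<beta>"
  shows "cinner (\<Phi> (unit_vec \<alpha> x)) (unit_vec \<gamma> y) = 0"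
proof -
  have "bshift b \<alpha> (unit_vec \<gamma> y) = 0"
    using assms by (intro ell2_eqI) (auto simp: bshift_nth[OF b] unit_vec_nth ell2_nth_simps)
  then show ?thesis
    by (subst intertwiner_unit_vec) (simp add: cinner_fshift[OF b] cinner.scaleR_left cinner.zero_right)
qed

definition fejer_weight :: "nat \<Rightarrow> nat \<Rightarrow> real"
  where "fejer_weight N k = (if k < N then 1 - real k / real N else 0)"

text \<open>The Cesaro mean of the formal series of \<open>\<Phi>\<close>, with word length as
  degree; the sum is finite because the alphabet is.\<close>

definition fejer :: "nat \<Rightarrow> ('n, 'e) fock \<Rightarrow> ('n, 'k) fock"
  where "fejer N h = (\<Sum>\<beta> | length \<beta> < N. rmult b \<beta> (\<lambda>x. fejer_weight N (length \<beta>) *\<^sub>R symbol \<beta> x) h)"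

lemma fejer_bop: "fejer N \<in> bops"
  unfolding fejer_def[abs_def] by (rule bop_sum) (rule rmult_bop[OF bop_scaleR[OF symbol_bop]])

text \<open>If \<open>length \<gamma> < length \<alpha>\<close>, the truncated subtraction is harmless, both sides being 0.\<close>

lemma cinner_fejer_unit_vec:
  "cinner (fejer N (unit_vec \<alpha> x)) (unit_vec \<gamma> y)
    = complex_of_real (fejer_weight N (length \<gamma> - length \<alpha>)) * cinner (\<Phi> (unit_vec \<alpha> x)) (unit_vec \<gamma> y)"
proof -
  let ?c = "\<lambda>\<beta>. complex_of_real (sqrt (b \<alpha> * b \<beta> / b (\<alpha> @ \<beta>)) * fejer_weight N (length \<beta>)) * cinner (symbol \<beta> x) y"
  have *: "cinner (fejer N (unit_vec \<alpha> x)) (unit_vec \<gamma> y)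
      = (\<Sum>\<beta> | length \<beta> < N. if \<gamma> = \<alpha> @ \<beta> then ?c \<beta> else 0)"
    unfolding fejer_def cinner.sum_left
  proof (rule sum.cong[OF refl])
    fix \<beta>
    show "cinner (rmult b \<beta> (\<lambda>x. fejer_weight N (length \<beta>) *\<^sub>R symbol \<beta> x) (unit_vec \<alpha> x)) (unit_vec \<gamma> y)
        = (if \<gamma> = \<alpha> @ \<beta> then ?c \<beta> else 0)"
      unfolding rmult_unit_vec[OF bop_scaleR[OF symbol_bop]] cinner.scaleR_left cinner_unit_vec_right
        ell2_nth_simps unit_vec_nth
      by (simp add: cinner.scaleR_left cinner.zero_left scaleR_conv_of_real)
  qed
  show ?thesis
  proof (cases "\<exists>\<beta>. \<gamma> = \<alpha> @ \<beta>")
    case True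
    then obtain \<beta> where \<gamma>: "\<gamma> = \<alpha> @ \<beta>" by blast
    have "cinner (fejer N (unit_vec \<alpha> x)) (unit_vec \<gamma> y) = (if length \<beta> < N then ?c \<beta> else 0)"
      unfolding * using finite_words(2)[of N, where ?'n = 'n] by (simp add: \<gamma> sum.delta)
    then show ?thesis
      by (simp add: \<gamma> cinner_intertwiner_append fejer_weight_def mult_ac)
  next
    case False
    then show ?thesis unfolding * by (simp add: cinner_intertwiner_other)
  qed
qed

text \<open>A block of \<open>N\<close> consecutive word lengths ending at \<open>m\<close>, written
  additively to avoid truncated subtraction.\<close>

definition window :: "nat \<Rightarrow> nat \<Rightarrow> 'n list set"
  where "window N m = {\<gamma>. length \<gamma> \<le> m \<and> m < length \<gamma> + N}"

text \<open>Two lengths at distance \<open>d\<close> share \<open>N - d\<close> windows. The range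
  \<open>m < L + N\<close> cuts none of them off, as the lengths are below \<open>L\<close>.\<close>

lemma card_window:
  assumes "k < L" "l < L" "k \<le> l" "0 < N"
  shows "real (card {m. m < L + N \<and> (k \<le> m \<and> m < k + N) \<and> (l \<le> m \<and> m < l + N)}) = real N * fejer_weight N (l - k)"
proof -
  have *: "{m. m < L + N \<and> (k \<le> m \<and> m < k + N) \<and> (l \<le> m \<and> m < l + N)} = {l..<k + N}"
    using assms by auto
  obtain d where d: "l = k + d" using assms(3) le_Suc_ex by blast
  have "real (N - d) = real N * fejer_weight N d"
    using assms(4) by (cases "d < N") (simp_all add: fejer_weight_def of_nat_diff field_simps)
  then show ?thesis unfolding * by (simp add: d)
qed

abbreviation trunc :: "nat \<Rightarrow> ('n, 'a::chilbert_space) fock \<Rightarrow> ('n, 'a) fock"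
  where "trunc L \<equiv> restr {\<gamma>. length \<gamma> < L}"

lemma cinner_trunc:
  fixes T :: "('n, 'e) fock \<Rightarrow> ('n, 'k) fock"
  assumes T: "T \<in> bops" and A: "finite A"
  shows "cinner (T (restr A x)) (restr A y)
    = (\<Sum>\<alpha>\<in>A. \<Sum>\<gamma>\<in>A. cinner (T (unit_vec \<alpha> (ell2_nth x \<alpha>))) (unit_vec \<gamma> (ell2_nth y \<gamma>)))"
  unfolding restr_finite[OF A] bop_linear(5)[OF T] cinner.sum_left cinner.sum_right by (rule sum.swap)

text \<open>The Schur multiplier of the Fejer mean is an average of the block projections
  \<open>restr (window N m)\<close> on both sides.\<close>

lemma fejer_windows:
  assumes N: "0 < N"
  shows "real N *\<^sub>R cinner (fejer N (trunc L x)) (trunc L y)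
    = (\<Sum>m<L + N. cinner (\<Phi> (restr (window N m) (trunc L x))) (restr (window N m) (trunc L y)))"
proof -
  define A where "A = {\<gamma> :: 'n list. length \<gamma> < L}"
  have A: "finite A" by (simp add: A_def finite_words)
  define t where "t \<alpha> \<gamma> = cinner (\<Phi> (unit_vec \<alpha> (ell2_nth x \<alpha>))) (unit_vec \<gamma> (ell2_nth y \<gamma>))" for \<alpha> \<gamma>
  \<comment> \<open>The windows containing both words are counted. If \<open>\<alpha>\<close> is
    longer than \<open>\<gamma>\<close>, the matrix entry is 0 and the count is irrelevant.\<close>
  have coef: "real N *\<^sub>R complex_of_real (fejer_weight N (length \<gamma> - length \<alpha>)) * t \<alpha> \<gamma>
      = (\<Sum>m<L + N. if \<alpha> \<in> window N m \<and> \<gamma> \<in> window N m then t \<alpha> \<gamma> else 0)"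
    if "\<alpha> \<in> A" "\<gamma> \<in> A" for \<alpha> \<gamma>
  proof (cases "length \<alpha> \<le> length \<gamma>")
    case True
    let ?M = "{m. m < L + N \<and> (length \<alpha> \<le> m \<and> m < length \<alpha> + N) \<and> (length \<gamma> \<le> m \<and> m < length \<gamma> + N)}"
    have "(\<Sum>m<L + N. if \<alpha> \<in> window N m \<and> \<gamma> \<in> window N m then t \<alpha> \<gamma> else 0) = (\<Sum>m\<in>?M. t \<alpha> \<gamma>)"
      by (rule sum.mono_neutral_cong_right) (auto simp: window_def)
    also have "\<dots> = complex_of_real (real (card ?M)) * t \<alpha> \<gamma>" by simp
    also have "real (card ?M) = real N * fejer_weight N (length \<gamma> - length \<alpha>)"
      using that True N by (intro card_window[of _ L]) (auto simp: A_def)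
    finally show ?thesis by (simp add: scaleR_conv_of_real)
  next
    case False
    then have "t \<alpha> \<gamma> = 0" unfolding t_def by (intro cinner_intertwiner_other) auto
    then show ?thesis by (simp cong: if_cong)
  qed
  have window: "restr (window N m) (restr A z) = restr A (restr (window N m) z)"
    for m and z :: "('n, 'a::chilbert_space) fock"
    by (rule ell2_eqI) (simp add: restr_nth)
  have "real N *\<^sub>R cinner (fejer N (restr A x)) (restr A y)
      = (\<Sum>\<alpha>\<in>A. \<Sum>\<gamma>\<in>A. real N *\<^sub>R complex_of_real (fejer_weight N (length \<gamma> - length \<alpha>)) * t \<alpha> \<gamma>)"
    by (simp add: cinner_trunc[OF fejer_bop A] cinner_fejer_unit_vec t_def scaleR_sum_right)
  also have "\<dots> = (\<Sum>\<alpha>\<in>A. \<Sum>\<gamma>\<in>A. \<Sum>m<L + N. if \<alpha> \<in> window N m \<and> \<gamma> \<in> window N m then t \<alpha> \<gamma> else 0)"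
    by (intro sum.cong refl coef)
  also have "\<dots> = (\<Sum>m<L + N. \<Sum>\<alpha>\<in>A. \<Sum>\<gamma>\<in>A. if \<alpha> \<in> window N m \<and> \<gamma> \<in> window N m then t \<alpha> \<gamma> else 0)"
    unfolding sum.swap[of _ "{..<L + N}" A] by (rule refl)
  also have "\<dots> = (\<Sum>m<L + N. cinner (\<Phi> (restr (window N m) (restr A x))) (restr (window N m) (restr A y)))"
  proof (rule sum.cong[OF refl])
    fix m
    have "(if \<alpha> \<in> window N m \<and> \<gamma> \<in> window N m then t \<alpha> \<gamma> else 0)
        = cinner (\<Phi> (unit_vec \<alpha> (ell2_nth (restr (window N m) x) \<alpha>))) (unit_vec \<gamma> (ell2_nth (restr (window N m) y) \<gamma>))"
      for \<alpha> \<gamma>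
      by (simp add: t_def restr_nth bop_linear(3)[OF unit_vec_bop] bop_linear(3)[OF \<Phi>] cinner.zero_left cinner.zero_right)
    then show "(\<Sum>\<alpha>\<in>A. \<Sum>\<gamma>\<in>A. if \<alpha> \<in> window N m \<and> \<gamma> \<in> window N m then t \<alpha> \<gamma> else 0)
        = cinner (\<Phi> (restr (window N m) (restr A x))) (restr (window N m) (restr A y))"
      unfolding window cinner_trunc[OF \<Phi> A] by simp
  qed
  finally show ?thesis by (simp add: A_def)
qed

text \<open>Each word shorter than \<open>L\<close> lies in exactly \<open>N\<close> of the
  windows.\<close>

lemma sum_norm_window:
  assumes "0 < N"
  shows "(\<Sum>m<L + N. (norm (restr (window N m) (trunc L z)))\<^sup>2) = real N * (norm (trunc L z))\<^sup>2"
proof -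
  let ?A = "{\<gamma> :: 'n list. length \<gamma> < L}"
  have "(norm (restr (window N m) (trunc L z)))\<^sup>2 = (\<Sum>\<alpha>\<in>?A. if \<alpha> \<in> window N m then (norm (ell2_nth z \<alpha>))\<^sup>2 else 0)" for m
  proof -
    have "restr (window N m) (trunc L z) = trunc L (restr (window N m) z)"
      by (rule ell2_eqI) (simp add: restr_nth)
    then show ?thesis
      by (simp add: norm_restr_finite[OF finite_words(2)] restr_nth if_distrib[of norm] if_distrib[of "\<lambda>x. x\<^sup>2"] cong: if_cong)
  qed
  then have "(\<Sum>m<L + N. (norm (restr (window N m) (trunc L z)))\<^sup>2)
      = (\<Sum>\<alpha>\<in>?A. \<Sum>m<L + N. if \<alpha> \<in> window N m then (norm (ell2_nth z \<alpha>))\<^sup>2 else 0)"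
    by (simp only:) (rule sum.swap)
  also have "\<dots> = (\<Sum>\<alpha>\<in>?A. real N * (norm (ell2_nth z \<alpha>))\<^sup>2)"
  proof (rule sum.cong[OF refl])
    fix \<alpha> assume \<alpha>: "\<alpha> \<in> ?A"
    have "(\<Sum>m<L + N. if \<alpha> \<in> window N m then (norm (ell2_nth z \<alpha>))\<^sup>2 else 0)
        = (\<Sum>m\<in>{length \<alpha>..<length \<alpha> + N}. (norm (ell2_nth z \<alpha>))\<^sup>2)"
      using \<alpha> by (intro sum.mono_neutral_cong_right) (auto simp: window_def)
    then show "(\<Sum>m<L + N. if \<alpha> \<in> window N m then (norm (ell2_nth z \<alpha>))\<^sup>2 else 0)
        = real N * (norm (ell2_nth z \<alpha>))\<^sup>2" by simp
  qed
  also have "\<dots> = real N * (norm (trunc L z))\<^sup>2"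
    by (simp add: norm_restr_finite[OF finite_words(2)] sum_distrib_left)
  finally show ?thesis .
qed

text \<open>Cauchy-Schwarz over the windows gives two factors \<open>sqrt N\<close>, which cancel
  the \<open>N\<close> on the left; so the bound \<open>r\<close> of \<open>\<Phi>\<close> survives
  uniformly in \<open>N\<close>.\<close>

lemma cmod_fejer_le:
  assumes N: "0 < N"
  shows "cmod (cinner (fejer N x) y) \<le> r * norm x * norm y"
proof (rule LIMSEQ_le_const2)
  have "(\<lambda>L. cinner (fejer N (trunc L x)) (trunc L y)) \<longlonglongrightarrow> cinner (fejer N x) y"
    by (intro cinner.tendsto bop_tendsto[OF fejer_bop] tendsto_restr_length)
  then show "(\<lambda>L. cmod (cinner (fejer N (trunc L x)) (trunc L y))) \<longlonglongrightarrow> cmod (cinner (fejer N x) y)"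
    by (rule tendsto_norm)
  have "cmod (cinner (fejer N (trunc L x)) (trunc L y)) \<le> r * norm x * norm y" for L
  proof -
    let ?p = "\<lambda>m. norm (restr (window N m) (trunc L x))" and ?q = "\<lambda>m. norm (restr (window N m) (trunc L y))"
    have "real N * cmod (cinner (fejer N (trunc L x)) (trunc L y))
        = cmod (\<Sum>m<L + N. cinner (\<Phi> (restr (window N m) (trunc L x))) (restr (window N m) (trunc L y)))"
      unfolding fejer_windows[OF N, symmetric] by simp
    also have "\<dots> \<le> (\<Sum>m<L + N. r * (\<bar>?p m\<bar> * \<bar>?q m\<bar>))"
    proof (rule sum_norm_le)
      fix m
      show "cmod (cinner (\<Phi> (restr (window N m) (trunc L x))) (restr (window N m) (trunc L y))) \<le> r * (\<bar>?p m\<bar> * \<bar>?q m\<bar>)"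
        using order_trans[OF cmod_cinner_le_norm mult_right_mono[OF \<Phi>_le norm_ge_zero]] by (simp add: mult.assoc)
    qed
    also have "\<dots> \<le> r * (L2_set ?p {..<L + N} * L2_set ?q {..<L + N})"
      unfolding sum_distrib_left[symmetric] by (intro mult_left_mono r L2_set_mult_ineq)
    also have "\<dots> = r * (sqrt (real N) * norm (trunc L x) * (sqrt (real N) * norm (trunc L y)))"
      unfolding L2_set_def sum_norm_window[OF N] by (simp add: real_sqrt_mult)
    also have "\<dots> = real N * (r * (norm (trunc L x) * norm (trunc L y)))"
      by (simp add: mult_ac)
    finally have "cmod (cinner (fejer N (trunc L x)) (trunc L y)) \<le> r * (norm (trunc L x) * norm (trunc L y))"
      using N by simp
    also have "\<dots> \<le> r * (norm x * norm y)"
      by (intro mult_left_mono mult_mono norm_restr_le r) auto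
    finally show ?thesis by (simp add: mult.assoc)
  qed
  then show "\<exists>M. \<forall>L\<ge>M. cmod (cinner (fejer N (trunc L x)) (trunc L y)) \<le> r * norm x * norm y" by blast
qed

lemma fejer_weight_tendsto: "(\<lambda>N. fejer_weight N k) \<longlonglongrightarrow> 1"
proof -
  have "(\<lambda>N. 1 - real k / real N) \<longlonglongrightarrow> 1 - 0"
    by (intro tendsto_diff tendsto_const lim_const_over_n)
  then have "(\<lambda>N. 1 - real k / real N) \<longlonglongrightarrow> 1" by simp
  then show ?thesis
    by (rule Lim_transform_eventually)
      (rule eventually_mono[OF eventually_gt_at_top[of k]], simp add: fejer_weight_def)
qed

text \<open>On truncated vectors finitely many matrix entries converge; the uniform bound on the
  means controls the error of truncation.\<close>

lemma fejer_tendsto: "(\<lambda>N. cinner (fejer N x) y) \<longlonglongrightarrow> cinner (\<Phi> x) y"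
proof (rule metric_LIMSEQ_I)
  fix e :: real assume e: "e > 0"
  let ?e = "\<lambda>L. 2 * r * norm (x - trunc L x) * norm y + 2 * r * norm x * norm (y - trunc L y)"
  have "?e \<longlonglongrightarrow> 2 * r * norm (x - x) * norm y + 2 * r * norm x * norm (y - y)"
    by (intro tendsto_intros tendsto_restr_length)
  then have "\<forall>\<^sub>F L in sequentially. ?e L < e / 2"
    using e by (intro order_tendstoD(2)[where y = 0]) auto
  then obtain L where L: "?e L < e / 2" by (auto simp: eventually_sequentially)
  define x' y' where "x' = trunc L x" and "y' = trunc L y"
  have "(\<lambda>N. cinner (fejer N x') y') \<longlonglongrightarrow> cinner (\<Phi> x') y'"
  proof -
    have "(\<lambda>N. \<Sum>\<alpha> | length \<alpha> < L. \<Sum>\<gamma> | length \<gamma> < L. complex_of_real (fejer_weight N (length \<gamma> - length \<alpha>))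
          * cinner (\<Phi> (unit_vec \<alpha> (ell2_nth x \<alpha>))) (unit_vec \<gamma> (ell2_nth y \<gamma>)))
      \<longlonglongrightarrow> (\<Sum>\<alpha> | length \<alpha> < L. \<Sum>\<gamma> | length \<gamma> < L. complex_of_real 1
          * cinner (\<Phi> (unit_vec \<alpha> (ell2_nth x \<alpha>))) (unit_vec \<gamma> (ell2_nth y \<gamma>)))"
      by (intro tendsto_intros fejer_weight_tendsto)
    then show ?thesis
      by (simp add: x'_def y'_def cinner_trunc[OF fejer_bop finite_words(2)] cinner_trunc[OF \<Phi> finite_words(2)]
          cinner_fejer_unit_vec)
  qed
  then obtain N0 where N0': "\<forall>N\<ge>N0. dist (cinner (fejer N x') y') (cinner (\<Phi> x') y') < e / 2"
    using e metric_LIMSEQ_D half_gt_zero by blast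
  \<comment> \<open>The maximum with 1 secures \<open>0 < N\<close> for the norm bound.\<close>
  have "dist (cinner (fejer N x) y) (cinner (\<Phi> x) y) < e" if N: "N \<ge> max 1 N0" for N
  proof -
    let ?T = "\<lambda>h. fejer N h - \<Phi> h"
    have T: "?T \<in> bops" by (rule bop_diff[OF fejer_bop \<Phi>])
    have T_le: "cmod (cinner (?T u) v) \<le> 2 * r * norm u * norm v" for u v
    proof -
      have "cmod (cinner (?T u) v) \<le> cmod (cinner (fejer N u) v) + cmod (cinner (\<Phi> u) v)"
        unfolding cinner.diff_left by (rule norm_triangle_ineq4)
      also have "\<dots> \<le> r * norm u * norm v + r * norm u * norm v"
        using N by (intro add_mono cmod_fejer_le order_trans[OF cmod_cinner_le_norm] mult_right_mono \<Phi>_le) auto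
      finally show ?thesis by simp
    qed
    have "cinner (?T x) y = cinner (?T x') y' + (cinner (?T (x - x')) y + cinner (?T x') (y - y'))"
      unfolding bop_linear(2)[OF T] by (simp add: cinner.diff_left cinner.diff_right)
    then have "cmod (cinner (?T x) y)
        \<le> cmod (cinner (?T x') y') + (cmod (cinner (?T (x - x')) y) + cmod (cinner (?T x') (y - y')))"
      by (metis norm_triangle_le norm_triangle_ineq add_left_mono)
    also have "cmod (cinner (?T x') y') < e / 2"
      using N0' N by (simp add: dist_norm cinner.diff_left)
    also have "cmod (cinner (?T (x - x')) y) + cmod (cinner (?T x') (y - y')) \<le> ?e L"
    proof (rule add_mono)
      show "cmod (cinner (?T (x - x')) y) \<le> 2 * r * norm (x - trunc L x) * norm y"
        using T_le[of "x - x'" y] by (simp add: x'_def)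
      have "cmod (cinner (?T x') (y - y')) \<le> 2 * r * norm x' * norm (y - y')" by (rule T_le)
      also have "\<dots> \<le> 2 * r * norm x * norm (y - y')"
        using r by (intro mult_right_mono mult_left_mono) (auto simp: x'_def norm_restr_le)
      finally show "cmod (cinner (?T x') (y - y')) \<le> 2 * r * norm x * norm (y - trunc L y)"
        by (simp add: y'_def)
    qed
    finally show ?thesis using L by (simp add: dist_norm cinner.diff_left)
  qed
  then show "\<exists>N0. \<forall>N\<ge>N0. dist (cinner (fejer N x) y) (cinner (\<Phi> x) y) < e" by blast
qed

lemma intertwiner_R_infty_tensor: "\<Phi> \<in> R_infty_tensor b UNIV"
proof -
  have "fejer N \<in> op_cspan {tensor_op \<psi> Y | \<psi> Y. \<psi> \<in> R_infty b \<and> Y \<in> bops}" for N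
    unfolding fejer_def[abs_def]
  proof (rule sum_in_op_cspan[OF finite_words(2)])
    fix \<beta>
    let ?Y = "\<lambda>x. fejer_weight N (length \<beta>) *\<^sub>R symbol \<beta> x"
    have Y: "?Y \<in> bops" by (rule bop_scaleR[OF symbol_bop])
    then show "rmult b \<beta> ?Y \<in> {tensor_op \<psi> Y | \<psi> Y. \<psi> \<in> R_infty b \<and> Y \<in> bops}"
      using tensor_op_rmult[OF Y, of \<beta>, symmetric] rmult_R_infty[of \<beta>] by blast
  qed
  moreover have "limitin (wot UNIV UNIV) fejer \<Phi> sequentially"
    by (rule limitin_wotI[OF \<Phi> fejer_bop fejer_tendsto])
  ultimately show ?thesis
    unfolding R_infty_tensor_def by (intro in_wot_closure[of _ _ fejer]) (simp_all add: fock_sub_def)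
qed

end

end

section \<open>The domain of an admissible series\<close>

text \<open>Each \<open>W_\<alpha> W_\<alpha>^*\<close> is diagonal, and its entry at
  \<open>\<gamma>\<close> is nonzero only for prefixes \<open>\<alpha>\<close> of
  \<open>\<gamma>\<close>; this reduces all questions on defects to coefficients.\<close>

lemma fshift_bshift_nth:
  assumes b: "shift_weights b"
  shows "ell2_nth (fshift b \<alpha> (bshift b \<alpha> h)) \<gamma>
    = (if take (length \<alpha>) \<gamma> = \<alpha> then b (drop (length \<alpha>) \<gamma>) / b \<gamma> else 0) *\<^sub>R ell2_nth h \<gamma>"
    (is "_ = ?c *\<^sub>R _")
proof (rule cinner_ext)
  fix x
  have *: "cinner x (ell2_nth (fshift b \<alpha> (bshift b \<alpha> h)) \<gamma>) = cinner (bshift b \<alpha> (unit_vec \<gamma> x)) (bshift b \<alpha> h)"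
    by (simp only: cinner_unit_vec_left[symmetric] fshift_def cinner_ad[OF bshift_bop[OF b]])
  show "cinner x (ell2_nth (fshift b \<alpha> (bshift b \<alpha> h)) \<gamma>) = cinner x (?c *\<^sub>R ell2_nth h \<gamma>)"
  proof (cases "take (length \<alpha>) \<gamma> = \<alpha>")
    case True
    then obtain \<beta> where \<gamma>: "\<gamma> = \<alpha> @ \<beta>" by (metis append_take_drop_id)
    have "bshift b \<alpha> (unit_vec \<gamma> x) = sqrt (b \<beta> / b \<gamma>) *\<^sub>R unit_vec \<beta> x"
      by (rule ell2_eqI) (simp add: bshift_nth[OF b] unit_vec_nth ell2_nth_simps \<gamma>)
    moreover have "sqrt (b \<beta> / b \<gamma>) * sqrt (b \<beta> / b \<gamma>) = b \<beta> / b \<gamma>"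
      using weights_pos[OF b] by (simp add: less_imp_le)
    ultimately show ?thesis
      unfolding * by (simp add: \<gamma> cinner.scaleR_left cinner.scaleR_right cinner_unit_vec_left bshift_nth[OF b])
  next
    case False
    then have "bshift b \<alpha> (unit_vec \<gamma> x) = 0"
      by (intro ell2_eqI) (auto simp: bshift_nth[OF b] unit_vec_nth ell2_nth_simps)
    with False show ?thesis unfolding * by (simp add: cinner.zero_left cinner.zero_right)
  qed
qed

text \<open>The diagonal entry at \<open>\<gamma>\<close> of the \<open>k\<close>-th partial defect
  sum: a convolution truncated to prefixes of length at most \<open>k\<close>, hence complete once
  \<open>k\<close> reaches the length of \<open>\<gamma>\<close>.\<close>

definition defect_coeff :: "'n nc_series \<Rightarrow> 'n nc_series \<Rightarrow> nat \<Rightarrow> 'n nc_series"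
  where "defect_coeff a b k \<gamma> = (\<Sum>p\<le>min k (length \<gamma>). a (take p \<gamma>) * b (drop p \<gamma>)) / b \<gamma>"

context
  fixes b :: "'n::finite nc_series"
  assumes b: "shift_weights b"
begin

lemma defect_partial_eq:
  "defect_partial UNIV a (\<lambda>i. fshift b [i]) k h
    = (\<Sum>p\<le>k. \<Sum>\<alpha> | length \<alpha> = p. a \<alpha> *\<^sub>R fshift b \<alpha> (bshift b \<alpha> h))"
  by (simp add: defect_partial_def word_op_fshift[OF b] ad_fshift[OF b])

lemma defect_partial_bop: "defect_partial UNIV a (\<lambda>i. fshift b [i]) k \<in> bops"
proof -
  have "(\<lambda>h. \<Sum>p\<le>k. \<Sum>\<alpha> | length \<alpha> = p. a \<alpha> *\<^sub>R fshift b \<alpha> (bshift b \<alpha> h)) \<in> bops"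
    by (rule bop_sum, rule bop_sum, rule bop_scaleR, rule bop_comp[OF fshift_bop[OF b] bshift_bop[OF b]])
  then show ?thesis unfolding defect_partial_eq[symmetric] .
qed

lemma defect_partial_nth:
  "ell2_nth (defect_partial UNIV a (\<lambda>i. fshift b [i]) k h) \<gamma> = defect_coeff a b k \<gamma> *\<^sub>R ell2_nth h \<gamma>"
proof -
  have inner: "(\<Sum>\<alpha> | length \<alpha> = p. a \<alpha> * (if take (length \<alpha>) \<gamma> = \<alpha> then b (drop (length \<alpha>) \<gamma>) / b \<gamma> else 0))
      = (if p \<le> length \<gamma> then a (take p \<gamma>) * b (drop p \<gamma>) / b \<gamma> else 0)" for p
  proof (cases "p \<le> length \<gamma>")
    case True
    have "(\<Sum>\<alpha> | length \<alpha> = p. a \<alpha> * (if take (length \<alpha>) \<gamma> = \<alpha> then b (drop (length \<alpha>) \<gamma>) / b \<gamma> else 0))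
        = (\<Sum>\<alpha> | length \<alpha> = p. if \<alpha> = take p \<gamma> then a \<alpha> * b (drop p \<gamma>) / b \<gamma> else 0)"
      by (rule sum.cong) auto
    then show ?thesis using True finite_words(3)[of p, where ?'n = 'n] by (simp add: sum.delta)
  next
    case False
    then show ?thesis by (intro trans[OF sum.neutral]) auto
  qed
  have "ell2_nth (defect_partial UNIV a (\<lambda>i. fshift b [i]) k h) \<gamma>
      = (\<Sum>p\<le>k. \<Sum>\<alpha> | length \<alpha> = p. a \<alpha> * (if take (length \<alpha>) \<gamma> = \<alpha> then b (drop (length \<alpha>) \<gamma>) / b \<gamma> else 0))
        *\<^sub>R ell2_nth h \<gamma>"
    by (simp only: defect_partial_eq ell2_nth_sum ell2_nth_simps fshift_bshift_nth[OF b] scaleR_scaleR scaleR_sum_left)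
  also have "(\<Sum>p\<le>k. \<Sum>\<alpha> | length \<alpha> = p. a \<alpha> * (if take (length \<alpha>) \<gamma> = \<alpha> then b (drop (length \<alpha>) \<gamma>) / b \<gamma> else 0))
      = (\<Sum>p\<le>min k (length \<gamma>). a (take p \<gamma>) * b (drop p \<gamma>) / b \<gamma>)"
    unfolding inner by (rule sum.mono_neutral_cong_right) auto
  finally show ?thesis by (simp add: defect_coeff_def sum_divide_distrib)
qed

lemma defect_coeff_eq:
  assumes "length \<gamma> \<le> k"
  shows "defect_coeff a b k \<gamma> = nc_mult a b \<gamma> / b \<gamma>"
  using assms by (simp add: defect_coeff_def nc_mult_def min_absorb2)

end

text \<open>The entries of a diagonal operator are bounded by its norm. Thus condition (c), stated
  for scalar coefficients, yields a bound that serves for every coefficient space.\<close>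

lemma admissible_defect_coeff_bound:
  assumes b: "admissible b"
  shows "\<exists>C\<ge>0. \<forall>k \<gamma>. \<bar>defect_coeff (nc_inverse b) b k \<gamma>\<bar> \<le> C"
proof -
  note w = admissible_shift_weights[OF b]
  let ?d = "\<lambda>k. defect_partial UNIV (nc_inverse b) (\<lambda>i. fshift b [i]) k :: ('a, complex) fock \<Rightarrow> _"
  have "universal_model b = (\<lambda>i. fshift b [i])"
    by (rule ext) (rule universal_model_eq[OF w])
  then have "bdd_above (range (\<lambda>k. op_norm UNIV (?d k)))"
    using b by (simp add: admissible_def)
  then obtain C where C: "\<forall>k. op_norm UNIV (?d k) \<le> C" unfolding bdd_above_def by blast
  have "\<bar>defect_coeff (nc_inverse b) b k \<gamma>\<bar> \<le> C" for k \<gamma>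
  proof -
    have "\<bar>defect_coeff (nc_inverse b) b k \<gamma>\<bar> = norm (ell2_nth (?d k (unit_vec \<gamma> 1)) \<gamma>)"
      by (simp add: defect_partial_nth[OF w] unit_vec_nth)
    also have "\<dots> \<le> norm (?d k (unit_vec \<gamma> 1))" by (rule ell2_nth_norm_le)
    also have "\<dots> \<le> op_norm UNIV (?d k) * norm (unit_vec \<gamma> (1::complex))"
      by (rule norm_le_op_norm[OF defect_partial_bop[OF w]]) simp
    also have "\<dots> \<le> C" using C by (simp add: norm_unit_vec)
    finally show ?thesis .
  qed
  moreover from this[of 0 "[]"] have "C \<ge> 0" by linarith
  ultimately show ?thesis by blast
qed

text \<open>As the coefficients are those of the inverse series, the defect is the projection onto
  the coordinate at the empty word. Its conjugates by the words are the coordinate projections,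
  which add up to the identity.\<close>

lemma ampliation_pure_domain:
  fixes b :: "'n::finite nc_series"
  assumes b: "admissible b"
  shows "(ampliation b :: 'n \<Rightarrow> ('n, 'e::chilbert_space) fock \<Rightarrow> _) \<in> pure_domain b UNIV"
proof -
  note w = admissible_shift_weights[OF b]
  let ?X = "\<lambda>i. fshift b [i] :: ('n, 'e) fock \<Rightarrow> _"
  let ?d = "\<lambda>k. defect_partial UNIV (nc_inverse b) ?X k"
  let ?\<Delta> = "restr {[]} :: ('n, 'e) fock \<Rightarrow> _"
  have X: "ampliation b = ?X" by (rule ext) (rule ampliation_eq[OF w])
  obtain C where C: "C \<ge> 0" "\<forall>k \<gamma>. \<bar>defect_coeff (nc_inverse b) b k \<gamma>\<bar> \<le> C"
    using admissible_defect_coeff_bound[OF b] by blast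
  have d_le: "norm (?d k h) \<le> C * norm h" for k h
  proof -
    note P = pullback[OF inj_on_id C(2)[rule_format, of k] bop_id(1), where K = 1, simplified]
    have "?d k h = pullback (\<lambda>x. x) (defect_coeff (nc_inverse b) b k) id h"
      by (rule ell2_eqI) (simp add: defect_partial_nth[OF w] P(1) id_def[symmetric])
    then show ?thesis using P(2) by (simp add: id_def)
  qed
  \<comment> \<open>On words of length at most \<open>k\<close> the convolution is complete and
    equals that of the defect, so the error sees only longer words, where the uniform bound
    applies.\<close>
  have tail: "?d k h - ?\<Delta> h = ?d k (restr {\<gamma>. length \<gamma> \<ge> Suc k} h)" for k h
  proof (rule ell2_eqI)
    fix \<gamma>
    have "defect_coeff (nc_inverse b) b k \<gamma> = nc_one \<gamma>" if "length \<gamma> \<le> k"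
      using that by (simp add: defect_coeff_eq[OF w] nc_inverse[of b, OF weights_Nil[OF w]] nc_one_def weights_Nil[OF w])
    then show "ell2_nth (?d k h - ?\<Delta> h) \<gamma> = ell2_nth (?d k (restr {\<gamma>. length \<gamma> \<ge> Suc k} h)) \<gamma>"
      by (auto simp: ell2_nth_simps defect_partial_nth[OF w] restr_nth nc_one_def not_less_eq_eq)
  qed
  have d_lim: "(\<lambda>k. ?d k h) \<longlonglongrightarrow> ?\<Delta> h" for h
  proof -
    have "(\<lambda>k. C * norm (restr {\<gamma>. length \<gamma> \<ge> Suc k} h)) \<longlonglongrightarrow> 0"
      using LIMSEQ_Suc[OF tendsto_restr_length(2)[of h]]
      by (intro tendsto_mult_right_zero tendsto_norm_zero)
    then have "(\<lambda>k. ?d k h - ?\<Delta> h) \<longlonglongrightarrow> 0"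
      by (rule Lim_null_comparison[rotated]) (simp add: tail d_le)
    then show ?thesis by (simp add: LIM_zero_iff)
  qed
  have defect: "is_defect UNIV b ?X ?\<Delta>"
    unfolding is_defect_def
    by (rule limitin_wotI[OF restr_bop defect_partial_bop[OF w]]) (intro cinner.tendsto d_lim tendsto_const)
  have summand: "b \<alpha> *\<^sub>R fshift b \<alpha> (?\<Delta> (bshift b \<alpha> h)) = unit_vec \<alpha> (ell2_nth h \<alpha>)" for \<alpha> h
  proof -
    have "?\<Delta> (bshift b \<alpha> h) = unit_vec [] (sqrt (1 / b \<alpha>) *\<^sub>R ell2_nth h \<alpha>)"
      by (simp add: restr_finite bshift_nth[OF w] weights_Nil[OF w])
    then show ?thesis
      using weights_pos[OF w, of \<alpha>]
      by (simp add: fshift_unit_vec[OF w] weights_Nil[OF w] bop_linear(4)[OF unit_vec_bop]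
          bop_linear(4)[OF fshift_bop[OF w]] flip: real_sqrt_mult)
  qed
  have defect_sum: "is_defect_sum UNIV b ?X ?\<Delta> (\<lambda>h. h)"
    unfolding is_defect_sum_def word_op_fshift[OF w] ad_fshift[OF w]
  proof (rule limitin_wotI[OF bop_id(2)])
    show "(\<lambda>h. \<Sum>\<alpha>\<in>A. b \<alpha> *\<^sub>R fshift b \<alpha> (?\<Delta> (bshift b \<alpha> h))) \<in> bops" for A
      unfolding summand by (rule bop_sum) (rule bop_comp[OF unit_vec_bop ell2_nth_bop])
    fix x y :: "('n, 'e) fock"
    have "((\<lambda>A. cinner (restr A x) y) \<longlongrightarrow> cinner x y) (finite_subsets_at_top UNIV)"
      by (intro cinner.tendsto tendsto_restr tendsto_const)
    then show "((\<lambda>A. cinner (\<Sum>\<alpha>\<in>A. b \<alpha> *\<^sub>R fshift b \<alpha> (?\<Delta> (bshift b \<alpha> x))) y) \<longlongrightarrow> cinner x y)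
        (finite_subsets_at_top UNIV)"
      unfolding summand
      by (rule Lim_transform_eventually)
        (rule eventually_finite_subsets_at_top_weakI, simp add: restr_finite)
  qed
  have pos: "positive_op UNIV ?\<Delta>"
    by (simp add: positive_op_def restr_finite cinner_unit_vec_left cinner_self less_eq_complex_def)
  have "positive_op UNIV (\<lambda>x :: ('n, 'e) fock. x - x)"
    by (simp add: positive_op_def cinner.zero_left less_eq_complex_def)
  then show ?thesis
    unfolding X pure_domain_def nc_domain_def using defect defect_sum pos fshift_bop[OF w] by blast
qed

text \<open>The defect of \<open>g\<close> taken at the model of \<open>f\<close> has the diagonal
  entry \<open>nc_mult (nc_inverse g) f \<gamma> / f \<gamma>\<close>, which must be
  nonnegative.\<close>

lemma nc_domain_coeff_nonneg:
  fixes f g :: "'n::finite nc_series"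
  assumes f: "shift_weights f"
    and dom: "(ampliation f :: 'n \<Rightarrow> ('n, complex \<times> 'e::chilbert_space) fock \<Rightarrow> _) \<in> nc_domain g UNIV"
  shows "0 \<le> nc_mult (nc_inverse g) f \<gamma>"
proof -
  let ?X = "\<lambda>i. fshift f [i] :: ('n, complex \<times> 'e) fock \<Rightarrow> _"
  have X: "ampliation f = ?X" by (rule ext) (rule ampliation_eq[OF f])
  obtain \<Delta> where \<Delta>: "is_defect UNIV g ?X \<Delta>" "positive_op UNIV \<Delta>"
    using dom unfolding X nc_domain_def by blast
  \<comment> \<open>The scalar summand provides a unit vector even when \<open>'e\<close> is the
    zero space.\<close>
  let ?h = "unit_vec \<gamma> (1, 0) :: ('n, complex \<times> 'e) fock"
  let ?d = "\<lambda>k. defect_partial UNIV (nc_inverse g) ?X k"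
  let ?q = "nc_mult (nc_inverse g) f \<gamma> / f \<gamma>"
  have "(\<lambda>k. cinner (?d k ?h) ?h) \<longlonglongrightarrow> cinner (\<Delta> ?h) ?h"
    by (rule limitin_wotD[OF \<Delta>(1)[unfolded is_defect_def]]) auto
  moreover have "(\<lambda>k. cinner (?d k ?h) ?h) \<longlonglongrightarrow> complex_of_real ?q"
  proof (rule Lim_transform_eventually[OF tendsto_const])
    have "complex_of_real ?q = cinner (?d k ?h) ?h" if "length \<gamma> \<le> k" for k
      by (simp add: cinner_unit_vec_right defect_partial_nth[OF f] defect_coeff_eq[OF f that] unit_vec_nth
          cinner.scaleR_left cinner_prod_def cinner_complex_def cinner.zero_left scaleR_conv_of_real)
    then show "\<forall>\<^sub>F k in sequentially. complex_of_real ?q = cinner (?d k ?h) ?h"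
      by (intro eventually_sequentiallyI[of "length \<gamma>"])
  qed
  ultimately have "cinner (\<Delta> ?h) ?h = complex_of_real ?q" by (rule LIMSEQ_unique)
  moreover have "0 \<le> cinner (\<Delta> ?h) ?h" using \<Delta>(2) by (simp add: positive_op_def)
  ultimately have "0 \<le> complex_of_real ?q" by simp
  then have "0 \<le> ?q" by (simp add: less_eq_complex_def)
  then show ?thesis using weights_pos[OF f, of \<gamma>] by (simp add: zero_le_divide_iff)
qed


section \<open>The Poisson kernel of one model relative to another\<close>

text \<open>Equality case of Cauchy-Schwarz: the vector \<open>ad T (T x)\<close> has norm at most
  that of \<open>x\<close>, and its inner product with \<open>x\<close> is the squared norm of
  \<open>x\<close>.\<close>

lemma isometry_ad:
  assumes T: "T \<in> bops" and iso: "\<And>x. norm (T x) = norm x"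
  shows "ad T (T x) = x"
proof -
  have le: "norm (ad T (T x)) \<le> norm x"
    using norm_ad_le[OF T, of 1 "T x"] by (simp add: iso)
  have "Re (cinner (ad T (T x)) x) = (norm x)\<^sup>2"
    by (simp add: cinner_ad'[OF T] cinner_self iso)
  then have "inner (ad T (T x)) x = (norm x)\<^sup>2" by (simp only: Re_cinner)
  then have "(norm (ad T (T x) - x))\<^sup>2 = (norm (ad T (T x)))\<^sup>2 - (norm x)\<^sup>2"
    unfolding power2_norm_eq_inner by (simp add: algebra_simps inner_commute)
  also have "\<dots> \<le> 0" using power_mono[OF le norm_ge_zero, of 2] by simp
  finally show ?thesis by simp
qed

lemma ad_intertwine:
  assumes "S \<in> bops" "T \<in> bops" "U \<in> bops" and "\<And>x. S (T x) = U (S x)"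
  shows "ad T (ad S y) = ad S (ad U y)"
  using ad_comp[OF assms(1,2)] ad_comp[OF assms(3,1)] assms(4) by (simp add: fun_eq_iff)

locale poisson_kernel =
  fixes f g c :: "'n::finite nc_series"
  assumes f: "shift_weights f" and g: "shift_weights g" and c: "\<And>\<beta>. 0 \<le> c \<beta>" and gc: "nc_mult g c = f"
begin

lemma weight_le_1: "\<bar>sqrt (g \<alpha> * c \<beta> / f (\<alpha> @ \<beta>))\<bar> \<le> 1"
proof -
  have "g (take (length \<alpha>) (\<alpha> @ \<beta>)) * c (drop (length \<alpha>) (\<alpha> @ \<beta>)) \<le> nc_mult g c (\<alpha> @ \<beta>)"
    unfolding nc_mult_def
    by (rule member_le_sum) (auto simp: c weights_pos[OF g] less_imp_le)
  then have "g \<alpha> * c \<beta> \<le> f (\<alpha> @ \<beta>)" by (simp add: gc)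
  then show ?thesis
    using weights_pos[OF f, of "\<alpha> @ \<beta>"] weights_pos[OF g, of \<alpha>] c[of \<beta>] by (simp add: less_imp_le)
qed

text \<open>The coefficient of \<open>e_\<alpha>\<close> in the kernel, placed in the second summand
  of \<open>universe\<close>. It collects the coordinates of \<open>h\<close> at all words beginning
  with \<open>\<alpha>\<close>.\<close>

definition slice :: "'n list \<Rightarrow> ('n, 'e::chilbert_space) fock \<Rightarrow> ('n, 'e) universe"
  where "slice \<alpha> = pullback (\<lambda>\<beta>. \<alpha> @ \<beta>) (\<lambda>\<beta>. sqrt (g \<alpha> * c \<beta> / f (\<alpha> @ \<beta>))) (\<lambda>x. (0, x))"

definition kernel :: "('n, 'e::chilbert_space) fock \<Rightarrow> ('n, ('n, 'e) universe) fock"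
  where "kernel h = Abs_ell2 (\<lambda>\<alpha>. slice \<alpha> h)"

context
  fixes h :: "('n, 'e::chilbert_space) fock"
begin

lemma slice_nth: "ell2_nth (slice \<alpha> h) \<beta> = sqrt (g \<alpha> * c \<beta> / f (\<alpha> @ \<beta>)) *\<^sub>R (0, ell2_nth h (\<alpha> @ \<beta>))"
  and slice_bop: "(slice \<alpha> :: ('n, 'e) fock \<Rightarrow> _) \<in> bops"
proof -
  have inj: "inj (\<lambda>\<beta>. \<alpha> @ \<beta>)" by (simp add: inj_def)
  have Z: "(\<lambda>x :: 'e. (0 :: complex, x)) \<in> bops" by (rule bop_Pair[OF bop_zero bop_id(2)])
  have K: "norm (0 :: complex, x) \<le> 1 * norm x" for x :: 'e by (simp add: norm_Pair)
  note P = pullback[OF inj weight_le_1 Z K]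
  show "ell2_nth (slice \<alpha> h) \<beta> = sqrt (g \<alpha> * c \<beta> / f (\<alpha> @ \<beta>)) *\<^sub>R (0, ell2_nth h (\<alpha> @ \<beta>))"
    unfolding slice_def by (rule P(1)) simp
  show "(slice \<alpha> :: ('n, 'e) fock \<Rightarrow> _) \<in> bops" unfolding slice_def by (rule P(3)) simp
qed

text \<open>Over all splittings of \<open>\<gamma>\<close> the weights add up to
  \<open>nc_mult g c \<gamma> / f \<gamma> = 1\<close>; this makes the kernel isometric.\<close>

lemma slice_norm_has_sum: "((\<lambda>\<alpha>. (norm (slice \<alpha> h))\<^sup>2) has_sum (norm h)\<^sup>2) UNIV"
proof -
  define F where "F \<alpha> \<beta> = g \<alpha> * c \<beta> / f (\<alpha> @ \<beta>) * (norm (ell2_nth h (\<alpha> @ \<beta>)))\<^sup>2" for \<alpha> \<beta>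
  have q: "0 \<le> g \<alpha> * c \<beta> / f (\<alpha> @ \<beta>)" for \<alpha> \<beta>
    using weights_pos[OF f] weights_pos[OF g] c by (simp add: less_imp_le)
  have F: "0 \<le> F \<alpha> \<beta>" for \<alpha> \<beta> unfolding F_def by (rule mult_nonneg_nonneg[OF q]) simp
  have "(\<Sum>k\<le>length \<gamma>. F (take k \<gamma>) (drop k \<gamma>)) = nc_mult g c \<gamma> / f \<gamma> * (norm (ell2_nth h \<gamma>))\<^sup>2" for \<gamma>
    by (simp add: F_def nc_mult_def sum_divide_distrib sum_distrib_right)
  then have "(\<Sum>k\<le>length \<gamma>. F (take k \<gamma>) (drop k \<gamma>)) = (norm (ell2_nth h \<gamma>))\<^sup>2" for \<gamma>
    using weights_pos[OF f, of \<gamma>] by (simp add: gc)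
  then have "((\<lambda>\<gamma>. \<Sum>k\<le>length \<gamma>. F (take k \<gamma>) (drop k \<gamma>)) has_sum (norm h)\<^sup>2) UNIV"
    using ell2_norm_has_sum[of h] by simp
  from has_sum_concat(3)[OF F this]
  have "((\<lambda>\<alpha>. \<Sum>\<^sub>\<infinity>\<beta>. F \<alpha> \<beta>) has_sum (norm h)\<^sup>2) UNIV" .
  moreover have "(\<Sum>\<^sub>\<infinity>\<beta>. F \<alpha> \<beta>) = (norm (slice \<alpha> h))\<^sup>2" for \<alpha>
    unfolding ell2_norm_sq slice_nth F_def norm_scaleR power_mult_distrib using q
    by (intro infsum_cong) (simp add: norm_Pair)
  ultimately show ?thesis by simp
qed

lemma kernel_nth: "ell2_nth (kernel h) \<alpha> = slice \<alpha> h"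
  unfolding kernel_def by (simp add: ell2_nth_Abs has_sum_imp_summable[OF slice_norm_has_sum])

lemma norm_kernel: "norm (kernel h) = norm h"
proof -
  have "(norm (kernel h))\<^sup>2 = (norm h)\<^sup>2"
    using has_sum_unique[OF ell2_norm_has_sum[of "kernel h"]] slice_norm_has_sum by (simp add: kernel_nth)
  then show ?thesis by (simp add: power2_eq_iff_nonneg)
qed

end

lemma kernel_bop: "kernel \<in> bops"
  by (rule bopI[of _ 1])
    (auto intro!: ell2_eqI[where g = "_ + _"] ell2_eqI[where g = "_ *\<^sub>C _"]
      simp: kernel_nth plus_ell2.rep_eq[of "kernel _"] scaleC_ell2.rep_eq[of _ "kernel _"] norm_kernel
        bop_linear(1)[OF slice_bop] bop_scaleC[OF slice_bop])

text \<open>Stripping \<open>i\<close> from the whole word strips it from its left part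
  \<open>\<alpha>\<close>. On one side the weight of \<open>f\<close> at
  \<open>\<alpha> @ \<beta>\<close> cancels, on the other that of \<open>g\<close> at
  \<open>i # \<alpha>\<close>.\<close>

lemma kernel_bshift: "kernel (bshift f [i] h) = bshift g [i] (kernel h)"
proof (rule ell2_eqI, rule ell2_eqI)
  fix \<alpha> \<beta>
  have "sqrt (g \<alpha> * c \<beta> / f (\<alpha> @ \<beta>)) * sqrt (f (\<alpha> @ \<beta>) / f (i # \<alpha> @ \<beta>))
      = sqrt (g \<alpha> / g (i # \<alpha>)) * sqrt (g (i # \<alpha>) * c \<beta> / f (i # \<alpha> @ \<beta>))"
    using weights_pos[OF f, of "\<alpha> @ \<beta>"] weights_pos[OF g, of "i # \<alpha>"] by (simp flip: real_sqrt_mult)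
  then show "ell2_nth (ell2_nth (kernel (bshift f [i] h)) \<alpha>) \<beta> = ell2_nth (ell2_nth (bshift g [i] (kernel h)) \<alpha>) \<beta>"
    by (simp add: kernel_nth slice_nth bshift_nth[OF f] bshift_nth[OF g] scaleR_ell2.rep_eq)
qed

end


section \<open>Regular series\<close>

text \<open>Here \<open>c\<close> is 1 minus the inverse, so both c g and g c agree with g off the
  empty word. The identity on the left drives the lifting; the one on the right bounds the ratios
  that make right multiplications bounded.\<close>

lemma
  fixes g :: "'n nc_series"
  assumes g: "shift_weights g" and reg: "regular g"
  defines "c \<equiv> \<lambda>\<alpha>. nc_one \<alpha> - nc_inverse g \<alpha>"
  shows regular_nonneg: "0 \<le> c \<alpha>" and regular_Nil: "c [] = 0"
    and regular_rec: "\<gamma> \<noteq> [] \<Longrightarrow> nc_mult c g \<gamma> = g \<gamma>"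
    and regular_right_bound: "\<exists>C. \<forall>\<alpha>. g \<alpha> / g (\<alpha> @ \<beta>) \<le> C"
proof -
  note inv = nc_inverse[of g, OF weights_Nil[OF g]]
  have "nc_inverse g [] = 1"
    using fun_cong[OF inv(1), of "[]"] by (simp add: nc_mult_def nc_one_def weights_Nil[OF g])
  then show c_Nil: "c [] = 0" by (simp add: c_def nc_one_def)
  show c_nonneg: "0 \<le> c \<alpha>" for \<alpha>
  proof (cases "\<alpha> = []")
    case False
    then have "nc_inverse g \<alpha> \<le> 0" using reg by (cases \<alpha>) (auto simp: regular_def)
    then show ?thesis using False by (simp add: c_def nc_one_def)
  qed (simp add: c_Nil)
  have "nc_mult c g \<gamma> = nc_mult nc_one g \<gamma> - nc_mult (nc_inverse g) g \<gamma>" for \<gamma>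
    by (simp add: nc_mult_def c_def left_diff_distrib sum_subtractf)
  then show "\<gamma> \<noteq> [] \<Longrightarrow> nc_mult c g \<gamma> = g \<gamma>" by (simp add: inv nc_mult_one nc_one_def)
  have "nc_mult g c \<gamma> = nc_mult g nc_one \<gamma> - nc_mult g (nc_inverse g) \<gamma>" for \<gamma>
    by (simp add: nc_mult_def c_def right_diff_distrib sum_subtractf)
  then have right: "nc_mult g c \<gamma> = g \<gamma>" if "\<gamma> \<noteq> []" for \<gamma> using that by (simp add: inv nc_mult_one nc_one_def)
  show "\<exists>C. \<forall>\<alpha>. g \<alpha> / g (\<alpha> @ \<beta>) \<le> C"
  proof (induction \<beta> rule: rev_induct)
    case Nil
    show ?case using weights_pos[OF g] by (intro exI[of _ 1]) (simp add: less_imp_neq[symmetric])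
  next
    case (snoc i \<beta>)
    then obtain C where C: "\<forall>\<alpha>. g \<alpha> / g (\<alpha> @ \<beta>) \<le> C" by blast
    \<comment> \<open>Strict negativity at single letters permits division here: one term of the
      convolution gives \<open>g \<gamma> * c [i] \<le> g (\<gamma> @ [i])\<close>.\<close>
    have ci: "c [i] > 0" using reg by (simp add: c_def nc_one_def regular_def)
    have "g \<alpha> / g (\<alpha> @ \<beta> @ [i]) \<le> C / c [i]" for \<alpha>
    proof -
      let ?\<gamma> = "\<alpha> @ \<beta>"
      have "g (take (length ?\<gamma>) (?\<gamma> @ [i])) * c (drop (length ?\<gamma>) (?\<gamma> @ [i])) \<le> nc_mult g c (?\<gamma> @ [i])"
        unfolding nc_mult_def
        by (rule member_le_sum) (auto simp: c_nonneg weights_pos[OF g] less_imp_le)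
      then have le: "g ?\<gamma> * c [i] \<le> g (?\<gamma> @ [i])" by (simp add: right)
      have "g \<alpha> / g (?\<gamma> @ [i]) \<le> g \<alpha> / (g ?\<gamma> * c [i])"
        using weights_pos[OF g] ci by (intro divide_left_mono le mult_pos_pos) (auto simp: less_imp_le)
      also have "\<dots> = g \<alpha> / g ?\<gamma> / c [i]" by simp
      also have "\<dots> \<le> C / c [i]" using C ci by (intro divide_right_mono) auto
      finally show ?thesis by simp
    qed
    then show ?case by blast
  qed
qed


section \<open>The lifting theorem\<close>

text \<open>Composing with the projection makes \<open>X\<close> everywhere defined without
  enlarging its norm.\<close>

lemma bop_comp_proj:
  assumes M: "closed_csubspace M" and X: "X \<in> bop M N"
  shows "(\<lambda>x. X (proj M x)) \<in> bops" and "norm (X (proj M x)) \<le> op_norm M X * norm x"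
proof -
  have M0: "0 \<in> M" using closed_csubspaceD(1)[OF M] by (rule csubspaceD)
  show le: "norm (X (proj M x)) \<le> op_norm M X * norm x" for x
    using order_trans[OF norm_le_op_norm[OF X proj_spec(1)[OF M]]
        mult_left_mono[OF norm_proj_le[OF M] op_norm_nonneg[OF X M0]]] .
  show "(\<lambda>x. X (proj M x)) \<in> bops"
  proof (rule bopI[OF _ _ le])
    show "X (proj M (x + y)) = X (proj M x) + X (proj M y)" for x y
      using X proj_spec(1)[OF M] by (simp add: bop_linear(1)[OF proj_bop[OF M]] bop_def)
    show "X (proj M (a *\<^sub>C x)) = a *\<^sub>C X (proj M x)" for a x
      using X proj_spec(1)[OF M] by (simp add: bop_scaleC[OF proj_bop[OF M]] bop_def)
  qed
qed

theorem theorem5p2: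
  fixes f g :: "'n::finite nc_series"
    and G1 :: "('n, 'e::chilbert_space) fock set"
    and G2 :: "('n, 'es::chilbert_space) fock set"
    and X :: "('n, 'e) fock \<Rightarrow> ('n, 'es) fock"
  assumes "admissible f" and "admissible g"
    and "regular g"
    and "\<And>H :: ('n, 'es) universe set. closed_csubspace H \<Longrightarrow> pure_domain f H \<subseteq> pure_domain g H"
    and "closed_csubspace G1" and "\<And>i. coinvariant (ampliation g i) G1"
    and "closed_csubspace G2" and "\<And>i. coinvariant (ampliation f i) G2"
    and "contraction G1 G2 X"
    and "\<And>i x. x \<in> G1 \<Longrightarrow> X (proj G1 (ampliation g i x)) = proj G2 (ampliation f i (X x))"
  shows "\<exists>\<Gamma> :: ('n, 'e) fock \<Rightarrow> ('n, 'es) fock.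
    contraction UNIV UNIV \<Gamma>
    \<and> (\<forall>i. \<Gamma> \<circ> ampliation g i = ampliation f i \<circ> \<Gamma>)
    \<and> (\<forall>y\<in>G2. adj G1 G2 X y = adj UNIV UNIV \<Gamma> y)
    \<and> op_norm UNIV \<Gamma> = op_norm G1 X
    \<and> (\<exists>(K :: ('n, 'es) universe set)
          (\<Phi> :: ('n, 'e) fock \<Rightarrow> ('n, ('n, 'es) universe) fock)
          (F :: ('n, ('n, 'es) universe) fock \<Rightarrow> ('n, 'es) fock).
        closed_csubspace K
        \<and> contraction UNIV (fock_sub K) \<Phi>
        \<and> (\<forall>i. \<Phi> \<circ> ampliation g i = ampliation g i \<circ> \<Phi>)
        \<and> \<Phi> \<in> R_infty_tensor g K
        \<and> coisometry (fock_sub K) UNIV F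
        \<and> (\<forall>i. \<forall>h\<in>fock_sub K. F (ampliation g i h) = ampliation f i (F h))
        \<and> \<Gamma> = F \<circ> \<Phi>)"
proof -
  note f = admissible_shift_weights[OF assms(1)] and g = admissible_shift_weights[OF assms(2)]
  note G1 = assms(5) and G2 = assms(7)
  let ?c = "nc_mult (nc_inverse g) f"
  \<comment> \<open>The inclusion of domains is tested on the model of \<open>f\<close> itself,
    amplified to \<open>universe\<close>.\<close>
  have "(ampliation f :: 'n \<Rightarrow> ('n, 'es) universe \<Rightarrow> _) \<in> nc_domain g UNIV"
    using ampliation_pure_domain[OF assms(1)] assms(4)[OF closed_csubspace_UNIV] by (auto simp: pure_domain_def)
  then have c: "0 \<le> ?c \<beta>" for \<beta> by (rule nc_domain_coeff_nonneg[OF f])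
  have "nc_mult g ?c = f"
    by (simp add: nc_mult_assoc[symmetric] nc_inverse[of g, OF weights_Nil[OF g]] nc_mult_one)
  then interpret poisson_kernel f g ?c using f g c by unfold_locales
  let ?K = "kernel :: ('n, 'es) fock \<Rightarrow> ('n, ('n, 'es) universe) fock"
  define F where "F = ad ?K"
  have F: "F \<in> bops" unfolding F_def by (rule ad_bop[OF kernel_bop])
  have F_le: "norm (F h) \<le> norm h" for h
    unfolding F_def using norm_ad_le[OF kernel_bop, of 1 h] by (simp add: norm_kernel)
  have F_kernel: "F (kernel h) = h" for h
    unfolding F_def by (rule isometry_ad[OF kernel_bop norm_kernel])
  have F_int: "F (fshift g [i] h) = fshift f [i] (F h)" for i h
    unfolding F_def fshift_def
    by (rule ad_intertwine[symmetric]) (simp_all add: kernel_bop bshift_bop[OF f] bshift_bop[OF g] kernel_bshift)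

  have X: "X \<in> bop G1 G2" and X_le: "op_norm G1 X \<le> 1" using assms(9) by (auto simp: contraction_def)
  define r where "r = op_norm G1 X"
  have G10: "0 \<in> G1" by (rule csubspaceD(1)[OF closed_csubspaceD(1)[OF G1]])
  have r: "0 \<le> r" unfolding r_def by (rule op_norm_nonneg[OF X G10])
  define XP where "XP = (\<lambda>x. X (proj G1 x))"
  have XP: "XP \<in> bops" and XP_le: "norm (XP x) \<le> r * norm x" for x
    unfolding XP_def r_def by (rule bop_comp_proj[OF G1 X])+
  define C0 where "C0 = ad XP"
  have C0: "C0 \<in> bops" unfolding C0_def by (rule ad_bop[OF XP])
  have C0_le: "norm (C0 y) \<le> r * norm y" for y unfolding C0_def by (rule norm_ad_le[OF XP XP_le r])
  have cinner_C0: "cinner x (C0 y) = cinner (XP x) y" for x y unfolding C0_def by (rule cinner_ad[OF XP, symmetric])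
  have C0_eq: "C0 y = adj G1 G2 X y" for y
  proof (rule cinner_ext)
    fix x
    show "cinner x (C0 y) = cinner x (adj G1 G2 X y)"
      unfolding cinner_C0 XP_def adj_spec(2)[OF G1 X proj_spec(1)[OF G1]]
      by (rule proj_spec(2)[OF G1 adj_spec(1)[OF G1 X]])
  qed
  have C0_G1: "C0 y \<in> G1" for y unfolding C0_eq by (rule adj_spec(1)[OF G1 X])
  have G1_inv: "bshift g [i] x \<in> G1" if "x \<in> G1" for i x
    using assms(6)[of i] that by (simp add: coinvariant_def ampliation_eq[OF g] ad_fshift[OF g])
  have G2_inv: "bshift f [i] y \<in> G2" if "y \<in> G2" for i y
    using assms(8)[of i] that by (simp add: coinvariant_def ampliation_eq[OF f] ad_fshift[OF f])
  \<comment> \<open>Taking adjoints removes the compressions: by co-invariance the backward shifts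
    map \<open>G1\<close> and \<open>G2\<close> into themselves, so both projections can be moved
    away.\<close>
  have C0_int: "C0 (bshift f [i] y) = bshift g [i] (C0 y)" if y: "y \<in> G2" for i y
  proof (rule cinner_ext)
    fix z
    let ?z = "proj G1 z"
    have z: "?z \<in> G1" by (rule proj_spec(1)[OF G1])
    have "cinner z (C0 (bshift f [i] y)) = cinner (fshift f [i] (X ?z)) y"
      by (simp only: cinner_C0 XP_def cinner_fshift[OF f])
    also have "\<dots> = cinner (proj G2 (fshift f [i] (X ?z))) y" by (rule proj_spec(2)[OF G2 y, symmetric])
    also have "\<dots> = cinner (XP (fshift g [i] ?z)) y"
      using assms(10)[OF z, of i] by (simp add: ampliation_eq[OF f] ampliation_eq[OF g] XP_def)
    also have "\<dots> = cinner ?z (bshift g [i] (C0 y))" by (simp only: cinner_C0[symmetric] cinner_fshift[OF g])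
    also have "\<dots> = cinner z (bshift g [i] (C0 y))" by (rule proj_spec(2)[OF G1 G1_inv[OF C0_G1]])
    finally show "cinner z (C0 (bshift f [i] y)) = cinner z (bshift g [i] (C0 y))" .
  qed

  have "\<exists>A\<in>bops. (\<forall>h. norm (A h) \<le> r * norm h) \<and> (\<forall>i h. A (bshift g [i] h) = bshift g [i] (A h))
    \<and> (\<forall>h\<in>kernel ` G2. A h = C0 (F h))"
  proof (rule commutant_lifting[OF g regular_nonneg[OF g assms(3)] regular_Nil[OF g assms(3)]
        regular_rec[OF g assms(3)] bop_comp[OF C0 F] _ r csubspace_image[OF kernel_bop closed_csubspaceD(1)[OF G2]]])
    show "norm (C0 (F h)) \<le> r * norm h" for h
      by (rule order_trans[OF C0_le mult_left_mono[OF F_le r]])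
    show "bshift g [i] h \<in> kernel ` G2" if "h \<in> kernel ` G2" for i h
      using that G2_inv by (auto simp: kernel_bshift[symmetric])
    show "C0 (F (bshift g [i] h)) = bshift g [i] (C0 (F h))" if "h \<in> kernel ` G2" for i h
      using that by (auto simp: kernel_bshift[symmetric] F_kernel C0_int)
  qed
  then obtain A where A: "A \<in> bops" and A_le: "\<forall>h. norm (A h) \<le> r * norm h"
    and A_int: "\<forall>i h. A (bshift g [i] h) = bshift g [i] (A h)" and A_eq: "\<forall>y\<in>G2. A (kernel y) = C0 y"
    by (auto simp: F_kernel)
  define \<Phi> where "\<Phi> = ad A"
  have \<Phi>: "\<Phi> \<in> bops" unfolding \<Phi>_def by (rule ad_bop[OF A])
  have \<Phi>_le: "norm (\<Phi> h) \<le> r * norm h" for h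
    unfolding \<Phi>_def by (rule norm_ad_le[OF A A_le[rule_format] r])
  have \<Phi>_int: "\<Phi> (fshift g [i] h) = fshift g [i] (\<Phi> h)" for i h
    unfolding \<Phi>_def fshift_def
    by (rule ad_intertwine[symmetric]) (simp_all add: A bshift_bop[OF g] A_int)
  define \<Gamma> where "\<Gamma> = (\<lambda>h. F (\<Phi> h))"
  have \<Gamma>: "\<Gamma> \<in> bops" unfolding \<Gamma>_def by (rule bop_comp[OF F \<Phi>])
  have \<Gamma>_le: "norm (\<Gamma> h) \<le> r * norm h" for h
    unfolding \<Gamma>_def by (rule order_trans[OF F_le \<Phi>_le])
  have ad_\<Gamma>: "ad \<Gamma> y = A (kernel y)" for y
    unfolding \<Gamma>_def ad_comp[OF F \<Phi>] by (simp add: \<Phi>_def F_def ad_ad[OF A] ad_ad[OF kernel_bop])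
  have norm_\<Gamma>: "op_norm UNIV \<Gamma> \<le> r" by (rule op_norm_le[OF \<Gamma>_le r]) simp
  \<comment> \<open>For \<open>x\<close> in \<open>G1\<close> the vector \<open>X x\<close> lies in
    \<open>G2\<close>, where the adjoints of \<open>X\<close> and \<open>\<Gamma>\<close> agree;
    hence the squared norm of \<open>X x\<close> is the inner product of \<open>\<Gamma> x\<close>
    with \<open>X x\<close>.\<close>
  have "r \<le> op_norm UNIV \<Gamma>"
    unfolding r_def
  proof (rule op_norm_le[OF _ op_norm_nonneg[OF \<Gamma>]])
    fix x assume x: "x \<in> G1"
    have Xx: "X x \<in> G2" using X x by (simp add: bop_def)
    have "complex_of_real ((norm (X x))\<^sup>2) = cinner (X x) (X x)" by (rule cinner_self[symmetric])
    also have "\<dots> = cinner x (ad \<Gamma> (X x))"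
      using A_eq Xx adj_spec(2)[OF G1 X x, of "X x"] by (simp add: ad_\<Gamma> C0_eq)
    also have "\<dots> = cinner (\<Gamma> x) (X x)" by (rule cinner_ad[OF \<Gamma>, symmetric])
    finally have "(norm (X x))\<^sup>2 = cmod (cinner (\<Gamma> x) (X x))"
      by (metis abs_of_nonneg norm_of_real zero_le_power2)
    also have "\<dots> \<le> op_norm UNIV \<Gamma> * norm x * norm (X x)"
      by (rule order_trans[OF cmod_cinner_le_norm mult_right_mono[OF norm_le_op_norm[OF \<Gamma> UNIV_I] norm_ge_zero]])
    finally show "norm (X x) \<le> op_norm UNIV \<Gamma> * norm x"
      using op_norm_nonneg[OF \<Gamma> UNIV_I] by (cases "X x = 0") (simp_all add: power2_eq_square)
  qed (use G10 in auto)
  then have 1: "op_norm UNIV \<Gamma> = op_norm G1 X" using norm_\<Gamma> by (simp add: r_def)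
  have 2: "contraction UNIV UNIV \<Gamma>"
    using \<Gamma> norm_\<Gamma> X_le by (simp add: contraction_def r_def)
  have 3: "\<Gamma> \<circ> ampliation g i = ampliation f i \<circ> \<Gamma>" for i
    by (rule ext) (simp add: ampliation_eq[OF f] ampliation_eq[OF g] \<Gamma>_def \<Phi>_int F_int)
  have 4: "adj G1 G2 X y = ad \<Gamma> y" if "y \<in> G2" for y
    using A_eq that by (simp add: ad_\<Gamma> C0_eq)
  \<comment> \<open>The space called F in the theorem is taken to be all of
    \<open>universe\<close>.\<close>
  have sub: "fock_sub UNIV = UNIV" by (simp add: fock_sub_def)
  have 5: "contraction UNIV (fock_sub UNIV) \<Phi>"
    using \<Phi> order_trans[OF op_norm_le[OF \<Phi>_le r UNIV_not_empty]] X_le by (simp add: contraction_def r_def sub)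
  have 6: "\<Phi> \<circ> ampliation g i = ampliation g i \<circ> \<Phi>" for i
    by (rule ext) (simp add: ampliation_eq[OF g] \<Phi>_int)
  have 7: "\<Phi> \<in> R_infty_tensor g UNIV"
    by (rule intertwiner_R_infty_tensor[OF g regular_right_bound[OF g assms(3)] \<Phi> \<Phi>_le r \<Phi>_int])
  have 8: "coisometry (fock_sub UNIV) UNIV F"
    using F by (simp add: coisometry_def sub) (simp add: F_def ad_ad[OF kernel_bop] F_kernel[unfolded F_def])
  have 9: "F (ampliation g i h) = ampliation f i (F h)" for i h
    by (simp add: ampliation_eq[OF f] ampliation_eq[OF g] F_int)
  have 10: "\<Gamma> = F \<circ> \<Phi>" by (simp add: \<Gamma>_def comp_def)
  show ?thesis
    by (rule exI[of _ \<Gamma>], intro conjI allI ballI exI[of _ "UNIV :: ('n, 'es) universe set"] exI[of _ \<Phi>] exI[of _ F])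
      (rule 1 2 3 4 5 6 7 8 9 10 closed_csubspace_UNIV, assumption?)+
qed

end
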